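(* Let $m,n\ge 1$ be integers, let $D\subset\mathbb{R}^m$ be a smoothly bounded domain, and let $\Omega=(\Omega_{ij})_{1\le i,j\le n}$ with $\Omega_{ij}\in L^2(D,\mathbb{R}^m)$ and $\Omega_{ij}=-\Omega_{ji}$ for all $1\le i,j\le n$. Then there exists $P\in W^{1,2}(D,SO(n))$ such that $$\operatorname{div}\big(P^T\nabla P-P^T\Omega P\big)=0\quad\text{in } D,$$ and $$\|\nabla P\|_{L^2(D)}+\|P^T\nabla P-P^T\Omega P\|_{L^2(D)}\le 3\,\|\Omega\|_{L^2(D)}.$$
   Context: $W^{1,2}(D,SO(n))$ denotes the set of all $Q\in W^{1,2}(D,\mathbb{R}^{n\times n})$ such that $Q(x)\in SO(n)$ (i.e. $Q(x)$ is orthogonal with positive determinant) for almost every $x\in D$. "Smoothly bounded domain" means a bounded domain with smooth boundary. The expression $P^T\nabla P-P^T\Omega P$ is the $n\times n$ matrix of $\mathbb{R}^m$-valued functions with entries $P^T_{ik}\nabla P_{kj}-P^T_{ik}\Omega_{kl}P_{lj}$ (summation over repeated indices), $\nabla=(\partial_1,\dots,\partial_m)^T$. The divergence equation is understood entrywise ($1\le i,j\le n$) in the weak (distributional) sense. $|\cdot|$ is the Hilbert–Schmidt norm of matrices and tensors, and the $L^2$ norms are taken with respect to it. *)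

theory Defs
  imports "HOL-Analysis.Analysis"
begin

text \<open>Intended for open \<open>S\<close>, where the derivative at a point does not depend on values outside \<open>S\<close>.\<close>

primrec Ck_on :: "nat \<Rightarrow> 'a::real_normed_vector set \<Rightarrow> ('a \<Rightarrow> 'b::real_normed_vector) \<Rightarrow> bool" where
  "Ck_on 0 S f \<longleftrightarrow> continuous_on S f"
| "Ck_on (Suc k) S f \<longleftrightarrow>
     (\<forall>x\<in>S. f differentiable (at x)) \<and>
     (\<forall>v. Ck_on k S (\<lambda>x. frechet_derivative f (at x) v))"

definition smooth_on :: "'a::real_normed_vector set \<Rightarrow> ('a \<Rightarrow> 'b::real_normed_vector) \<Rightarrow> bool" where
  "smooth_on S f \<longleftrightarrow> (\<forall>k. Ck_on k S f)"

text \<open>Near each boundary point, after a rotation taking the unit vector \<open>e\<close> to the last coordinate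
  direction, \<open>D\<close> is the set strictly above the graph of a smooth function \<open>\<gamma>\<close> of the remaining
  \<open>m - 1\<close> coordinates.  These are the coordinates of \<open>x - (x \<bullet> e) *\<^sub>R e\<close>, so only the restriction
  of \<open>\<gamma>\<close> to the hyperplane orthogonal to \<open>e\<close> matters.\<close>

definition smooth_boundary :: "'a::euclidean_space set \<Rightarrow> bool" where
  "smooth_boundary D \<longleftrightarrow>
     (\<forall>p\<in>frontier D. \<exists>r>0. \<exists>e. \<exists>\<gamma>::'a \<Rightarrow> real. norm e = 1 \<and> smooth_on UNIV \<gamma> \<and>
        D \<inter> ball p r = {x \<in> ball p r. x \<bullet> e > \<gamma> (x - (x \<bullet> e) *\<^sub>R e)})"

definition smoothly_bounded_domain :: "'a::euclidean_space set \<Rightarrow> bool" where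
  "smoothly_bounded_domain D \<longleftrightarrow>
     open D \<and> connected D \<and> D \<noteq> {} \<and> bounded D \<and> smooth_boundary D"

definition L2_on :: "'a::euclidean_space set \<Rightarrow> ('a \<Rightarrow> 'b::euclidean_space) set" where
  "L2_on D = {f. f \<in> borel_measurable (lebesgue_on D) \<and>
                 integrable (lebesgue_on D) (\<lambda>x. (norm (f x))\<^sup>2)}"

text \<open>On \<open>real ^ 'n ^ 'n\<close> and \<open>real ^ 'm ^ 'n ^ 'n\<close> the library norm is the square root of the sum
  of the squares of all entries, that is, the Hilbert-Schmidt norm.\<close>

definition L2_norm_on :: "'a::euclidean_space set \<Rightarrow> ('a \<Rightarrow> 'b::euclidean_space) \<Rightarrow> real" where
  "L2_norm_on D f = sqrt (integral\<^sup>L (lebesgue_on D) (\<lambda>x. (norm (f x))\<^sup>2))"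

definition locally_integrable_on :: "'a::euclidean_space set \<Rightarrow> ('a \<Rightarrow> 'b::euclidean_space) \<Rightarrow> bool" where
  "locally_integrable_on D f \<longleftrightarrow> (\<forall>K. compact K \<and> K \<subseteq> D \<longrightarrow> f absolutely_integrable_on K)"

definition test_function :: "'a::euclidean_space set \<Rightarrow> ('a \<Rightarrow> real) \<Rightarrow> bool" where
  "test_function D \<phi> \<longleftrightarrow>
     smooth_on UNIV \<phi> \<and> compact (closure {x. \<phi> x \<noteq> 0}) \<and> closure {x. \<phi> x \<noteq> 0} \<subseteq> D"

definition grad :: "(real ^ 'm::finite \<Rightarrow> real) \<Rightarrow> real ^ 'm \<Rightarrow> real ^ 'm" where
  "grad \<phi> x = (\<chi> a. frechet_derivative \<phi> (at x) (axis a 1))"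

definition has_weak_gradient ::
    "(real ^ 'm::finite) set \<Rightarrow> (real ^ 'm \<Rightarrow> real) \<Rightarrow> (real ^ 'm \<Rightarrow> real ^ 'm) \<Rightarrow> bool" where
  "has_weak_gradient D f g \<longleftrightarrow>
     locally_integrable_on D f \<and> locally_integrable_on D g \<and>
     (\<forall>\<phi>. test_function D \<phi> \<longrightarrow>
        integral\<^sup>L (lebesgue_on D) (\<lambda>x. f x *\<^sub>R grad \<phi> x)
        = - integral\<^sup>L (lebesgue_on D) (\<lambda>x. \<phi> x *\<^sub>R g x))"

definition has_weak_divergence ::
    "(real ^ 'm::finite) set \<Rightarrow> (real ^ 'm \<Rightarrow> real ^ 'm) \<Rightarrow> (real ^ 'm \<Rightarrow> real) \<Rightarrow> bool" where
  "has_weak_divergence D F h \<longleftrightarrow>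
     locally_integrable_on D F \<and> locally_integrable_on D h \<and>
     (\<forall>\<phi>. test_function D \<phi> \<longrightarrow>
        integral\<^sup>L (lebesgue_on D) (\<lambda>x. F x \<bullet> grad \<phi> x)
        = - integral\<^sup>L (lebesgue_on D) (\<lambda>x. h x * \<phi> x))"

definition W12 :: "(real ^ 'm::finite) set \<Rightarrow> (real ^ 'm \<Rightarrow> real) set" where
  "W12 D = {f. f \<in> L2_on D \<and> (\<exists>g. g \<in> L2_on D \<and> has_weak_gradient D f g)}"

definition W12_SO :: "(real ^ 'm::finite) set \<Rightarrow> (real ^ 'm \<Rightarrow> real ^ 'n::finite ^ 'n) set" where
  "W12_SO D = {Q. (\<forall>i j. (\<lambda>x. Q x $ i $ j) \<in> W12 D) \<and>
                  (AE x in lebesgue_on D. orthogonal_matrix (Q x) \<and> det (Q x) > 0)}"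

definition has_weak_gradient_matrix ::
    "(real ^ 'm::finite) set \<Rightarrow> (real ^ 'm \<Rightarrow> real ^ 'n::finite ^ 'n)
       \<Rightarrow> (real ^ 'm \<Rightarrow> real ^ 'm ^ 'n ^ 'n) \<Rightarrow> bool" where
  "has_weak_gradient_matrix D P G \<longleftrightarrow>
     (\<forall>i j. has_weak_gradient D (\<lambda>x. P x $ i $ j) (\<lambda>x. G x $ i $ j))"

text \<open>\<open>P\<^sup>T \<nabla>P - P\<^sup>T \<Omega> P\<close> at a point, with \<open>G\<close> in the role of \<open>\<nabla>P\<close>; the entries are vectors in
  \<open>real ^ 'm\<close>.\<close>

definition gauge_transform ::
    "real ^ 'n::finite ^ 'n \<Rightarrow> real ^ 'm::finite ^ 'n ^ 'n \<Rightarrow> real ^ 'm ^ 'n ^ 'n \<Rightarrow> real ^ 'm ^ 'n ^ 'n"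
  where
  "gauge_transform P G \<Omega> =
     (\<chi> i j. (\<Sum>k\<in>UNIV. transpose P $ i $ k *\<^sub>R G $ k $ j)
           - (\<Sum>k\<in>UNIV. \<Sum>l\<in>UNIV. (transpose P $ i $ k * P $ l $ j) *\<^sub>R \<Omega> $ k $ l))"

end

theory Submission imports Defs "HOL-Complex_Analysis.Great_Picard" begin

text \<open>
  Minimize \<open>\<integral> |Q\<^sup>T \<nabla>Q - Q\<^sup>T \<Omega> Q|\<^sup>2\<close> over the \<open>C\<^sup>1\<close> maps \<open>Q : \<real>\<^sup>m \<rightarrow> SO(n)\<close> that are the identity off a
  compact subset of \<open>D\<close>.  Let \<open>X = Q\<^sup>T \<nabla>Q - Q\<^sup>T \<Omega> Q\<close>.  Multiplying \<open>Q\<close> on the right by the rotation by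
  the angle \<open>t \<phi>\<close> in a coordinate plane with generator \<open>A\<close> changes the integrand to
  \<open>|X + t A \<nabla>\<phi>|\<^sup>2\<close>.  The infimum need not be attained in this class, but along a minimizing sequence
  \<open>Q\<^sub>k\<close> the divergences of the \<open>X\<^sub>k\<close> tend to zero in the weak sense, and \<open>\<parallel>X\<^sub>k\<parallel> \<le> \<parallel>\<Omega>\<parallel>\<close> by comparison
  with the constant map.  Since \<open>\<nabla>Q\<^sub>k = Q\<^sub>k X\<^sub>k + \<Omega> Q\<^sub>k\<close> is bounded in \<open>L\<^sup>2\<close>, after passing to a
  subsequence \<open>Q\<^sub>k \<rightarrow> P\<close> almost everywhere while \<open>X\<^sub>k\<close> clusters weakly at some \<open>X\<close>.  In the limit
  \<open>\<nabla>P = P X + \<Omega> P\<close>, so that \<open>P\<^sup>T \<nabla>P - P\<^sup>T \<Omega> P = X\<close> is divergence free, and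
  \<open>\<parallel>\<nabla>P\<parallel> + \<parallel>X\<parallel> \<le> 2 \<parallel>X\<parallel> + \<parallel>\<Omega>\<parallel> \<le> 3 \<parallel>\<Omega>\<parallel>\<close>.
\<close>

section \<open>Square integrable maps\<close>

text \<open>The delicate limit is that of the product \<open>Q X\<close>, in which \<open>X\<close>
  converges only weakly. It survives because orthogonal matrices are uniformly bounded, so that a.e.
  convergence of \<open>Q\<close> becomes strong convergence of \<open>Q\<close> against a fixed
  test tensor, by domination. Two features make near-minimality usable without a minimizer. The
  energy of the rotated competitor is exactly quadratic in \<open>t\<close>, with no remainder to
  estimate, so being within \<open>e\<close> of the infimum bounds the linear coefficient by a
  multiple of \<open>sqrt e\<close>. Moreover every \<open>X\<close> is antisymmetric in its matrix
  indices: \<open>Q^T grad Q\<close> is skew because \<open>Q^T Q = 1\<close>, and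
  \<open>Q^T \<Omega> Q\<close> is skew because \<Omega> is. Hence the generator of the
  \<open>(i,j)\<close> plane tests twice the entry \<open>X_ij\<close>, finitely many generators
  reach every off-diagonal entry, and the diagonal vanishes. Maps equal to the identity off a
  compact subset of \<open>D\<close> extend to the whole space with the same energy of the gradient,
  so translations can be used freely in the compactness argument.\<close>

definition sq_integrable :: "'a measure \<Rightarrow> ('a \<Rightarrow> 'b::euclidean_space) \<Rightarrow> bool" where
  "sq_integrable M f \<longleftrightarrow> f \<in> borel_measurable M \<and> integrable M (\<lambda>x. (norm (f x))\<^sup>2)"

lemma L2_on_iff_sq_integrable: "f \<in> L2_on D \<longleftrightarrow> sq_integrable (lebesgue_on D) f"
  by (simp add: L2_on_def sq_integrable_def)

lemma sq_integrable_measurable[measurable_dest]: "sq_integrable M f \<Longrightarrow> f \<in> borel_measurable M"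
  by (simp add: sq_integrable_def)

lemma sq_integrable_dominated:
  fixes f :: "'a \<Rightarrow> 'b::euclidean_space"
  assumes "f \<in> borel_measurable M" "integrable M g" "AE x in M. (norm (f x))\<^sup>2 \<le> g x"
  shows "sq_integrable M f"
  unfolding sq_integrable_def
proof
  show "integrable M (\<lambda>x. (norm (f x))\<^sup>2)"
    by (rule Bochner_Integration.integrable_bound[OF assms(2)]) (use assms in auto)
qed (use assms in simp)

lemma norm_add_sq_le: "(norm (a + b))\<^sup>2 \<le> 2 * (norm a)\<^sup>2 + 2 * (norm b)\<^sup>2"
  for a b :: "'b::real_inner"
proof -
  have "0 \<le> (norm (a - b))\<^sup>2" by simp
  then show ?thesis
    by (simp add: power2_norm_eq_inner inner_simps inner_commute)
qed

lemma sq_integrable_add: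
  assumes "sq_integrable M f" "sq_integrable M g"
  shows "sq_integrable M (\<lambda>x. f x + g x)"
  by (rule sq_integrable_dominated[where g="\<lambda>x. 2 * (norm (f x))\<^sup>2 + 2 * (norm (g x))\<^sup>2"])
     (use assms norm_add_sq_le in \<open>auto simp: sq_integrable_def\<close>)

lemma sq_integrable_scaleR:
  "sq_integrable M f \<Longrightarrow> sq_integrable M (\<lambda>x. c *\<^sub>R f x)"
  by (auto simp: sq_integrable_def power_mult_distrib)

lemma sq_integrable_diff:
  assumes "sq_integrable M f" "sq_integrable M g"
  shows "sq_integrable M (\<lambda>x. f x - g x)"
  using sq_integrable_add[OF assms(1) sq_integrable_scaleR[OF assms(2), of "-1"]] by simp

lemma sq_integrable_bounded:
  fixes f :: "'a \<Rightarrow> 'b::euclidean_space"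
  assumes "finite_measure M" "f \<in> borel_measurable M" "AE x in M. norm (f x) \<le> B"
  shows "sq_integrable M f"
proof (rule sq_integrable_dominated[where g="\<lambda>x. B\<^sup>2"])
  interpret finite_measure M by fact
  show "integrable M (\<lambda>x. B\<^sup>2)" by simp
  show "AE x in M. (norm (f x))\<^sup>2 \<le> B\<^sup>2"
    using assms(3) by eventually_elim (simp add: power_mono)
qed fact

lemma sq_integrable_bounded_mult:
  fixes f :: "'a \<Rightarrow> 'b::euclidean_space" and c :: "'a \<Rightarrow> real"
  assumes "sq_integrable M f" "c \<in> borel_measurable M" "AE x in M. \<bar>c x\<bar> \<le> B"
  shows "sq_integrable M (\<lambda>x. c x *\<^sub>R f x)"
proof (rule sq_integrable_dominated[where g="\<lambda>x. B\<^sup>2 * (norm (f x))\<^sup>2"])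
  show "AE x in M. (norm (c x *\<^sub>R f x))\<^sup>2 \<le> B\<^sup>2 * (norm (f x))\<^sup>2"
    using assms(3)
  proof eventually_elim
    case (elim x)
    then have "\<bar>c x\<bar>\<^sup>2 \<le> B\<^sup>2" by (intro power_mono) auto
    then show ?case by (simp add: power_mult_distrib mult_right_mono)
  qed
qed (use assms in \<open>auto simp: sq_integrable_def\<close>)

lemma sq_integrable_inner:
  assumes "sq_integrable M f" "sq_integrable M g"
  shows "integrable M (\<lambda>x. f x \<bullet> g x)"
proof (rule Bochner_Integration.integrable_bound[where f="\<lambda>x. (norm (f x))\<^sup>2 + (norm (g x))\<^sup>2"])
  have "\<bar>a \<bullet> b\<bar> \<le> (norm a)\<^sup>2 + (norm b)\<^sup>2" for a b :: 'b
  proof -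
    have "\<bar>a \<bullet> b\<bar> \<le> norm a * norm b" by (rule Cauchy_Schwarz_ineq2)
    moreover have "2 * (norm a * norm b) \<le> (norm a)\<^sup>2 + (norm b)\<^sup>2"
      using sum_squares_bound[of "norm a" "norm b"] by (simp add: mult.assoc)
    moreover have "0 \<le> norm a * norm b" by simp
    ultimately show ?thesis by linarith
  qed
  then show "AE x in M. norm (f x \<bullet> g x) \<le> norm ((norm (f x))\<^sup>2 + (norm (g x))\<^sup>2)"
    by (auto intro: order_trans)
qed (use assms in \<open>auto simp: sq_integrable_def\<close>)

lemma sq_integrable_integrable:
  assumes "finite_measure M" "sq_integrable M f"
  shows "integrable M f"
proof (rule Bochner_Integration.integrable_bound[where f="\<lambda>x. (norm (f x))\<^sup>2 + 1"])
  interpret finite_measure M by fact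
  show "integrable M (\<lambda>x. (norm (f x))\<^sup>2 + 1)" using assms(2) by (auto simp: sq_integrable_def)
  have "a \<le> a\<^sup>2 + 1" for a :: real
    using sum_squares_bound[of a 1] by (sos)
  then show "AE x in M. norm (f x) \<le> norm ((norm (f x))\<^sup>2 + 1)" by auto
qed (use assms in \<open>auto simp: sq_integrable_def\<close>)

section \<open>The quadratic expansion, Cauchy-Schwarz and Minkowski\<close>

text \<open>Used in two ways: nonnegativity of this polynomial in \<open>t\<close> gives
  Cauchy-Schwarz, and with \<open>g\<close> a direction of variation it is the energy of a
  competitor.\<close>

lemma integral_norm_sq_add_scaleR:
  assumes "sq_integrable M f" "sq_integrable M g"
  shows "(\<integral>x. (norm (f x + t *\<^sub>R g x))\<^sup>2 \<partial>M)
    = (\<integral>x. (norm (f x))\<^sup>2 \<partial>M) + 2 * t * (\<integral>x. f x \<bullet> g x \<partial>M) + t\<^sup>2 * (\<integral>x. (norm (g x))\<^sup>2 \<partial>M)"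
proof -
  have "(norm (f x + t *\<^sub>R g x))\<^sup>2 = (norm (f x))\<^sup>2 + 2 * t * (f x \<bullet> g x) + t\<^sup>2 * (norm (g x))\<^sup>2" for x
    unfolding power2_norm_eq_inner
    by (simp add: inner_add_left inner_add_right inner_commute power2_eq_square algebra_simps)
  then show ?thesis
    using assms sq_integrable_inner[OF assms] by (simp add: sq_integrable_def)
qed

lemma integral_inner_sq_le:
  assumes "sq_integrable M f" "sq_integrable M g"
  shows "(\<integral>x. f x \<bullet> g x \<partial>M)\<^sup>2 \<le> (\<integral>x. (norm (f x))\<^sup>2 \<partial>M) * (\<integral>x. (norm (g x))\<^sup>2 \<partial>M)"
proof -
  define a b c where "a = (\<integral>x. (norm (f x))\<^sup>2 \<partial>M)" and "b = (\<integral>x. f x \<bullet> g x \<partial>M)"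
    and "c = (\<integral>x. (norm (g x))\<^sup>2 \<partial>M)"
  have quad: "0 \<le> a + 2 * t * b + t\<^sup>2 * c" for t
    unfolding a_def b_def c_def integral_norm_sq_add_scaleR[OF assms, symmetric] by simp
  have "c \<ge> 0" unfolding c_def by simp
  have "b\<^sup>2 \<le> a * c"
  proof (cases "c = 0")
    case True
    have "b = 0"
    proof (rule ccontr)
      assume "b \<noteq> 0"
      \<comment> \<open>At this \<open>t\<close> the quadratic, here an affine function because
        \<open>c = 0\<close>, takes the value -1.\<close>
      then show False using quad[of "- (a + 1) / (2 * b)"] True by (simp add: field_simps)
    qed
    then show ?thesis using True by simp
  next
    case False
    with \<open>c \<ge> 0\<close> have "c > 0" by simp
    \<comment> \<open>The parameter \<open>- b / c\<close> is the vertex of the parabola.\<close>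
    then show ?thesis
      using quad[of "- b / c"] by (simp add: field_simps power2_eq_square)
  qed
  then show ?thesis by (simp add: a_def b_def c_def)
qed

lemma abs_integral_inner_le:
  assumes "sq_integrable M f" "sq_integrable M g"
  shows "\<bar>\<integral>x. f x \<bullet> g x \<partial>M\<bar> \<le> sqrt (\<integral>x. (norm (f x))\<^sup>2 \<partial>M) * sqrt (\<integral>x. (norm (g x))\<^sup>2 \<partial>M)"
  using real_sqrt_le_mono[OF integral_inner_sq_le[OF assms]] by (simp add: real_sqrt_mult)

lemma sqrt_integral_norm_sq_add_le:
  assumes "sq_integrable M f" "sq_integrable M g"
  shows "sqrt (\<integral>x. (norm (f x + g x))\<^sup>2 \<partial>M)
    \<le> sqrt (\<integral>x. (norm (f x))\<^sup>2 \<partial>M) + sqrt (\<integral>x. (norm (g x))\<^sup>2 \<partial>M)"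
proof (rule real_le_lsqrt)
  define a c where "a = (\<integral>x. (norm (f x))\<^sup>2 \<partial>M)" and "c = (\<integral>x. (norm (g x))\<^sup>2 \<partial>M)"
  have "a \<ge> 0" "c \<ge> 0" by (auto simp: a_def c_def)
  then show "(\<integral>x. (norm (f x + g x))\<^sup>2 \<partial>M)
    \<le> (sqrt (\<integral>x. (norm (f x))\<^sup>2 \<partial>M) + sqrt (\<integral>x. (norm (g x))\<^sup>2 \<partial>M))\<^sup>2"
    using integral_norm_sq_add_scaleR[OF assms, of 1] abs_integral_inner_le[OF assms]
    unfolding a_def[symmetric] c_def[symmetric] by (simp add: power2_sum)
qed simp

section \<open>Completeness and weak compactness\<close>

text \<open>The Riesz-Fischer argument: along a fast subsequence the increments are summable in the
  mean, hence pointwise almost everywhere, and Fatou's lemma turns the pointwise limit into a limit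
  of the whole sequence in the square mean. The subsequence is part of the conclusion because the
  compactness theorem below needs a.e. convergence.\<close>

lemma sq_integrable_complete:
  fixes f :: "nat \<Rightarrow> 'a \<Rightarrow> 'b::euclidean_space"
  assumes fin: "finite_measure M" and f: "\<And>k. sq_integrable M (f k)"
    and cauchy: "\<And>e. e > 0 \<Longrightarrow> \<exists>N. \<forall>m\<ge>N. \<forall>n\<ge>N. (\<integral>x. (norm (f m x - f n x))\<^sup>2 \<partial>M) < e"
  obtains g r where "sq_integrable M g" "strict_mono r" "AE x in M. (\<lambda>k. f (r k) x) \<longlonglongrightarrow> g x"
    "(\<lambda>k. \<integral>x. (norm (f k x - g x))\<^sup>2 \<partial>M) \<longlonglongrightarrow> 0"
proof -
  interpret finite_measure M by fact
  have [measurable]: "f k \<in> borel_measurable M" for k using f by (simp add: sq_integrable_def)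
  have "\<exists>N. \<forall>m\<ge>N. \<forall>n\<ge>N. (\<integral>x. (norm (f m x - f n x))\<^sup>2 \<partial>M) < (1/4)^k" for k :: nat
    by (rule cauchy) simp
  then obtain N where N: "\<And>k m n. m \<ge> N k \<Longrightarrow> n \<ge> N k \<Longrightarrow> (\<integral>x. (norm (f m x - f n x))\<^sup>2 \<partial>M) < (1/4)^k"
    by metis
  \<comment> \<open>The sum forces \<open>r k\<close> to be at least \<open>N k\<close>, and the
    summand \<open>k\<close> makes \<open>r\<close> strictly increasing.\<close>
  define r where "r k = k + (\<Sum>i\<le>k. N i)" for k
  have r: "strict_mono r" by (auto simp: strict_mono_Suc_iff r_def)
  have rN: "r k \<ge> N k" for k
    unfolding r_def by (rule trans_le_add2) (rule member_le_sum, auto)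
  have rk: "r k \<ge> k" for k using r by (rule seq_suble)
  define d where "d k x = f (r (Suc k)) x - f (r k) x" for k x
  have d: "sq_integrable M (d k)" for k unfolding d_def by (intro sq_integrable_diff f)
  have dint: "integrable M (d k)" for k using sq_integrable_integrable[OF fin d] .
  have d2: "(\<integral>x. (norm (d k x))\<^sup>2 \<partial>M) \<le> (1/4)^k" for k
    unfolding d_def
    by (rule less_imp_le, rule N) (use rN[of k] strict_mono_leD[OF r, of k "Suc k"] in auto)
  define \<mu> where "\<mu> = measure M (space M)"
  have d1: "(\<integral>x. norm (d k x) \<partial>M) \<le> (1 + \<mu>) * (1/2)^k" for k
  proof -
    \<comment> \<open>A weighted inequality between arithmetic and geometric mean. The weight
      \<open>2^k\<close> balances the two contributions: \<open>2^k\<close> times the bound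
      \<open>(1/4)^k\<close>, and the constant \<open>(1/2)^k\<close> integrated over a finite
      measure, both decay like \<open>(1/2)^k\<close>.\<close>
    have le: "a \<le> 2^k * a\<^sup>2 + (1/2)^k" for a :: real
    proof -
      have "0 \<le> (2^k * a - 1)\<^sup>2" by simp
      then have "2 * 2^k * a \<le> 2^k * (2^k * a\<^sup>2) + 1" by (simp add: power2_eq_square algebra_simps)
      moreover have "2^k * a \<le> 2 * 2^k * a \<or> a < 0" by auto
      moreover have "0 \<le> 2^k * (2^k * a\<^sup>2) + 1" by simp
      ultimately have "2^k * a \<le> 2^k * (2^k * a\<^sup>2) + 1"
        by (smt (verit) mult_nonneg_nonneg mult_pos_neg zero_less_power)
      then have "2^k * a \<le> 2^k * (2^k * a\<^sup>2 + (1/2)^k)"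
        by (simp add: distrib_left power_one_over)
      then show ?thesis by (simp add: mult_le_cancel_left_pos)
    qed
    have "(\<integral>x. norm (d k x) \<partial>M) \<le> (\<integral>x. 2^k * (norm (d k x))\<^sup>2 + (1/2)^k \<partial>M)"
      by (intro integral_mono le integrable_norm dint) (use d in \<open>auto simp: sq_integrable_def\<close>)
    also have "\<dots> = 2^k * (\<integral>x. (norm (d k x))\<^sup>2 \<partial>M) + \<mu> * (1/2)^k"
      using d by (simp add: sq_integrable_def \<mu>_def)
    also have "\<dots> \<le> 2^k * (1/4)^k + \<mu> * (1/2)^k" using d2 by simp
    also have "2^k * (1/4)^k = (1/2::real)^k" by (simp flip: power_mult_distrib)
    finally show ?thesis by (simp add: algebra_simps)
  qed
  have "(\<integral>\<^sup>+x. (\<Sum>k. ennreal (norm (d k x))) \<partial>M) = (\<Sum>k. \<integral>\<^sup>+x. norm (d k x) \<partial>M)"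
    by (rule nn_integral_suminf) (auto simp: d_def)
  also have "\<dots> \<le> (\<Sum>k. ennreal ((1 + \<mu>) * (1/2)^k))"
  proof (rule suminf_le)
    show "(\<integral>\<^sup>+x. norm (d k x) \<partial>M) \<le> ennreal ((1 + \<mu>) * (1/2)^k)" for k
      using d1 dint by (subst nn_integral_eq_integral) (auto intro: ennreal_leI)
  qed auto
  also have "\<dots> < \<infinity>"
    by (subst suminf_ennreal2) (auto intro!: summable_mult summable_geometric simp: \<mu>_def)
  finally have "(\<integral>\<^sup>+x. (\<Sum>k. ennreal (norm (d k x))) \<partial>M) < \<infinity>" .
  then have "AE x in M. (\<Sum>k. ennreal (norm (d k x))) \<noteq> \<infinity>"
    by (intro nn_integral_PInf_AE) (auto simp: d_def)
  then have conv: "AE x in M. convergent (\<lambda>k. f (r k) x)"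
  proof eventually_elim
    case (elim x)
    then have "summable (\<lambda>k. norm (d k x))"
      by (intro summable_suminf_not_top) auto
    then have "summable (\<lambda>k. d k x)" by (rule summable_norm_cancel)
    then have "convergent (\<lambda>n. \<Sum>k<n. d k x)" by (simp add: summable_iff_convergent)
    then have "convergent (\<lambda>n. f (r n) x - f (r 0) x)"
      using sum_lessThan_telescope[of "\<lambda>k. f (r k) x"] by (simp add: d_def)
    then have "convergent (\<lambda>n. (f (r n) x - f (r 0) x) + f (r 0) x)"
      by (intro convergent_add convergent_const)
    then show ?case by simp
  qed
  \<comment> \<open>The value 0 on the exceptional null set makes \<open>g\<close> measurable as it
    stands, without completeness of \<open>M\<close>.\<close>
  define g where "g x = (if convergent (\<lambda>k. f (r k) x) then lim (\<lambda>k. f (r k) x) else 0)" for x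
  have [measurable]: "g \<in> borel_measurable M"
  proof -
    have "Measurable.pred M (\<lambda>x. convergent (\<lambda>k. f (r k) x))"
      unfolding Cauchy_convergent_iff[symmetric] by (measurable)
    then show ?thesis unfolding g_def by measurable
  qed
  have lim: "AE x in M. (\<lambda>k. f (r k) x) \<longlonglongrightarrow> g x"
    using conv by eventually_elim (simp add: g_def convergent_LIMSEQ_iff)
  have fatou: "(\<integral>\<^sup>+x. ennreal ((norm (f n x - g x))\<^sup>2) \<partial>M) \<le> ennreal e"
    if e: "e > 0" and n: "\<And>m. m \<ge> n \<Longrightarrow> (\<integral>x. (norm (f n x - f m x))\<^sup>2 \<partial>M) < e" for n e
  proof -
    have "(\<integral>\<^sup>+x. ennreal ((norm (f n x - g x))\<^sup>2) \<partial>M)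
        = (\<integral>\<^sup>+x. liminf (\<lambda>k. ennreal ((norm (f n x - f (r k) x))\<^sup>2)) \<partial>M)"
      using lim
      by (intro nn_integral_cong_AE, eventually_elim)
         (intro lim_imp_Liminf[symmetric] tendsto_intros, auto)
    also have "\<dots> \<le> liminf (\<lambda>k. \<integral>\<^sup>+x. ennreal ((norm (f n x - f (r k) x))\<^sup>2) \<partial>M)"
      by (intro nn_integral_liminf) measurable
    also have "\<dots> \<le> liminf (\<lambda>k. ennreal e)"
    proof (rule Liminf_mono, rule eventually_sequentiallyI[of n])
      fix k assume "n \<le> k"
      then have "r k \<ge> n" using rk[of k] by simp
      have "integrable M (\<lambda>x. (norm (f n x - f (r k) x))\<^sup>2)"
        using sq_integrable_diff[OF f f] by (simp add: sq_integrable_def)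
      then show "(\<integral>\<^sup>+x. ennreal ((norm (f n x - f (r k) x))\<^sup>2) \<partial>M) \<le> ennreal e"
        using n[OF \<open>r k \<ge> n\<close>] by (subst nn_integral_eq_integral) (auto intro: ennreal_leI)
    qed
    finally show ?thesis by (simp add: Liminf_const)
  qed
  have sq: "sq_integrable M (\<lambda>x. f n x - g x)"
    if e: "e > 0" and n: "\<And>m. m \<ge> n \<Longrightarrow> (\<integral>x. (norm (f n x - f m x))\<^sup>2 \<partial>M) < e" for n e
    using fatou[OF that]
    by (auto simp: sq_integrable_def intro!: integrableI_bounded intro: order.strict_trans1[OF _ ennreal_less_top])
  have g: "sq_integrable M g"
  proof -
    have "sq_integrable M (\<lambda>x. f (N 0) x - g x)"
      by (rule sq[of 1]) (use N[of 0] in auto)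
    from sq_integrable_diff[OF f[of "N 0"] this] show ?thesis by simp
  qed
  have "(\<lambda>k. \<integral>x. (norm (f k x - g x))\<^sup>2 \<partial>M) \<longlonglongrightarrow> 0"
  proof (rule LIMSEQ_I)
    fix e :: real assume "e > 0"
    then obtain N where N: "\<forall>m\<ge>N. \<forall>n\<ge>N. (\<integral>x. (norm (f m x - f n x))\<^sup>2 \<partial>M) < e/2"
      using cauchy[of "e/2"] by auto
    have "norm ((\<integral>x. (norm (f k x - g x))\<^sup>2 \<partial>M) - 0) < e" if "k \<ge> N" for k
    proof -
      have "ennreal (\<integral>x. (norm (f k x - g x))\<^sup>2 \<partial>M) \<le> ennreal (e/2)"
        using fatou[of "e/2" k] sq_integrable_diff[OF f g] N that \<open>e > 0\<close>
        by (subst nn_integral_eq_integral[symmetric]) (auto simp: sq_integrable_def)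
      then have "(\<integral>x. (norm (f k x - g x))\<^sup>2 \<partial>M) \<le> e/2" using \<open>e > 0\<close> by simp
      then show ?thesis using \<open>e > 0\<close> by simp
    qed
    then show "\<exists>N. \<forall>k\<ge>N. norm ((\<integral>x. (norm (f k x - g x))\<^sup>2 \<partial>M) - 0) < e" by blast
  qed
  with g r lim show ?thesis by (rule that)
qed

text \<open>A form of weak sequential compactness without subsequences: the limit is that of almost
  norm-minimal elements of the closed convex hulls \<open>K n\<close> of the tails, which is a Cauchy
  sequence by the parallelogram identity.\<close>

lemma sq_integrable_weak_cluster:
  fixes f :: "nat \<Rightarrow> 'a \<Rightarrow> 'b::euclidean_space"
  assumes fin: "finite_measure M" and f: "\<And>k. sq_integrable M (f k)"
    and bnd: "\<And>k. (\<integral>x. (norm (f k x))\<^sup>2 \<partial>M) \<le> C"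
  obtains g where "sq_integrable M g" "(\<integral>x. (norm (g x))\<^sup>2 \<partial>M) \<le> C"
    "\<And>z a. sq_integrable M z \<Longrightarrow> (\<lambda>k. \<integral>x. f k x \<bullet> z x \<partial>M) \<longlonglongrightarrow> a \<Longrightarrow> (\<integral>x. g x \<bullet> z x \<partial>M) = a"
proof -
  let ?N = "\<lambda>y. \<integral>x. (norm (y x))\<^sup>2 \<partial>M"
  \<comment> \<open>The closed convex hull of the tail is encoded as the intersection of the closed
    half-spaces that contain the tail, so no convex combinations have to be formed. Of convexity
    only closure under midpoints is used.\<close>
  define K where "K n = {y. sq_integrable M y \<and> (\<forall>z B. sq_integrable M z \<longrightarrow>
    (\<forall>k\<ge>n. (\<integral>x. f k x \<bullet> z x \<partial>M) \<le> B) \<longrightarrow> (\<integral>x. y x \<bullet> z x \<partial>M) \<le> B)}" for n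
  have Ksq: "sq_integrable M y" if "y \<in> K n" for y n using that by (simp add: K_def)
  have Kf: "f n \<in> K n" for n using f by (auto simp: K_def)
  have Kanti: "K m \<subseteq> K n" if "n \<le> m" for m n
    using that unfolding K_def by (intro Collect_mono) (meson order_trans)
  have Kmid: "(\<lambda>x. (1/2) *\<^sub>R (y x + w x)) \<in> K n" if y: "y \<in> K n" and w: "w \<in> K n" for y w n
    unfolding K_def
  proof safe
    show "sq_integrable M (\<lambda>x. (1/2) *\<^sub>R (y x + w x))"
      by (intro sq_integrable_scaleR sq_integrable_add Ksq[OF y] Ksq[OF w])
    fix z and B :: real assume z: "sq_integrable M z" and B: "\<forall>k\<ge>n. (\<integral>x. f k x \<bullet> z x \<partial>M) \<le> B"
    have "(\<integral>x. y x \<bullet> z x \<partial>M) \<le> B" "(\<integral>x. w x \<bullet> z x \<partial>M) \<le> B"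
      using y w z B by (auto simp: K_def)
    moreover have "(\<integral>x. ((1/2) *\<^sub>R (y x + w x)) \<bullet> z x \<partial>M)
        = (\<integral>x. y x \<bullet> z x \<partial>M) / 2 + (\<integral>x. w x \<bullet> z x \<partial>M) / 2"
      using sq_integrable_inner[OF Ksq[OF y] z] sq_integrable_inner[OF Ksq[OF w] z]
      by (simp add: inner_add_left)
    ultimately show "(\<integral>x. ((1/2) *\<^sub>R (y x + w x)) \<bullet> z x \<partial>M) \<le> B" by (smt (verit) field_sum_of_halves)
  qed
  define I where "I n = (INF y\<in>K n. ?N y)" for n
  have bdd: "bdd_below (?N ` K n)" for n by (rule bdd_belowI[of _ 0]) auto
  have Ile: "I n \<le> ?N y" if "y \<in> K n" for n y
    unfolding I_def using bdd that by (rule cINF_lower)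
  have IC: "I n \<le> C" for n using Ile[OF Kf] bnd order_trans by blast
  \<comment> \<open>The hulls shrink, so their minimal energies increase; being bounded by
    \<open>C\<close> they form a Cauchy sequence, which controls the right-hand side of the
    parallelogram estimate below.\<close>
  have "incseq I"
  proof (rule incseq_SucI)
    fix n
    have "K (Suc n) \<noteq> {}" using Kf by blast
    then show "I n \<le> I (Suc n)"
      unfolding I_def using Kanti[of n "Suc n"] bdd by (intro cINF_superset_mono) auto
  qed
  then have "convergent I"
    by (meson IC incseq_convergent convergentI)
  then have CI: "Cauchy I" by (rule convergent_Cauchy)
  have "\<exists>y\<in>K n. ?N y < I n + 1 / real (Suc n)" for n
  proof -
    have "?N ` K n \<noteq> {}" using Kf by blast
    then have "\<exists>t\<in>?N ` K n. t < I n + 1 / real (Suc n)"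
      by (intro cInf_lessD) (auto simp: I_def)
    then show ?thesis by blast
  qed
  then obtain y where yK: "\<And>n. y n \<in> K n" and yN: "\<And>n. ?N (y n) < I n + 1 / real (Suc n)" by metis
  have ysq: "sq_integrable M (y n)" for n using Ksq[OF yK] .
  \<comment> \<open>Both \<open>y n\<close> and \<open>y m\<close> lie in \<open>K n\<close>, hence
    so does their midpoint, whose energy is therefore at least \<open>I n\<close>; the parallelogram
    identity converts this into smallness of the difference.\<close>
  have par: "?N (\<lambda>x. y n x - y m x) \<le> 2 * (I m - I n) + 4 / real (Suc n)" if "n \<le> m" for m n
  proof -
    have "I n \<le> ?N (\<lambda>x. (1/2) *\<^sub>R (y n x + y m x))"
      using Kanti[OF that] yK by (intro Ile Kmid) auto
    also have "\<dots> = (1/4) * ?N (\<lambda>x. y n x + y m x)"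
      by (simp add: power_mult_distrib power2_eq_square)
    finally have 1: "4 * I n \<le> ?N (\<lambda>x. y n x + y m x)" by simp
    have 2: "?N (\<lambda>x. y n x - y m x) + ?N (\<lambda>x. y n x + y m x) = 2 * ?N (y n) + 2 * ?N (y m)"
      using integral_norm_sq_add_scaleR[OF ysq ysq, of n 1 m]
        integral_norm_sq_add_scaleR[OF ysq ysq, of n "-1" m] by simp
    have "1 / real (Suc m) \<le> 1 / real (Suc n)" using that by (simp add: frac_le)
    moreover have "4 / real (Suc n) = 4 * (1 / real (Suc n))" by simp
    ultimately show ?thesis using 1 2 yN[of n] yN[of m] by argo
  qed
  have yC: "\<exists>N. \<forall>m\<ge>N. \<forall>n\<ge>N. ?N (\<lambda>x. y m x - y n x) < e" if e: "e > 0" for e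
  proof -
    obtain N1 where N1: "\<And>m n. m \<ge> N1 \<Longrightarrow> n \<ge> N1 \<Longrightarrow> norm (I m - I n) < e/4"
      using CauchyD[OF CI, of "e/4"] e by (metis divide_pos_pos zero_less_numeral)
    obtain N2 where N2: "1 / real (Suc N2) < e/8" using nat_approx_posE[of "e/8"] e by (metis divide_pos_pos zero_less_numeral)
    have main: "?N (\<lambda>x. y n x - y m x) < e" if "n \<ge> max N1 N2" "n \<le> m" for m n
    proof -
      have "1 / real (Suc n) \<le> 1 / real (Suc N2)" using that by (simp add: frac_le)
      moreover have "\<bar>I m - I n\<bar> < e/4" using N1[of m n] that by simp
      moreover have "4 / real (Suc n) = 4 * (1 / real (Suc n))" by simp
      ultimately show ?thesis using par[OF that(2)] N2 by argo
    qed
    have "?N (\<lambda>x. y m x - y n x) < e" if "n \<ge> max N1 N2" "m \<ge> max N1 N2" for m n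
      using that main[of n m] main[of m n] by (cases "n \<le> m") (simp_all add: norm_minus_commute)
    then show ?thesis by blast
  qed
  obtain g r where g: "sq_integrable M g" and "strict_mono (r :: nat \<Rightarrow> nat)"
    "AE x in M. (\<lambda>k. y (r k) x) \<longlonglongrightarrow> g x" and lim: "(\<lambda>k. ?N (\<lambda>x. y k x - g x)) \<longlonglongrightarrow> 0"
    by (rule sq_integrable_complete[where M=M and f=y, OF fin ysq yC])
  have lim': "(\<lambda>k. sqrt (?N (\<lambda>x. y k x - g x))) \<longlonglongrightarrow> 0"
    using tendsto_real_sqrt[OF lim] by simp
  have "sqrt (?N g) \<le> sqrt C"
  proof (rule LIMSEQ_le_const)
    have "(\<lambda>k. sqrt (C + 1 / real (Suc k)) + sqrt (?N (\<lambda>x. y k x - g x))) \<longlonglongrightarrow> sqrt (C + 0) + 0"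
      by (intro tendsto_intros lim' LIMSEQ_inverse_real_of_nat[unfolded inverse_eq_divide])
    then show "(\<lambda>k. sqrt (C + 1 / real (Suc k)) + sqrt (?N (\<lambda>x. y k x - g x))) \<longlonglongrightarrow> sqrt C" by simp
    have "sqrt (?N g) \<le> sqrt (C + 1 / real (Suc k)) + sqrt (?N (\<lambda>x. y k x - g x))" for k
    proof -
      have "sqrt (?N g) \<le> sqrt (?N (y k)) + sqrt (?N (\<lambda>x. g x - y k x))"
        using sqrt_integral_norm_sq_add_le[OF ysq sq_integrable_diff[OF g ysq], of k k] by simp
      moreover have "sqrt (?N (y k)) \<le> sqrt (C + 1 / real (Suc k))"
        using yN[of k] IC[of k] by (intro real_sqrt_le_mono) linarith
      moreover have "sqrt (?N (\<lambda>x. g x - y k x)) = sqrt (?N (\<lambda>x. y k x - g x))" by (simp add: norm_minus_commute)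
      ultimately show ?thesis by argo
    qed
    then show "\<exists>N. \<forall>k\<ge>N. sqrt (?N g) \<le> sqrt (C + 1 / real (Suc k)) + sqrt (?N (\<lambda>x. y k x - g x))"
      by blast
  qed
  then have "?N g \<le> C" by simp
  moreover have "(\<integral>x. g x \<bullet> z x \<partial>M) = a"
    if z: "sq_integrable M z" and a: "(\<lambda>k. \<integral>x. f k x \<bullet> z x \<partial>M) \<longlonglongrightarrow> a" for z a
  proof (rule LIMSEQ_unique)
    have "(\<lambda>k. sqrt (?N (\<lambda>x. y k x - g x)) * sqrt (?N z)) \<longlonglongrightarrow> 0"
      using tendsto_mult_right[OF lim', of "sqrt (?N z)"] by simp
    then have "(\<lambda>k. (\<integral>x. y k x \<bullet> z x \<partial>M) - (\<integral>x. g x \<bullet> z x \<partial>M)) \<longlonglongrightarrow> 0"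
    proof (rule Lim_null_comparison[rotated], intro always_eventually allI)
      show "norm ((\<integral>x. y k x \<bullet> z x \<partial>M) - (\<integral>x. g x \<bullet> z x \<partial>M))
          \<le> sqrt (?N (\<lambda>x. y k x - g x)) * sqrt (?N z)" for k
        using abs_integral_inner_le[OF sq_integrable_diff[OF ysq g] z, of k]
          sq_integrable_inner[OF ysq z] sq_integrable_inner[OF g z]
        by (simp add: inner_diff_left)
    qed
    then show "(\<lambda>k. \<integral>x. y k x \<bullet> z x \<partial>M) \<longlonglongrightarrow> (\<integral>x. g x \<bullet> z x \<partial>M)"
      by (simp add: LIM_zero_iff)
    show "(\<lambda>k. \<integral>x. y k x \<bullet> z x \<partial>M) \<longlonglongrightarrow> a"
    proof (rule LIMSEQ_I)
      fix e :: real assume "e > 0"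
      then obtain N where N: "\<And>k. k \<ge> N \<Longrightarrow> norm ((\<integral>x. f k x \<bullet> z x \<partial>M) - a) < e/2"
        using LIMSEQ_D[OF a, of "e/2"] by auto
      have "norm ((\<integral>x. y n x \<bullet> z x \<partial>M) - a) < e" if "n \<ge> N" for n
      proof -
        have near: "\<bar>(\<integral>x. f k x \<bullet> z x \<partial>M) - a\<bar> < e/2" if "k \<ge> n" for k
          using N[of k] that \<open>n \<ge> N\<close> by simp
        \<comment> \<open>The half-spaces given by \<open>z\<close> and by \<open>- z\<close>
          together form a slab around \<open>a\<close> that contains the tail; membership of
          \<open>y n\<close> in \<open>K n\<close> confines it to the same slab.\<close>
        have b: "\<forall>k\<ge>n. (\<integral>x. f k x \<bullet> z x \<partial>M) \<le> a + e/2"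
            "\<forall>k\<ge>n. (\<integral>x. f k x \<bullet> (- z x) \<partial>M) \<le> - a + e/2"
          using near unfolding inner_minus_right integral_minus by (smt (verit) field_sum_of_halves)+
        have "sq_integrable M (\<lambda>x. - z x)" using z by (auto simp: sq_integrable_def)
        then have "(\<integral>x. y n x \<bullet> z x \<partial>M) \<le> a + e/2" "(\<integral>x. y n x \<bullet> (- z x) \<partial>M) \<le> - a + e/2"
          using yK[of n] z b unfolding K_def by blast+
        then show ?thesis using \<open>e > 0\<close> by simp
      qed
      then show "\<exists>N. \<forall>n\<ge>N. norm ((\<integral>x. y n x \<bullet> z x \<partial>M) - a) < e" by blast
    qed
  qed
  ultimately show ?thesis using g that by blast
qed

section \<open>Compactness of bounded families with bounded Dirichlet energy\<close>

text \<open>Jensen's inequality for the square, obtained from the nonnegativity of the variance. The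
  right-hand side is an extended integral, so no integrability has to be supplied where it is
  applied.\<close>

lemma norm_integral_sq_le_nn_integral:
  fixes F :: "'a \<Rightarrow> 'b::euclidean_space"
  assumes "finite_measure M" "measure M (space M) = 1" and [measurable]: "F \<in> borel_measurable M"
  shows "ennreal ((norm (\<integral>x. F x \<partial>M))\<^sup>2) \<le> (\<integral>\<^sup>+x. ennreal ((norm (F x))\<^sup>2) \<partial>M)"
proof (cases "(\<integral>\<^sup>+x. ennreal ((norm (F x))\<^sup>2) \<partial>M) < \<infinity>")
  case True
  interpret finite_measure M by fact
  have F: "sq_integrable M F"
    unfolding sq_integrable_def
  proof
    show "integrable M (\<lambda>x. (norm (F x))\<^sup>2)" by (rule integrableI_nonneg) (simp, simp, rule True)
  qed simp
  define c where "c = (\<integral>x. F x \<partial>M)"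
  have "0 \<le> (\<integral>x. (norm (F x + (-1) *\<^sub>R c))\<^sup>2 \<partial>M)" by simp
  also have "\<dots> = (\<integral>x. (norm (F x))\<^sup>2 \<partial>M) + 2 * (-1) * (\<integral>x. F x \<bullet> c \<partial>M) + (-1)\<^sup>2 * (\<integral>x. (norm c)\<^sup>2 \<partial>M)"
    by (rule integral_norm_sq_add_scaleR) (rule F, simp add: sq_integrable_def)
  also have "(\<integral>x. F x \<bullet> c \<partial>M) = c \<bullet> c"
    using sq_integrable_integrable[OF assms(1) F] by (simp add: c_def)
  finally have "(norm c)\<^sup>2 \<le> (\<integral>x. (norm (F x))\<^sup>2 \<partial>M)"
    by (simp add: assms(2) power2_norm_eq_inner)
  then show ?thesis
    using F by (subst nn_integral_eq_integral) (auto simp: sq_integrable_def c_def intro: ennreal_leI)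
next
  case False
  then show ?thesis by (simp add: top_unique not_less)
qed

lemma nn_integral_lborel_translate:
  fixes c :: "'a::euclidean_space"
  assumes [measurable]: "f \<in> borel_measurable borel"
  shows "(\<integral>\<^sup>+x. f (c + x) \<partial>lborel) = (\<integral>\<^sup>+x. f x \<partial>lborel)"
proof -
  have "(\<integral>\<^sup>+x. f x \<partial>lborel) = (\<integral>\<^sup>+x. f x \<partial>(distr lborel borel ((+) c)))"
    by (simp add: lborel_distr_plus)
  also have "\<dots> = (\<integral>\<^sup>+x. f (c + x) \<partial>lborel)" by (subst nn_integral_distr) auto
  finally show ?thesis ..
qed

text \<open>The difference is the integral of the derivative along the segment from \<open>x\<close>
  to \<open>x + h\<close>. Jensen's inequality moves the square inside, and after exchanging the
  integrals each point of the segment contributes the same amount, by translation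
  invariance.\<close>

lemma nn_integral_translate_diff_le:
  fixes f :: "'a::euclidean_space \<Rightarrow> 'b::euclidean_space" and N :: "'a \<Rightarrow> real"
  assumes der: "\<And>x. (f has_derivative f' x) (at x)"
    and cont: "\<And>h. continuous_on UNIV (\<lambda>x. f' x h)"
    and N[measurable]: "N \<in> borel_measurable borel" and bnd: "\<And>x h. norm (f' x h) \<le> N x * norm h"
  shows "(\<integral>\<^sup>+x. ennreal ((norm (f (x + h) - f x))\<^sup>2) \<partial>lborel)
    \<le> ennreal ((norm h)\<^sup>2) * (\<integral>\<^sup>+x. ennreal ((N x)\<^sup>2) \<partial>lborel)"
proof -
  have ptw: "ennreal ((norm (f (x + h) - f x))\<^sup>2)
      \<le> (\<integral>\<^sup>+t. ennreal ((N (x + t *\<^sub>R h) * norm h)\<^sup>2) * indicator {0..1} t \<partial>lborel)" for x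
  proof -
    let ?F = "\<lambda>t. f' (x + t *\<^sub>R h) h"
    let ?M = "restrict_space lborel {0..1::real}"
    have cF: "continuous_on A ?F" for A
      by (rule continuous_on_compose2[OF cont[of h]]) (auto intro!: continuous_intros)
    have "(\<integral>t. indicator {0..1} t *\<^sub>R ?F t \<partial>lborel) = f (x + 1 *\<^sub>R h) - f (x + 0 *\<^sub>R h)"
    proof (rule integral_FTC_atLeastAtMost[OF _ _ cF])
      fix t :: real
      have "((\<lambda>t. f (x + t *\<^sub>R h)) has_derivative (\<lambda>s. f' (x + t *\<^sub>R h) (s *\<^sub>R h))) (at t within {0..1})"
        by (rule has_derivative_compose[OF _ der]) (auto intro!: derivative_eq_intros)
      moreover have "f' (x + t *\<^sub>R h) (s *\<^sub>R h) = s *\<^sub>R f' (x + t *\<^sub>R h) h" for s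
        using has_derivative_linear[OF der] by (simp add: linear_cmul)
      ultimately show "((\<lambda>t. f (x + t *\<^sub>R h)) has_vector_derivative ?F t) (at t within {0..1})"
        by (simp add: has_vector_derivative_def)
    qed simp
    then have "f (x + h) - f x = (\<integral>t. ?F t \<partial>?M)" by (simp add: integral_restrict_space)
    then have "ennreal ((norm (f (x + h) - f x))\<^sup>2) = ennreal ((norm (\<integral>t. ?F t \<partial>?M))\<^sup>2)" by simp
    also have "\<dots> \<le> (\<integral>\<^sup>+t. ennreal ((norm (?F t))\<^sup>2) \<partial>?M)"
    proof (rule norm_integral_sq_le_nn_integral)
      show "finite_measure ?M"
        by (rule finite_measureI) (simp add: emeasure_restrict_space)
      show "measure ?M (space ?M) = 1" by (simp add: measure_restrict_space)
      show "?F \<in> borel_measurable ?M"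
        by (intro measurable_restrict_space1) (simp add: borel_measurable_continuous_onI cF)
    qed
    also have "\<dots> = (\<integral>\<^sup>+t. ennreal ((norm (?F t))\<^sup>2) * indicator {0..1} t \<partial>lborel)"
      by (simp add: nn_integral_restrict_space)
    also have "\<dots> \<le> (\<integral>\<^sup>+t. ennreal ((N (x + t *\<^sub>R h) * norm h)\<^sup>2) * indicator {0..1} t \<partial>lborel)"
      by (intro nn_integral_mono mult_right_mono ennreal_leI power_mono bnd) auto
    finally show ?thesis .
  qed
  have "(\<integral>\<^sup>+x. ennreal ((norm (f (x + h) - f x))\<^sup>2) \<partial>lborel)
      \<le> (\<integral>\<^sup>+x. (\<integral>\<^sup>+t. ennreal ((N (x + t *\<^sub>R h) * norm h)\<^sup>2) * indicator {0..1} t \<partial>lborel) \<partial>lborel)"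
    by (intro nn_integral_mono ptw)
  also have "\<dots> = (\<integral>\<^sup>+t. (\<integral>\<^sup>+x. ennreal ((N (x + t *\<^sub>R h) * norm h)\<^sup>2) * indicator {0..1} t \<partial>lborel) \<partial>lborel)"
    by (rule lborel_pair.Fubini') simp
  also have "\<dots> = (\<integral>\<^sup>+t. (ennreal ((norm h)\<^sup>2) * (\<integral>\<^sup>+x. ennreal ((N x)\<^sup>2) \<partial>lborel)) * indicator {0..1::real} t \<partial>lborel)"
  proof (rule nn_integral_cong)
    fix t :: real
    have "(\<integral>\<^sup>+x. ennreal ((N (x + t *\<^sub>R h) * norm h)\<^sup>2) * indicator {0..1} t \<partial>lborel)
      = (\<integral>\<^sup>+x. ennreal ((norm h)\<^sup>2) * ennreal ((N (t *\<^sub>R h + x))\<^sup>2) * indicator {0..1} t \<partial>lborel)"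
      by (simp add: power_mult_distrib ennreal_mult ac_simps)
    also have "\<dots> = ennreal ((norm h)\<^sup>2) * (\<integral>\<^sup>+x. ennreal ((N (t *\<^sub>R h + x))\<^sup>2) \<partial>lborel) * indicator {0..1} t"
      by (simp add: nn_integral_cmult nn_integral_multc)
    also have "(\<integral>\<^sup>+x. ennreal ((N (t *\<^sub>R h + x))\<^sup>2) \<partial>lborel) = (\<integral>\<^sup>+x. ennreal ((N x)\<^sup>2) \<partial>lborel)"
      by (rule nn_integral_lborel_translate) simp
    finally show "(\<integral>\<^sup>+x. ennreal ((N (x + t *\<^sub>R h) * norm h)\<^sup>2) * indicator {0..1} t \<partial>lborel)
      = (ennreal ((norm h)\<^sup>2) * (\<integral>\<^sup>+x. ennreal ((N x)\<^sup>2) \<partial>lborel)) * indicator {0..1} t" .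
  qed
  also have "\<dots> = ennreal ((norm h)\<^sup>2) * (\<integral>\<^sup>+x. ennreal ((N x)\<^sup>2) \<partial>lborel)"
    by (simp add: nn_integral_cmult)
  finally show ?thesis .
qed

section \<open>Averages over the cells of a grid\<close>

text \<open>The lower corner of the cell of side \<open>s\<close> that contains \<open>x\<close>.
  Only countably many corners occur, so quantities indexed by them admit a diagonal
  argument.\<close>

definition grid :: "real \<Rightarrow> 'a::euclidean_space \<Rightarrow> 'a" where
  "grid s x = (\<Sum>b\<in>Basis. (s * of_int \<lfloor>(x \<bullet> b) / s\<rfloor>) *\<^sub>R b)"

text \<open>The cell with lower corner \<open>z\<close> is rescaled to the unit cube, whose volume
  is 1; Jensen's inequality then applies without a normalising factor.\<close>

definition cell_average :: "real \<Rightarrow> ('a::euclidean_space \<Rightarrow> 'b::euclidean_space) \<Rightarrow> 'a \<Rightarrow> 'b" where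
  "cell_average s f z = (\<integral>h. f (z + s *\<^sub>R h) \<partial>(restrict_space lborel (cbox 0 One)))"

lemma finite_measure_unit_cube: "finite_measure (restrict_space lborel (cbox 0 (One::'a::euclidean_space)))"
  by (rule finite_measureI) (simp add: emeasure_restrict_space emeasure_lborel_cbox_eq)

lemma measure_unit_cube:
  "measure (restrict_space lborel (cbox 0 (One::'a::euclidean_space))) (space (restrict_space lborel (cbox 0 (One::'a)))) = 1"
  by (simp add: measure_restrict_space measure_lborel_cbox_eq)

lemma countable_range_grid: "countable (range (grid s :: 'a::euclidean_space \<Rightarrow> 'a))"
proof (rule countable_subset)
  show "range (grid s :: 'a \<Rightarrow> 'a)
      \<subseteq> (\<lambda>k. \<Sum>b\<in>Basis. (s * of_int (k b)) *\<^sub>R b) ` (\<Pi>\<^sub>E b\<in>(Basis::'a set). (UNIV :: int set))"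
  proof safe
    fix x :: 'a
    show "grid s x \<in> (\<lambda>k. \<Sum>b\<in>Basis. (s * of_int (k b)) *\<^sub>R b) ` (\<Pi>\<^sub>E b\<in>(Basis::'a set). (UNIV :: int set))"
      by (rule image_eqI[where x="\<lambda>b\<in>Basis. \<lfloor>(x \<bullet> b) / s\<rfloor>"]) (auto simp: grid_def)
  qed
  show "countable ((\<lambda>k. \<Sum>b\<in>Basis. (s * of_int (k b)) *\<^sub>R b) ` (\<Pi>\<^sub>E b\<in>(Basis::'a set). (UNIV :: int set)))"
    by (intro countable_image countable_PiE) auto
qed

lemma grid_in_cube:
  fixes x :: "'a::euclidean_space"
  assumes "s > 0"
  shows "(x - grid s x) /\<^sub>R s \<in> cbox 0 One"
proof -
  have "0 \<le> (x - grid s x) \<bullet> b / s \<and> (x - grid s x) \<bullet> b / s \<le> 1" if "b \<in> Basis" for b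
  proof -
    have "grid s x \<bullet> b = s * of_int \<lfloor>(x \<bullet> b) / s\<rfloor>"
      using that unfolding grid_def by simp
    then have "(x - grid s x) \<bullet> b / s = (x \<bullet> b) / s - of_int \<lfloor>(x \<bullet> b) / s\<rfloor>"
      using assms by (simp add: inner_diff_left diff_divide_distrib)
    then show ?thesis by linarith
  qed
  then show ?thesis by (auto simp: mem_box divide_inverse mult.commute)
qed

lemma borel_measurable_grid[measurable]: "grid s \<in> borel_measurable borel"
  unfolding grid_def by measurable

lemma borel_measurable_cell_average_grid:
  assumes [measurable]: "f \<in> borel_measurable borel"
  shows "(\<lambda>x. cell_average s f (grid s x)) \<in> borel_measurable borel"
proof -
  have "(\<lambda>x. \<integral>h. indicator (cbox 0 One) h *\<^sub>R f (grid s x + s *\<^sub>R h) \<partial>lborel) \<in> borel_measurable borel"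
    by measurable
  then show ?thesis
    unfolding cell_average_def by (subst integral_restrict_space) auto
qed

lemma norm_cell_average_le:
  assumes [measurable]: "f \<in> borel_measurable borel" and "\<And>x. norm (f x) \<le> B"
  shows "norm (cell_average s f z) \<le> B"
proof -
  let ?M = "restrict_space lborel (cbox 0 (One::'a))"
  interpret finite_measure ?M by (rule finite_measure_unit_cube)
  have [measurable]: "(\<lambda>h. f (z + s *\<^sub>R h)) \<in> borel_measurable ?M"
    by (intro measurable_restrict_space1) simp
  have "norm (cell_average s f z) \<le> (\<integral>h. norm (f (z + s *\<^sub>R h)) \<partial>?M)"
    unfolding cell_average_def by (rule integral_norm_bound)
  also have "\<dots> \<le> (\<integral>h. B \<partial>?M)"
    by (intro integral_mono integrable_const integrable_const_bound[where B=B]) (use assms in auto)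
  also have "\<dots> = B" using measure_unit_cube[where 'a='a] by simp
  finally show ?thesis .
qed

text \<open>Jensen's inequality bounds the deviation at \<open>x\<close> by a mean of squared
  differences \<open>f (x + s h) - f x\<close>, with \<open>h\<close> ranging over a cube that does
  not depend on \<open>x\<close>. Exchanging the integrals and applying the translation estimate to
  the step \<open>s h\<close> yields the factor \<open>s^2\<close>.\<close>

lemma nn_integral_cell_average_diff_le:
  fixes f :: "'a::euclidean_space \<Rightarrow> 'b::euclidean_space" and N :: "'a \<Rightarrow> real"
  assumes der: "\<And>x. (f has_derivative f' x) (at x)"
    and cont: "\<And>h. continuous_on UNIV (\<lambda>x. f' x h)"
    and N[measurable]: "N \<in> borel_measurable borel" and bnd: "\<And>x h. norm (f' x h) \<le> N x * norm h"
    and "s > 0"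
  shows "(\<integral>\<^sup>+x. ennreal ((norm (f x - cell_average s f (grid s x)))\<^sup>2) \<partial>lborel)
    \<le> (\<integral>\<^sup>+h\<in>cbox (- One) One. ennreal ((norm (h :: 'a))\<^sup>2) \<partial>lborel) * (ennreal (s\<^sup>2) * (\<integral>\<^sup>+x. ennreal ((N x)\<^sup>2) \<partial>lborel))"
proof -
  have "continuous_on UNIV f"
    using der has_derivative_continuous continuous_at_imp_continuous_on by blast
  then have [measurable]: "f \<in> borel_measurable borel" by (rule borel_measurable_continuous_onI)
  let ?M = "restrict_space lborel (cbox 0 (One::'a))"
  interpret finite_measure ?M by (rule finite_measure_unit_cube)
  have ptw: "ennreal ((norm (f x - cell_average s f (grid s x)))\<^sup>2)
      \<le> (\<integral>\<^sup>+h. ennreal ((norm (f (x + s *\<^sub>R h) - f x))\<^sup>2) * indicator (cbox (- One) One) h \<partial>lborel)" for x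
  proof -
    define z where "z = grid s x"
    \<comment> \<open>The relative position of \<open>x\<close> in its cell, rescaled to the unit
      cube.\<close>
    define w where "w = (x - z) /\<^sub>R s"
    have w: "w \<in> cbox 0 One" unfolding w_def z_def by (rule grid_in_cube[OF \<open>s > 0\<close>])
    have z: "z = x - s *\<^sub>R w" using \<open>s > 0\<close> by (simp add: w_def)
    have m[measurable]: "(\<lambda>h. f (z + s *\<^sub>R h) - f x) \<in> borel_measurable ?M" "(\<lambda>h. f (z + s *\<^sub>R h)) \<in> borel_measurable ?M"
      by (auto intro!: measurable_restrict_space1)
    show ?thesis
    proof (cases "integrable ?M (\<lambda>h. f (z + s *\<^sub>R h))")
      case True
      have "cell_average s f z - f x = (\<integral>h. f (z + s *\<^sub>R h) - f x \<partial>?M)"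
        using True measure_unit_cube[where 'a='a] by (simp add: cell_average_def)
      then have "ennreal ((norm (f x - cell_average s f z))\<^sup>2) = ennreal ((norm (\<integral>h. f (z + s *\<^sub>R h) - f x \<partial>?M))\<^sup>2)"
        by (metis norm_minus_commute)
      also have "\<dots> \<le> (\<integral>\<^sup>+h. ennreal ((norm (f (z + s *\<^sub>R h) - f x))\<^sup>2) \<partial>?M)"
        by (rule norm_integral_sq_le_nn_integral[OF finite_measure_unit_cube measure_unit_cube m(1)])
      also have "\<dots> = (\<integral>\<^sup>+h. ennreal ((norm (f (z + s *\<^sub>R h) - f x))\<^sup>2) * indicator (cbox 0 One) h \<partial>lborel)"
        by (simp add: nn_integral_restrict_space)
      \<comment> \<open>Recentring at \<open>x\<close>: the shifted unit cube lies in
        \<open>cbox (- One) One\<close> whatever \<open>w\<close> is, and this larger domain of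
        integration makes the exchange of integrals possible.\<close>
      also have "\<dots> = (\<integral>\<^sup>+h. ennreal ((norm (f (z + s *\<^sub>R (w + h)) - f x))\<^sup>2) * indicator (cbox 0 One) (w + h) \<partial>lborel)"
        by (rule nn_integral_lborel_translate[symmetric]) simp
      also have "\<dots> \<le> (\<integral>\<^sup>+h. ennreal ((norm (f (x + s *\<^sub>R h) - f x))\<^sup>2) * indicator (cbox (- One) One) h \<partial>lborel)"
      proof (rule nn_integral_mono)
        fix h :: 'a
        have "h \<in> cbox (- One) One" if "w + h \<in> cbox 0 One"
          using that w by (fastforce simp: mem_box inner_simps)
        then show "ennreal ((norm (f (z + s *\<^sub>R (w + h)) - f x))\<^sup>2) * indicator (cbox 0 One) (w + h)
            \<le> ennreal ((norm (f (x + s *\<^sub>R h) - f x))\<^sup>2) * indicator (cbox (- One) One) h"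
          by (auto simp: z scaleR_add_right indicator_def)
      qed
      finally show ?thesis by (simp add: z_def)
    next
      case False
      have "continuous_on (cbox 0 One) (\<lambda>h. f (z + s *\<^sub>R h))"
        by (rule continuous_on_compose2[OF \<open>continuous_on UNIV f\<close>]) (auto intro!: continuous_intros)
      then have "integrable ?M (\<lambda>h. f (z + s *\<^sub>R h))"
        by (subst integrable_restrict_space) (auto intro!: borel_integrable_compact)
      with False show ?thesis by simp
    qed
  qed
  have "(\<integral>\<^sup>+x. ennreal ((norm (f x - cell_average s f (grid s x)))\<^sup>2) \<partial>lborel)
     \<le> (\<integral>\<^sup>+x. (\<integral>\<^sup>+h. ennreal ((norm (f (x + s *\<^sub>R h) - f x))\<^sup>2) * indicator (cbox (- One) One) h \<partial>lborel) \<partial>lborel)"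
    by (intro nn_integral_mono ptw)
  also have "\<dots> = (\<integral>\<^sup>+h. (\<integral>\<^sup>+x. ennreal ((norm (f (x + s *\<^sub>R h) - f x))\<^sup>2) * indicator (cbox (- One) One) h \<partial>lborel) \<partial>lborel)"
    by (rule lborel_pair.Fubini') simp
  also have "\<dots> = (\<integral>\<^sup>+h. (\<integral>\<^sup>+x. ennreal ((norm (f (x + s *\<^sub>R h) - f x))\<^sup>2) \<partial>lborel) * indicator (cbox (- One) One) h \<partial>lborel)"
    by (simp add: nn_integral_multc)
  also have "\<dots> \<le> (\<integral>\<^sup>+h. (ennreal ((norm (s *\<^sub>R h))\<^sup>2) * (\<integral>\<^sup>+x. ennreal ((N x)\<^sup>2) \<partial>lborel)) * indicator (cbox (- One) One) (h::'a) \<partial>lborel)"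
    by (intro nn_integral_mono mult_right_mono nn_integral_translate_diff_le[OF der cont N bnd]) auto
  also have "\<dots> = (\<integral>\<^sup>+h. (ennreal ((norm h)\<^sup>2) * indicator (cbox (- One) One) (h::'a)) * (ennreal (s\<^sup>2) * (\<integral>\<^sup>+x. ennreal ((N x)\<^sup>2) \<partial>lborel)) \<partial>lborel)"
    by (simp add: power_mult_distrib ennreal_mult ac_simps)
  also have "\<dots> = (\<integral>\<^sup>+h\<in>cbox (- One) One. ennreal ((norm (h :: 'a))\<^sup>2) \<partial>lborel) * (ennreal (s\<^sup>2) * (\<integral>\<^sup>+x. ennreal ((N x)\<^sup>2) \<partial>lborel))"
    by (rule nn_integral_multc) simp
  finally show ?thesis .
qed

lemma nn_integral_lebesgue_on_le:
  assumes "D \<in> sets lebesgue"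
  shows "(\<integral>\<^sup>+x. f x \<partial>(lebesgue_on D)) \<le> (\<integral>\<^sup>+x. f x \<partial>lborel)"
proof -
  have "(\<integral>\<^sup>+x. f x \<partial>(lebesgue_on D)) = (\<integral>\<^sup>+x. f x * indicator D x \<partial>lebesgue)"
    using assms by (simp add: nn_integral_restrict_space)
  also have "\<dots> \<le> (\<integral>\<^sup>+x. f x \<partial>lebesgue)"
    by (intro nn_integral_mono) (auto simp: indicator_def)
  finally show ?thesis by (simp add: nn_integral_completion)
qed

lemma finite_measure_lebesgue_on_bounded:
  assumes "open D" "bounded D"
  shows "finite_measure (lebesgue_on (D :: 'a::euclidean_space set))"
proof -
  have "D \<in> lmeasurable" using assms by (simp add: lmeasurable_open)
  then show ?thesis by (rule finite_measure_lebesgue_on)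
qed

lemma borel_imp_lebesgue_on_measurable:
  "f \<in> borel_measurable borel \<Longrightarrow> f \<in> borel_measurable (lebesgue_on D)"
  by (intro measurable_restrict_space1 measurable_completion) simp

lemma norm_sum4_sq_le: "(norm (a + b + c + d))\<^sup>2 \<le> 4 * ((norm a)\<^sup>2 + (norm b)\<^sup>2 + (norm c)\<^sup>2 + (norm d)\<^sup>2)"
  for a b c d :: "'b::real_inner"
  using norm_add_sq_le[of "a + b" "c + d"] norm_add_sq_le[of a b] norm_add_sq_le[of c d]
  by (simp add: add.assoc)

text \<open>Rellich's theorem.  On a grid of mesh \<open>s\<close> the cell averages are within \<open>O(s)\<close> of the map
  in the square mean, and there are only countably many of them.\<close>

proposition AE_convergent_subsequence_bounded_energy:
  fixes f :: "nat \<Rightarrow> 'a::euclidean_space \<Rightarrow> 'b::euclidean_space" and N :: "nat \<Rightarrow> 'a \<Rightarrow> real"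
  assumes der: "\<And>k x. (f k has_derivative f' k x) (at x)"
    and cont: "\<And>k h. continuous_on UNIV (\<lambda>x. f' k x h)"
    and N: "\<And>k. N k \<in> borel_measurable borel" and bnd: "\<And>k x h. norm (f' k x h) \<le> N k x * norm h"
    and B: "\<And>k x. norm (f k x) \<le> B"
    and E: "\<And>k. (\<integral>\<^sup>+x. ennreal ((N k x)\<^sup>2) \<partial>lborel) \<le> ennreal E"
    and D: "open D" "bounded D"
  obtains r g where "strict_mono (r :: nat \<Rightarrow> nat)" "g \<in> borel_measurable (lebesgue_on D)"
    "AE x in lebesgue_on D. (\<lambda>k. f (r k) x) \<longlonglongrightarrow> g x"
proof -
  let ?L = "lebesgue_on D"
  interpret finite_measure ?L by (rule finite_measure_lebesgue_on_bounded[OF D])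
  have "continuous_on UNIV (f k)" for k
    using der has_derivative_continuous continuous_at_imp_continuous_on by blast
  then have fm[measurable]: "f k \<in> borel_measurable borel" for k
    by (simp add: borel_measurable_continuous_onI)
  have fmL[measurable]: "f k \<in> borel_measurable ?L" for k by (simp add: borel_imp_lebesgue_on_measurable)
  have "norm (f 0 undefined) \<le> B" by (rule B)
  then have "B \<ge> 0" using norm_ge_zero order_trans by blast
  define s where "s j = 1 / real (Suc j)" for j
  have s: "s j > 0" for j by (simp add: s_def)
  \<comment> \<open>All pairs of a mesh size and a cell corner form one countable index set, so a
    single diagonal subsequence makes the cell averages converge for every mesh
    simultaneously.\<close>
  have "countable (SIGMA j:UNIV. range (grid (s j) :: 'a \<Rightarrow> 'a))"
    by (intro countable_SIGMA countable_range_grid) auto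
  then obtain r where r: "strict_mono (r :: nat \<Rightarrow> nat)" and
    conv: "\<And>p. p \<in> (SIGMA j:UNIV. range (grid (s j))) \<Longrightarrow> \<exists>l. (\<lambda>n. cell_average (s (fst p)) (f (r n)) (snd p)) \<longlonglongrightarrow> l"
    by (rule function_convergent_subsequence[where M=B and f="\<lambda>n p. cell_average (s (fst p)) (f n) (snd p)"])
       (use norm_cell_average_le[OF fm B] in blast)+
  define g where "g j n x = cell_average (s j) (f (r n)) (grid (s j) x)" for j n x
  have gB: "norm (g j n x) \<le> B" for j n x unfolding g_def by (rule norm_cell_average_le[OF fm B])
  have gm[measurable]: "g j n \<in> borel_measurable ?L" for j n
    unfolding g_def by (intro borel_imp_lebesgue_on_measurable borel_measurable_cell_average_grid fm)
  have "\<exists>G. \<forall>x. (\<lambda>n. g j n x) \<longlonglongrightarrow> G x" for j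
    using conv[of "(j, grid (s j) x)" for x] unfolding g_def by (intro choice) simp
  then obtain G where G: "\<And>j x. (\<lambda>n. g j n x) \<longlonglongrightarrow> G j x" by metis
  have Gm[measurable]: "G j \<in> borel_measurable ?L" for j
    by (rule borel_measurable_LIMSEQ_metric[OF gm]) (rule G)
  have GB: "norm (G j x) \<le> B" for j x
    by (rule Lim_bounded[OF tendsto_norm[OF G]]) (simp add: gB)
  have Glim: "(\<lambda>n. \<integral>x. (norm (g j n x - G j x))\<^sup>2 \<partial>?L) \<longlonglongrightarrow> 0" for j
  proof -
    have "(\<lambda>n. \<integral>x. (norm (g j n x - G j x))\<^sup>2 \<partial>?L) \<longlonglongrightarrow> (\<integral>x. 0 \<partial>?L)"
    proof (rule integral_dominated_convergence[where w="\<lambda>_. (2 * B)\<^sup>2"])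
      show "AE x in ?L. (\<lambda>n. (norm (g j n x - G j x))\<^sup>2) \<longlonglongrightarrow> 0"
      proof (intro AE_I2)
        fix x
        have "(\<lambda>n. (norm (g j n x - G j x))\<^sup>2) \<longlonglongrightarrow> (norm (G j x - G j x))\<^sup>2"
          by (intro tendsto_intros G)
        then show "(\<lambda>n. (norm (g j n x - G j x))\<^sup>2) \<longlonglongrightarrow> 0" by simp
      qed
      show "AE x in ?L. norm ((norm (g j n x - G j x))\<^sup>2) \<le> (2 * B)\<^sup>2" for n
      proof (intro AE_I2)
        fix x
        have "norm (g j n x - G j x) \<le> 2 * B"
          using norm_triangle_ineq4[of "g j n x" "G j x"] gB[of j n x] GB[of j x] by simp
        then have "(norm (g j n x - G j x))\<^sup>2 \<le> (2 * B)\<^sup>2" by (intro power_mono) auto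
        then show "norm ((norm (g j n x - G j x))\<^sup>2) \<le> (2 * B)\<^sup>2" by simp
      qed
    qed auto
    then show ?thesis by simp
  qed
  have sq: "sq_integrable ?L (f k)" "sq_integrable ?L (g j k)" "sq_integrable ?L (G j)" for j k
    by (rule sq_integrable_bounded[OF finite_measure_axioms, where B=B]; simp add: B gB GB)+
  define V where "V = (\<integral>\<^sup>+h\<in>cbox (- One) One. ennreal ((norm (h :: 'a))\<^sup>2) \<partial>lborel)"
  have "V < \<infinity>"
  proof -
    obtain c where c: "\<And>h. h \<in> cbox (- One) One \<Longrightarrow> norm (h::'a) \<le> c"
      using bounded_cbox bounded_iff by metis
    have "V \<le> (\<integral>\<^sup>+h. ennreal (c\<^sup>2) * indicator (cbox (- One) (One::'a)) h \<partial>lborel)"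
      unfolding V_def
      by (intro nn_integral_mono) (auto simp: indicator_def intro!: ennreal_leI power_mono c)
    also have "\<dots> < \<infinity>"
      by (simp add: nn_integral_cmult emeasure_lborel_cbox_eq ennreal_mult_less_top)
    finally show ?thesis .
  qed
  then obtain v where v: "V = ennreal v" "v \<ge> 0" by (cases V) auto
  \<comment> \<open>Since \<open>ennreal\<close> truncates at zero, replacing \<open>E\<close> by
    \<open>max E 0\<close> leaves the energy bound unchanged and makes the constant
    nonnegative.\<close>
  define C where "C = v * max E 0"
  have Cnn: "C \<ge> 0" using v by (simp add: C_def)
  have close: "(\<integral>x. (norm (f (r n) x - g j n x))\<^sup>2 \<partial>?L) \<le> C * (s j)\<^sup>2" for j n
  proof -
    have "ennreal (\<integral>x. (norm (f (r n) x - g j n x))\<^sup>2 \<partial>?L) = (\<integral>\<^sup>+x. ennreal ((norm (f (r n) x - g j n x))\<^sup>2) \<partial>?L)"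
      by (rule nn_integral_eq_integral[symmetric])
         (use sq_integrable_diff[OF sq(1) sq(2)] in \<open>auto simp: sq_integrable_def\<close>)
    also have "\<dots> \<le> (\<integral>\<^sup>+x. ennreal ((norm (f (r n) x - g j n x))\<^sup>2) \<partial>lborel)"
      using D(1) by (intro nn_integral_lebesgue_on_le) auto
    also have "\<dots> \<le> V * (ennreal ((s j)\<^sup>2) * (\<integral>\<^sup>+x. ennreal ((N (r n) x)\<^sup>2) \<partial>lborel))"
      unfolding g_def V_def by (rule nn_integral_cell_average_diff_le[OF der cont N bnd s])
    also have "\<dots> \<le> V * (ennreal ((s j)\<^sup>2) * ennreal (max E 0))"
      by (intro mult_left_mono order_trans[OF E] ennreal_leI) auto
    also have "\<dots> = ennreal (C * (s j)\<^sup>2)"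
      using v by (simp add: C_def ennreal_mult[symmetric] ac_simps)
    finally show ?thesis using Cnn by (subst (asm) ennreal_le_iff) auto
  qed
  have "\<exists>K. \<forall>m\<ge>K. \<forall>n\<ge>K. (\<integral>x. (norm (f (r m) x - f (r n) x))\<^sup>2 \<partial>?L) < e" if e: "e > 0" for e
  proof -
    \<comment> \<open>The mesh is fixed before the index: the distance to the cell averages is small
      uniformly in \<open>n\<close>, and for the chosen mesh the averages converge. Four terms, each
      below \<open>e/16\<close>, enter with the factor 4 of \<open>norm_sum4_sq_le\<close>.\<close>
    have "(\<lambda>j. C * (s j)\<^sup>2) \<longlonglongrightarrow> C * 0\<^sup>2"
      unfolding s_def by (intro tendsto_intros LIMSEQ_inverse_real_of_nat[unfolded inverse_eq_divide])
    then have "eventually (\<lambda>j. C * (s j)\<^sup>2 < e/16) sequentially"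
      by (rule order_tendstoD(2)) (use e in simp)
    then obtain j where j: "C * (s j)\<^sup>2 < e/16" by (auto simp: eventually_sequentially)
    have "eventually (\<lambda>n. (\<integral>x. (norm (g j n x - G j x))\<^sup>2 \<partial>?L) < e/16) sequentially"
      by (rule order_tendstoD(2)[OF Glim]) (use e in simp)
    then obtain K where K: "\<And>n. n \<ge> K \<Longrightarrow> (\<integral>x. (norm (g j n x - G j x))\<^sup>2 \<partial>?L) < e/16"
      by (auto simp: eventually_sequentially)
    have arith: "4 * (p + q + u + v) < e" if "p \<le> c" "q < e/16" "u < e/16" "v \<le> c" "c < e/16" for p q u v c :: real
      using that by argo
    have "(\<integral>x. (norm (f (r m) x - f (r n) x))\<^sup>2 \<partial>?L) < e" if "m \<ge> K" "n \<ge> K" for m n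
    proof -
      let ?a = "\<lambda>n x. (norm (f (r n) x - g j n x))\<^sup>2" and ?b = "\<lambda>n x. (norm (g j n x - G j x))\<^sup>2"
      have i: "integrable ?L (?a n)" "integrable ?L (?b n)" for n
        using sq_integrable_diff[OF sq(1)[of "r n"] sq(2)[of j n]] sq_integrable_diff[OF sq(2)[of j n] sq(3)]
        by (auto simp: sq_integrable_def)
      have "(\<integral>x. (norm (f (r m) x - f (r n) x))\<^sup>2 \<partial>?L) \<le> (\<integral>x. 4 * (?a m x + ?b m x + ?b n x + ?a n x) \<partial>?L)"
      proof (rule integral_mono)
        show "integrable ?L (\<lambda>x. (norm (f (r m) x - f (r n) x))\<^sup>2)"
          using sq_integrable_diff[OF sq(1)[of "r m"] sq(1)[of "r n"]] by (simp add: sq_integrable_def)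
        show "integrable ?L (\<lambda>x. 4 * (?a m x + ?b m x + ?b n x + ?a n x))" by (intro integrable_mult_right Bochner_Integration.integrable_add i)
        show "(norm (f (r m) x - f (r n) x))\<^sup>2 \<le> 4 * (?a m x + ?b m x + ?b n x + ?a n x)" for x
          using norm_sum4_sq_le[of "f (r m) x - g j m x" "g j m x - G j x" "G j x - g j n x" "g j n x - f (r n) x"]
          by (simp add: norm_minus_commute)
      qed
      also have "\<dots> = 4 * ((\<integral>x. ?a m x \<partial>?L) + (\<integral>x. ?b m x \<partial>?L) + (\<integral>x. ?b n x \<partial>?L) + (\<integral>x. ?a n x \<partial>?L))"
        by (simp add: i)
      also have "\<dots> < e"
        by (rule arith[OF close K[OF that(1)] K[OF that(2)] close j])
      finally show ?thesis .
    qed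
    then show ?thesis by blast
  qed
  from sq_integrable_complete[where f="\<lambda>n. f (r n)", OF finite_measure_axioms sq(1) this]
  obtain p q where pq: "sq_integrable ?L p" "strict_mono (q :: nat \<Rightarrow> nat)" "AE x in ?L. (\<lambda>k. f (r (q k)) x) \<longlonglongrightarrow> p x"
    by blast
  have "strict_mono (r \<circ> q)" using r pq(2) by (rule strict_mono_o)
  moreover have "p \<in> borel_measurable ?L" using pq(1) by (rule sq_integrable_measurable)
  ultimately show ?thesis using pq(3) that[of "r \<circ> q" p] by simp
qed

section \<open>Integration by parts\<close>

lemma bounded_range_compact_support:
  fixes f :: "'a::euclidean_space \<Rightarrow> real"
  assumes "continuous_on UNIV f" "compact K" "\<And>x. x \<notin> K \<Longrightarrow> f x = 0"
  obtains B where "\<And>x. \<bar>f x\<bar> \<le> B" "B \<ge> 0"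
proof -
  have "bounded (f ` K)"
    by (intro compact_imp_bounded compact_continuous_image continuous_on_subset[OF assms(1)] assms(2)) simp
  then obtain B where "\<And>x. x \<in> K \<Longrightarrow> norm (f x) \<le> B" "B > 0"
    by (auto simp: bounded_pos)
  then show ?thesis using assms(3) that[of B] by (metis abs_zero less_imp_le real_norm_def)
qed

lemma integrable_compact_support:
  fixes f :: "'a::euclidean_space \<Rightarrow> 'b::euclidean_space"
  assumes "continuous_on UNIV f" "compact K" "\<And>x. x \<notin> K \<Longrightarrow> f x = 0"
  shows "integrable lborel f"
proof -
  have "integrable lborel (\<lambda>x. indicator K x *\<^sub>R f x)"
    by (intro borel_integrable_compact assms(2) continuous_on_subset[OF assms(1)]) simp
  moreover have "(\<lambda>x. indicator K x *\<^sub>R f x) = f" using assms(3) by (auto simp: indicator_def)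
  ultimately show ?thesis by simp
qed

text \<open>Difference quotients of a compactly supported function have integral zero by translation
  invariance. They converge to the directional derivative, and the mean value theorem together with
  the compact support provides a dominating function.\<close>

proposition integral_derivative_compact_support:
  fixes u :: "'a::euclidean_space \<Rightarrow> real"
  assumes der: "\<And>x. (u has_derivative u' x) (at x)"
    and cont: "continuous_on UNIV (\<lambda>x. u' x h)"
    and K: "compact K" "\<And>x. x \<notin> K \<Longrightarrow> u x = 0" "\<And>x. x \<notin> K \<Longrightarrow> u' x h = 0"
  shows "(\<integral>x. u' x h \<partial>lborel) = 0"
proof -
  have cu: "continuous_on UNIV u"
    using der has_derivative_continuous continuous_at_imp_continuous_on by blast
  then have um[measurable]: "u \<in> borel_measurable borel" by (rule borel_measurable_continuous_onI)
  have [measurable]: "(\<lambda>x. u' x h) \<in> borel_measurable borel" using cont by (rule borel_measurable_continuous_onI)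
  obtain B where B: "\<And>x. \<bar>u' x h\<bar> \<le> B" "B \<ge> 0" using bounded_range_compact_support[OF cont K(1,3)] by blast
  obtain R where R: "\<And>x. x \<in> K \<Longrightarrow> norm x \<le> R" using compact_imp_bounded[OF K(1)] bounded_iff by metis
  define t where "t n = 1 / real (Suc n)" for n
  have t: "0 < t n" "t n \<le> 1" for n by (auto simp: t_def)
  have tlim: "t \<longlonglongrightarrow> 0" unfolding t_def by (rule LIMSEQ_inverse_real_of_nat[unfolded inverse_eq_divide])
  define d where "d n x = (u (t n *\<^sub>R h + x) - u x) / t n" for n x
  have line: "((\<lambda>s. u (s *\<^sub>R h + x)) has_real_derivative u' (s *\<^sub>R h + x) h) (at s)" for s x
  proof -
    have "((\<lambda>s. u (s *\<^sub>R h + x)) has_derivative (\<lambda>y. u' (s *\<^sub>R h + x) (y *\<^sub>R h))) (at s)"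
      by (rule has_derivative_compose[OF _ der]) (auto intro!: derivative_eq_intros)
    moreover have "u' (s *\<^sub>R h + x) (y *\<^sub>R h) = u' (s *\<^sub>R h + x) h * y" for y
      using has_derivative_linear[OF der] by (simp add: linear_cmul)
    ultimately show ?thesis by (simp add: has_field_derivative_def)
  qed
  have dB: "\<bar>d n x\<bar> \<le> B" for n x
  proof -
    obtain z where "u (t n *\<^sub>R h + x) - u (0 *\<^sub>R h + x) = (t n - 0) * u' (z *\<^sub>R h + x) h"
      using MVT2[OF t(1)[of n], of "\<lambda>s. u (s *\<^sub>R h + x)" "\<lambda>s. u' (s *\<^sub>R h + x) h"] line by blast
    then show ?thesis using B t(1)[of n] by (simp add: d_def)
  qed
  \<comment> \<open>All steps \<open>t n\<close> are at most 1, so enlarging the ball around the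
    support by \<open>norm h\<close> captures the supports of all difference quotients.\<close>
  have "(\<lambda>n. \<integral>x. d n x \<partial>lborel) \<longlonglongrightarrow> (\<integral>x. u' x h \<partial>lborel)"
  proof (rule integral_dominated_convergence[where w="\<lambda>x. B * indicator (cball 0 (R + norm h)) x"])
    show "integrable lborel (\<lambda>x. B * indicator (cball 0 (R + norm h)) x :: real)"
      by (intro integrable_mult_right integrable_real_indicator emeasure_lborel_cball_finite) simp
    show "AE x in lborel. (\<lambda>n. d n x) \<longlonglongrightarrow> u' x h"
    proof (intro AE_I2)
      fix x
      have "((\<lambda>s. (u (s *\<^sub>R h + x) - u x) / s) \<longlongrightarrow> u' x h) (at 0)"
        using line[where s=0 and x=x] by (simp add: has_field_derivative_iff)
      then show "(\<lambda>n. d n x) \<longlonglongrightarrow> u' x h"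
        unfolding d_def
        by (rule filterlim_compose) (use tlim t in \<open>auto simp: filterlim_at intro!: always_eventually less_imp_neq[THEN not_sym]\<close>)
    qed
    show "AE x in lborel. norm (d n x) \<le> B * indicator (cball 0 (R + norm h)) x" for n
    proof (intro AE_I2)
      fix x
      have "d n x = 0" if "x \<notin> cball 0 (R + norm h)"
      proof -
        have nx: "norm x > R + norm h" using that by simp
        have "norm (t n *\<^sub>R h) \<le> norm h" using t[of n] by (simp add: mult_left_le_one_le)
        then have "norm (t n *\<^sub>R h + x) > R" using nx norm_diff_ineq[of x "t n *\<^sub>R h"] by (simp add: add.commute)
        then have "t n *\<^sub>R h + x \<notin> K" using R[of "t n *\<^sub>R h + x"] by linarith
        moreover have "x \<notin> K" using R[of x] nx norm_ge_zero[of h] by linarith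
        ultimately show ?thesis by (simp add: d_def K)
      qed
      then show "norm (d n x) \<le> B * indicator (cball 0 (R + norm h)) x"
        using dB[of n x] by (auto simp: indicator_def)
    qed
  qed (auto simp: d_def)
  moreover have "(\<integral>x. d n x \<partial>lborel) = 0" for n
  proof -
    have iu: "integrable lborel u" by (rule integrable_compact_support[OF cu K(1,2)])
    have "integrable (distr lborel borel ((+) (t n *\<^sub>R h))) u" using iu by (simp add: lborel_distr_plus)
    then have iu': "integrable lborel (\<lambda>x. u (t n *\<^sub>R h + x))" by (subst (asm) integrable_distr_eq) auto
    have "(\<integral>x. u x \<partial>lborel) = (\<integral>x. u x \<partial>(distr lborel borel ((+) (t n *\<^sub>R h))))" by (simp add: lborel_distr_plus)
    also have "\<dots> = (\<integral>x. u (t n *\<^sub>R h + x) \<partial>lborel)" by (subst integral_distr) auto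
    finally show ?thesis using iu iu' by (simp add: d_def)
  qed
  ultimately show ?thesis by (simp add: LIMSEQ_const_iff)
qed

section \<open>Matrices and rotations in a coordinate plane\<close>

text \<open>In this form the product rule, continuity and passage to limits for matrix products come
  from the general theory of bounded bilinear maps.\<close>

lemma bounded_bilinear_matrix_mult:
  "bounded_bilinear ((**) :: real ^ 'n ^ 'm \<Rightarrow> real ^ 'p ^ 'n \<Rightarrow> real ^ 'p ^ 'm)"
  unfolding bilinear_conv_bounded_bilinear[symmetric]
  by (auto simp: bilinear_def linear_iff matrix_matrix_mult_def vec_eq_iff sum.distrib algebra_simps
      sum_distrib_left)

lemmas matrix_mult_bilinear_simps =
  bounded_bilinear.add_left[OF bounded_bilinear_matrix_mult]
  bounded_bilinear.add_right[OF bounded_bilinear_matrix_mult]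
  bounded_bilinear.diff_left[OF bounded_bilinear_matrix_mult]
  bounded_bilinear.diff_right[OF bounded_bilinear_matrix_mult]
  bounded_bilinear.minus_left[OF bounded_bilinear_matrix_mult]
  bounded_bilinear.minus_right[OF bounded_bilinear_matrix_mult]
  bounded_bilinear.scaleR_left[OF bounded_bilinear_matrix_mult]
  bounded_bilinear.scaleR_right[OF bounded_bilinear_matrix_mult]
  bounded_bilinear.zero_left[OF bounded_bilinear_matrix_mult]
  bounded_bilinear.zero_right[OF bounded_bilinear_matrix_mult]

lemma inner_matrix_mult_left: "(U ** M) \<bullet> N = M \<bullet> (transpose U ** N)"
  for U :: "real ^ 'n ^ 'm" and M :: "real ^ 'p ^ 'n"
proof -
  have "(U ** M) \<bullet> N = (\<Sum>i\<in>UNIV. \<Sum>j\<in>UNIV. \<Sum>k\<in>UNIV. U $ i $ k * M $ k $ j * N $ i $ j)"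
    by (simp add: inner_vec_def matrix_matrix_mult_def sum_distrib_right)
  also have "\<dots> = (\<Sum>i\<in>UNIV. \<Sum>k\<in>UNIV. \<Sum>j\<in>UNIV. U $ i $ k * M $ k $ j * N $ i $ j)"
    by (intro sum.cong refl sum.swap)
  also have "\<dots> = (\<Sum>k\<in>UNIV. \<Sum>i\<in>UNIV. \<Sum>j\<in>UNIV. U $ i $ k * M $ k $ j * N $ i $ j)"
    by (rule sum.swap)
  also have "\<dots> = (\<Sum>k\<in>UNIV. \<Sum>j\<in>UNIV. \<Sum>i\<in>UNIV. U $ i $ k * M $ k $ j * N $ i $ j)"
    by (intro sum.cong refl sum.swap)
  also have "\<dots> = M \<bullet> (transpose U ** N)"
    by (simp add: inner_vec_def matrix_matrix_mult_def transpose_def sum_distrib_left ac_simps)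
  finally show ?thesis .
qed

lemma norm_orthogonal_mult_left:
  fixes U :: "real ^ 'n ^ 'n" and M :: "real ^ 'p ^ 'n"
  assumes "orthogonal_matrix U"
  shows "norm (U ** M) = norm M"
  using assms by (simp add: norm_eq_sqrt_inner inner_matrix_mult_left matrix_mul_assoc orthogonal_matrix)

lemma norm_transpose: "norm (transpose M) = norm (M :: real ^ 'n ^ 'm)"
proof -
  have "transpose M \<bullet> transpose M = M \<bullet> M"
    unfolding inner_vec_def transpose_def by (simp, rule sum.swap)
  then show ?thesis by (simp add: norm_eq_sqrt_inner)
qed

lemma norm_orthogonal_mult_right:
  fixes U :: "real ^ 'n ^ 'n" and M :: "real ^ 'n ^ 'm"
  assumes "orthogonal_matrix U"
  shows "norm (M ** U) = norm M"
proof -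
  have "norm (M ** U) = norm (transpose U ** transpose M)"
    by (simp add: norm_transpose flip: matrix_transpose_mul)
  then show ?thesis using assms by (simp add: norm_orthogonal_mult_left norm_transpose)
qed

lemma norm_orthogonal_matrix:
  assumes "orthogonal_matrix (U :: real ^ 'n ^ 'n)"
  shows "norm U = sqrt (real CARD('n))"
proof -
  have "norm U = norm (mat 1 :: real ^ 'n ^ 'n)" using norm_orthogonal_mult_left[OF assms, of "mat 1"] by simp
  also have "\<dots> = sqrt (real CARD('n))"
    by (simp add: norm_eq_sqrt_inner inner_vec_def mat_def if_distrib[of "\<lambda>x. x * _"] cong: if_cong)
  finally show ?thesis .
qed

lemma transpose_linear: "transpose (M + N) = transpose M + transpose N" "transpose (M - N) = transpose M - transpose N"
  "transpose (- M) = - transpose M" "transpose (c *\<^sub>R M) = c *\<^sub>R transpose M"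
  for M N :: "real ^ 'n ^ 'm"
  by (simp_all add: transpose_def vec_eq_iff)

section \<open>The one-parameter group generated by a skew matrix\<close>

text \<open>Rodrigues' formula: this is the exponential of \<open>\<theta> A\<close> for every
  \<open>A\<close> whose cube is \<open>- A\<close>. The closed form reduces the group law and the
  derivative to trigonometric identities.\<close>

definition rot :: "real ^ 'n ^ 'n \<Rightarrow> real \<Rightarrow> real ^ 'n ^ 'n" where
  "rot A \<theta> = mat 1 + sin \<theta> *\<^sub>R A + (1 - cos \<theta>) *\<^sub>R (A ** A)"

lemma rot_0 [simp]: "rot A 0 = mat 1"
  by (simp add: rot_def)

context
  fixes A :: "real ^ 'n ^ 'n"
  assumes cube: "A ** A ** A = - A" and skew: "transpose A = - A"
begin

lemma rot_mult: "rot A a ** rot A b = rot A (a + b)"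
proof -
  define B where "B = A ** A"
  have B: "A ** B = - A" "B ** A = - A" "A ** A = B" using cube by (simp_all add: B_def matrix_mul_assoc)
  have BB: "B ** B = - B"
    by (metis B_def B(1) matrix_mul_assoc matrix_mult_bilinear_simps(6) B(3))
  show ?thesis
    unfolding rot_def B
    by (simp add: matrix_mult_bilinear_simps B BB)
       (simp add: vec_eq_iff sin_add cos_add algebra_simps)
qed

lemma transpose_rot: "transpose (rot A \<theta>) = rot A (- \<theta>)"
proof -
  have "transpose (A ** A) = A ** A"
    by (simp add: matrix_transpose_mul skew matrix_mult_bilinear_simps)
  then show ?thesis by (simp add: rot_def transpose_linear skew)
qed

lemma orthogonal_rot: "orthogonal_matrix (rot A \<theta>)"
  by (simp add: orthogonal_matrix transpose_rot rot_mult)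

text \<open>Halving the angle exhibits the rotation as a square, so its determinant is the square of
  a nonzero number.\<close>

lemma det_rot_pos: "det (rot A \<theta>) > 0"
proof -
  have "det (rot A \<theta>) = (det (rot A (\<theta> / 2)))\<^sup>2"
    using rot_mult[of "\<theta> / 2" "\<theta> / 2"] det_mul[of "rot A (\<theta> / 2)" "rot A (\<theta> / 2)"] by (simp add: power2_eq_square)
  moreover have "det (rot A (\<theta> / 2)) \<noteq> 0"
    using det_orthogonal_matrix[OF orthogonal_rot, of "\<theta> / 2"] by auto
  ultimately show ?thesis by simp
qed

lemma rot_commute: "A ** rot A \<theta> = rot A \<theta> ** A"
  by (simp add: rot_def matrix_mult_bilinear_simps matrix_mul_assoc)

lemma transpose_rot_conj: "transpose (rot A \<theta>) ** A ** rot A \<theta> = A"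
proof -
  have "transpose (rot A \<theta>) ** A ** rot A \<theta> = (transpose (rot A \<theta>) ** rot A \<theta>) ** A"
    by (simp add: matrix_mul_assoc[symmetric] rot_commute)
  then show ?thesis using orthogonal_rot by (simp add: orthogonal_matrix)
qed

lemma has_derivative_rot: "(rot A has_derivative (\<lambda>h. h *\<^sub>R (A ** rot A \<theta>))) (at \<theta>)"
proof -
  have "A ** rot A \<theta> = cos \<theta> *\<^sub>R A + sin \<theta> *\<^sub>R (A ** A)"
    by (simp add: rot_def matrix_mult_bilinear_simps matrix_mul_assoc cube algebra_simps)
  moreover have "(rot A has_derivative (\<lambda>h. (h * cos \<theta>) *\<^sub>R A + (h * sin \<theta>) *\<^sub>R (A ** A))) (at \<theta>)"
    unfolding rot_def[abs_def] by (auto intro!: derivative_eq_intros)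
  ultimately show ?thesis by (simp add: scaleR_add_right)
qed

end

definition matrix_unit :: "'n \<Rightarrow> 'n \<Rightarrow> real ^ 'n ^ 'n" where
  "matrix_unit i j = (\<chi> k l. if k = i \<and> l = j then 1 else 0)"

definition plane_generator :: "'n \<Rightarrow> 'n \<Rightarrow> real ^ 'n ^ 'n" where
  "plane_generator i j = matrix_unit i j - matrix_unit j i"

lemma matrix_unit_mult: "matrix_unit i j ** matrix_unit k l = (if j = k then matrix_unit i l else 0)"
  by (auto simp: matrix_unit_def matrix_matrix_mult_def vec_eq_iff if_distrib[of "\<lambda>x. x * _"]
      if_distrib[of "\<lambda>x. _ * x"] cong: if_cong)

text \<open>The generator acts as a quarter turn, up to orientation, on the plane of the two
  coordinates and annihilates the remaining ones.\<close>

lemma plane_generator_cube: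
  assumes "i \<noteq> j"
  shows "plane_generator i j ** plane_generator i j ** plane_generator i j = - plane_generator i j"
  using assms by (simp add: plane_generator_def matrix_mult_bilinear_simps matrix_unit_mult)

lemma plane_generator_skew: "transpose (plane_generator i j) = - plane_generator i j"
proof -
  have "transpose (matrix_unit k l) = matrix_unit l k" for k l :: 'a
    unfolding transpose_def matrix_unit_def by (simp add: vec_eq_iff conj_commute)
  then show ?thesis by (simp add: plane_generator_def transpose_linear)
qed

section \<open>Tensors as families of matrices\<close>

text \<open>\<open>slice a G\<close> is the matrix of \<open>a\<close>-th partial derivatives when \<open>G\<close> is a gradient.\<close>

definition slice :: "'m \<Rightarrow> real ^ 'm ^ 'n ^ 'n \<Rightarrow> real ^ 'n ^ 'n" where
  "slice a G = (\<chi> i j. G $ i $ j $ a)"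

lemma slice_nth [simp]: "slice a G $ i $ j = G $ i $ j $ a"
  by (simp add: slice_def)

definition join_slices :: "('m \<Rightarrow> real ^ 'n ^ 'n) \<Rightarrow> real ^ 'm ^ 'n ^ 'n" where
  "join_slices f = (\<chi> i j a. f a $ i $ j)"

lemma slice_join_slices [simp]: "slice a (join_slices f) = f a"
  by (simp add: slice_def join_slices_def)

lemma slice_eqI: "(\<And>a. slice a G = slice a H) \<Longrightarrow> G = H"
  by (simp add: vec_eq_iff slice_def)

lemma slice_linear [simp]: "slice a (G + H) = slice a G + slice a H" "slice a (G - H) = slice a G - slice a H"
  "slice a (c *\<^sub>R G) = c *\<^sub>R slice a G" "slice a 0 = 0"
  by (simp_all add: slice_def vec_eq_iff)

lemma inner_eq_sum_slice: "G \<bullet> H = (\<Sum>a\<in>UNIV. slice a G \<bullet> slice a H)"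
  for G H :: "real ^ 'm ^ 'n ^ 'n"
proof -
  have "G \<bullet> H = (\<Sum>i\<in>UNIV. \<Sum>j\<in>UNIV. \<Sum>a\<in>UNIV. G $ i $ j $ a * H $ i $ j $ a)"
    by (simp add: inner_vec_def)
  also have "\<dots> = (\<Sum>i\<in>UNIV. \<Sum>a\<in>UNIV. \<Sum>j\<in>UNIV. G $ i $ j $ a * H $ i $ j $ a)"
    by (intro sum.cong refl sum.swap)
  also have "\<dots> = (\<Sum>a\<in>UNIV. \<Sum>i\<in>UNIV. \<Sum>j\<in>UNIV. G $ i $ j $ a * H $ i $ j $ a)"
    by (rule sum.swap)
  finally show ?thesis by (simp add: inner_vec_def)
qed

lemma norm_sq_eq_sum_slice: "(norm G)\<^sup>2 = (\<Sum>a\<in>UNIV. (norm (slice a G))\<^sup>2)"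
  for G :: "real ^ 'm ^ 'n ^ 'n"
  by (simp add: power2_norm_eq_inner inner_eq_sum_slice)

lemma norm_eq_slices:
  fixes G H :: "real ^ 'm ^ 'n ^ 'n"
  assumes "\<And>a. norm (slice a G) = norm (slice a H)"
  shows "norm G = norm H"
proof -
  have "(norm G)\<^sup>2 = (norm H)\<^sup>2" by (simp add: norm_sq_eq_sum_slice assms)
  then show ?thesis by simp
qed

lemma slice_gauge_transform:
  "slice a (gauge_transform P G \<Omega>) = transpose P ** slice a G - transpose P ** slice a \<Omega> ** P"
proof -
  have "slice a (gauge_transform P G \<Omega>) $ i $ j = (transpose P ** slice a G - transpose P ** slice a \<Omega> ** P) $ i $ j" for i j
  proof -
    have "(transpose P ** slice a \<Omega> ** P) $ i $ j
        = (\<Sum>l\<in>UNIV. \<Sum>k\<in>UNIV. transpose P $ i $ k * \<Omega> $ k $ l $ a * P $ l $ j)"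
      by (simp add: matrix_matrix_mult_def sum_distrib_right)
    also have "\<dots> = (\<Sum>k\<in>UNIV. \<Sum>l\<in>UNIV. transpose P $ i $ k * \<Omega> $ k $ l $ a * P $ l $ j)"
      by (rule sum.swap)
    finally show ?thesis
      by (simp add: gauge_transform_def) (simp add: matrix_matrix_mult_def ac_simps)
  qed
  then show ?thesis by (simp add: vec_eq_iff)
qed

text \<open>Writing \<open>R\<close> for the rotation, the new gauge transform is, slice by slice,
  the conjugate by \<open>R\<close> of the old one plus \<open>v\<close> times \<open>A\<close>: the
  factor \<open>P^T P\<close> cancels in the term that comes from differentiating \<open>R\<close>.
  Conjugation by an orthogonal matrix preserves the norm, so the effect of the rotation on the
  energy density is a mere translation by a tensor linear in \<open>v\<close>.\<close>

lemma gauge_transform_rot: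
  fixes A P :: "real ^ 'n ^ 'n" and G G' \<Omega> :: "real ^ 'm ^ 'n ^ 'n" and v :: "real ^ 'm"
  assumes A: "A ** A ** A = - A" "transpose A = - A"
    and G': "\<And>a. slice a G' = slice a G ** rot A \<theta> + (v $ a) *\<^sub>R (P ** A ** rot A \<theta>)"
    and P: "orthogonal_matrix P"
  shows "norm (gauge_transform (P ** rot A \<theta>) G' \<Omega>)
    = norm (gauge_transform P G \<Omega> + (\<chi> i j. A $ i $ j *\<^sub>R v))"
proof (rule norm_eq_slices)
  fix a
  define R where "R = rot A \<theta>"
  have R: "orthogonal_matrix R" "transpose R ** A ** R = A"
    unfolding R_def using orthogonal_rot[OF A] transpose_rot_conj[OF A] by auto
  have PP: "transpose P ** P = mat 1" using P by (simp add: orthogonal_matrix)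
  have sl: "slice a (\<chi> i j. A $ i $ j *\<^sub>R v) = (v $ a) *\<^sub>R A" by (simp add: slice_def vec_eq_iff)
  have "transpose R ** transpose P ** (P ** A ** R) = transpose R ** (transpose P ** P) ** A ** R"
    by (simp add: matrix_mul_assoc)
  then have PA: "transpose R ** transpose P ** (P ** A ** R) = transpose R ** A ** R" by (simp add: PP)
  have "slice a (gauge_transform (P ** R) G' \<Omega>)
      = transpose R ** transpose P ** (slice a G ** R) + (v $ a) *\<^sub>R (transpose R ** transpose P ** (P ** A ** R))
        - transpose R ** transpose P ** slice a \<Omega> ** (P ** R)"
    by (simp only: slice_gauge_transform G' R_def[symmetric] matrix_transpose_mul matrix_mult_bilinear_simps)
  also have "\<dots> = transpose R ** (slice a (gauge_transform P G \<Omega>) + (v $ a) *\<^sub>R A) ** R"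
  proof -
    define g w where "g = transpose P ** slice a G" and "w = transpose P ** slice a \<Omega> ** P"
    have "transpose R ** transpose P ** (slice a G ** R) = transpose R ** g ** R"
      "transpose R ** transpose P ** slice a \<Omega> ** (P ** R) = transpose R ** w ** R"
      by (simp_all add: g_def w_def matrix_mul_assoc)
    moreover have "transpose R ** (g - w + (v $ a) *\<^sub>R A) ** R
        = transpose R ** g ** R - transpose R ** w ** R + (v $ a) *\<^sub>R (transpose R ** A ** R)"
      by (simp only: matrix_mult_bilinear_simps)
    ultimately show ?thesis unfolding slice_gauge_transform g_def[symmetric] w_def[symmetric] PA by simp
  qed
  finally have "slice a (gauge_transform (P ** R) G' \<Omega>)
      = transpose R ** (slice a (gauge_transform P G \<Omega>) + (v $ a) *\<^sub>R A) ** R" .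
  then show "norm (slice a (gauge_transform (P ** rot A \<theta>) G' \<Omega>))
      = norm (slice a (gauge_transform P G \<Omega> + (\<chi> i j. A $ i $ j *\<^sub>R v)))"
    using R(1) by (simp add: R_def[symmetric] norm_orthogonal_mult_left norm_orthogonal_mult_right sl)
qed

lemma inner_matrix_unit:
  fixes X :: "real ^ 'm ^ 'n ^ 'n"
  shows "X \<bullet> (\<chi> k l. matrix_unit i j $ k $ l *\<^sub>R v) = X $ i $ j \<bullet> v"
proof -
  have "(\<Sum>l\<in>UNIV. matrix_unit i j $ k $ l * (X $ k $ l \<bullet> v)) = (if k = i then X $ k $ j \<bullet> v else 0)" for k
    by (auto simp: matrix_unit_def if_distrib[of "\<lambda>x. x * _"] cong: if_cong)
  then show ?thesis by (simp add: inner_vec_def[where 'b='n])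
qed

text \<open>When \<open>X\<close> is antisymmetric in \<open>i\<close> and \<open>j\<close> the
  right-hand side is twice the pairing of \<open>X $ i $ j\<close> with \<open>v\<close>.\<close>

lemma inner_plane_generator:
  fixes X :: "real ^ 'm ^ 'n ^ 'n"
  shows "X \<bullet> (\<chi> k l. plane_generator i j $ k $ l *\<^sub>R v) = (X $ i $ j - X $ j $ i) \<bullet> v"
proof -
  have "(\<chi> k l. plane_generator i j $ k $ l *\<^sub>R v)
      = (\<chi> k l. matrix_unit i j $ k $ l *\<^sub>R v) - (\<chi> k l. matrix_unit j i $ k $ l *\<^sub>R v)"
    unfolding plane_generator_def by (simp add: vec_eq_iff left_diff_distrib)
  then show ?thesis by (simp add: inner_diff_right inner_matrix_unit inner_diff_left)
qed

text \<open>Conjugation by \<open>P\<close> preserves skewness of \<Omega>, and the first assumption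
  is the skewness of \<open>P^T grad P\<close>.\<close>

lemma gauge_transform_antisym:
  fixes P :: "real ^ 'n ^ 'n" and G \<Omega> :: "real ^ 'm ^ 'n ^ 'n"
  assumes "\<And>a. transpose (transpose P ** slice a G) = - (transpose P ** slice a G)"
    and "\<And>i j. \<Omega> $ i $ j = - \<Omega> $ j $ i"
  shows "gauge_transform P G \<Omega> $ i $ j = - gauge_transform P G \<Omega> $ j $ i"
proof -
  have "transpose (slice a (gauge_transform P G \<Omega>)) = - slice a (gauge_transform P G \<Omega>)" for a
  proof -
    have om: "transpose (slice a \<Omega>) = - slice a \<Omega>"
    proof -
      have "transpose (slice a \<Omega>) $ i $ j = (- slice a \<Omega>) $ i $ j" for i j
        using arg_cong[OF assms(2)[of j i], of "\<lambda>w. w $ a"] by (simp add: transpose_def)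
      then show ?thesis by (simp add: vec_eq_iff)
    qed
    have "transpose (transpose P ** slice a \<Omega> ** P) = - (transpose P ** slice a \<Omega> ** P)"
      by (simp add: matrix_transpose_mul om matrix_mult_bilinear_simps matrix_mul_assoc)
    then show ?thesis unfolding slice_gauge_transform transpose_linear assms(1) by simp
  qed
  then have "transpose (slice a (gauge_transform P G \<Omega>)) $ j $ i = (- slice a (gauge_transform P G \<Omega>)) $ j $ i" for a
    by simp
  then have "gauge_transform P G \<Omega> $ i $ j $ a = - gauge_transform P G \<Omega> $ j $ i $ a" for a
    unfolding transpose_def by simp
  then show ?thesis by (simp add: vec_eq_iff)
qed

section \<open>Test functions\<close>

lemma test_function_has_derivative:
  fixes \<phi> :: "real ^ 'm \<Rightarrow> real"
  assumes "test_function D \<phi>"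
  shows "(\<phi> has_derivative (\<lambda>h. grad \<phi> x \<bullet> h)) (at x)"
proof -
  have "Ck_on (Suc 0) UNIV \<phi>" using assms by (simp add: test_function_def smooth_on_def)
  then have "(\<phi> has_derivative frechet_derivative \<phi> (at x)) (at x)"
    by (auto simp: frechet_derivative_works)
  moreover have "frechet_derivative \<phi> (at x) = (\<lambda>h. grad \<phi> x \<bullet> h)"
  proof
    fix h :: "real ^ 'm"
    have lin: "linear (frechet_derivative \<phi> (at x))"
      using calculation by (rule has_derivative_linear)
    have "h = (\<Sum>a\<in>UNIV. h $ a *\<^sub>R axis a 1)"
      using basis_expansion[of h] by (simp add: scalar_mult_eq_scaleR)
    then have "frechet_derivative \<phi> (at x) h = frechet_derivative \<phi> (at x) (\<Sum>a\<in>UNIV. h $ a *\<^sub>R axis a 1)"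
      by simp
    also have "\<dots> = grad \<phi> x \<bullet> h"
      by (simp add: linear_sum[OF lin] linear_cmul[OF lin] grad_def inner_vec_def ac_simps)
    finally show "frechet_derivative \<phi> (at x) h = grad \<phi> x \<bullet> h" .
  qed
  ultimately show ?thesis by simp
qed

lemma test_function_continuous:
  assumes "test_function D \<phi>"
  shows "continuous_on UNIV \<phi>"
proof -
  have "Ck_on 0 UNIV \<phi>" using assms unfolding test_function_def smooth_on_def by blast
  then show ?thesis by simp
qed

lemma test_function_continuous_grad:
  fixes \<phi> :: "real ^ 'm \<Rightarrow> real"
  assumes "test_function D \<phi>"
  shows "continuous_on UNIV (grad \<phi>)"
proof -
  have "Ck_on (Suc 0) UNIV \<phi>" using assms unfolding test_function_def smooth_on_def by blast
  then show ?thesis unfolding grad_def by (intro continuous_on_vec_lambda) simp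
qed

text \<open>The complement of the closed support is open and the function is constantly zero there,
  hence so is its gradient.\<close>

lemma test_function_support:
  fixes \<phi> :: "real ^ 'm \<Rightarrow> real"
  assumes "test_function D \<phi>" "x \<notin> closure {x. \<phi> x \<noteq> 0}"
  shows "\<phi> x = 0" "grad \<phi> x = 0"
proof -
  have zero: "\<phi> y = 0" if "y \<notin> closure {x. \<phi> x \<noteq> 0}" for y
    using that subsetD[OF closure_subset[of "{x. \<phi> x \<noteq> 0}"], of y] by auto
  show "\<phi> x = 0" using assms(2) by (rule zero)
  have "(\<phi> has_derivative (\<lambda>h. 0)) (at x)"
  proof (rule has_derivative_transform_within_open[of "\<lambda>_. 0"])
    show "open (- closure {x. \<phi> x \<noteq> 0})" by (intro open_Compl closed_closure)
    show "0 = \<phi> y" if "y \<in> - closure {x. \<phi> x \<noteq> 0}" for y using zero[of y] that by simp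
  qed (use assms in auto)
  then have "(\<lambda>h. grad \<phi> x \<bullet> h) = (\<lambda>h. 0)"
    using test_function_has_derivative[OF assms(1)] by (rule has_derivative_unique[rotated])
  then show "grad \<phi> x = 0" by (metis inner_eq_zero_iff)
qed

lemma test_function_bounded:
  fixes \<phi> :: "real ^ 'm \<Rightarrow> real"
  assumes "test_function D \<phi>"
  obtains B where "\<And>x. \<bar>\<phi> x\<bar> \<le> B" "\<And>x. norm (grad \<phi> x) \<le> B"
proof -
  let ?K = "closure {x. \<phi> x \<noteq> 0}"
  have K: "compact ?K" using assms by (simp add: test_function_def)
  have "\<exists>B. \<forall>x. \<bar>\<phi> x\<bar> \<le> B"
    by (rule bounded_range_compact_support[OF test_function_continuous[OF assms] K test_function_support(1)[OF assms]]) auto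
  then obtain B1 where B1: "\<And>x. \<bar>\<phi> x\<bar> \<le> B1" by auto
  have "\<exists>B. \<forall>x. \<bar>norm (grad \<phi> x)\<bar> \<le> B"
  proof (rule bounded_range_compact_support[OF continuous_on_norm[OF test_function_continuous_grad[OF assms]] K])
    show "norm (grad \<phi> x) = 0" if "x \<notin> ?K" for x
      using test_function_support(2)[OF assms that] by simp
  qed auto
  then obtain B2 where B2: "\<And>x. norm (grad \<phi> x) \<le> B2" by auto
  show ?thesis
    by (rule that[of "max B1 B2"]) (use B1 B2 in \<open>auto simp: le_max_iff_disj\<close>)
qed

section \<open>Admissible gauges\<close>

text \<open>The gradient \<open>G\<close> is carried along as data, with one slice for each partial
  derivative. Being the identity off a compact subset of \<open>D\<close> is preserved under
  multiplication by rotations whose angle is a test function, which makes the class closed under the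
  variations considered.\<close>

definition admissible :: "(real ^ 'm) set \<Rightarrow> (real ^ 'm \<Rightarrow> real ^ 'n ^ 'n) \<Rightarrow> (real ^ 'm \<Rightarrow> real ^ 'm ^ 'n ^ 'n) \<Rightarrow> bool" where
  "admissible D Q G \<longleftrightarrow>
     (\<forall>x. (Q has_derivative (\<lambda>h. \<Sum>a\<in>UNIV. h $ a *\<^sub>R slice a (G x))) (at x)) \<and>
     continuous_on UNIV G \<and>
     (\<exists>K. compact K \<and> K \<subseteq> D \<and> (\<forall>x. x \<notin> K \<longrightarrow> Q x = mat 1 \<and> G x = 0)) \<and>
     (\<forall>x. orthogonal_matrix (Q x) \<and> det (Q x) > 0)"

lemma admissible_id: "admissible D (\<lambda>_. mat 1) (\<lambda>_. 0)"
  unfolding admissible_def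
  by (intro conjI exI[of _ "{}"]) (auto simp: orthogonal_matrix_id)

lemma admissible_continuous:
  assumes "admissible D Q G"
  shows "continuous_on UNIV Q" "continuous_on UNIV G"
proof -
  have "(Q has_derivative (\<lambda>h. \<Sum>a\<in>UNIV. h $ a *\<^sub>R slice a (G x))) (at x)" for x
    using assms by (simp add: admissible_def)
  then show "continuous_on UNIV Q"
    using has_derivative_continuous continuous_at_imp_continuous_on by blast
  show "continuous_on UNIV G" using assms by (simp add: admissible_def)
qed

lemma continuous_on_slice: "continuous_on S G \<Longrightarrow> continuous_on S (\<lambda>x. slice a (G x))"
  unfolding slice_def by (intro continuous_on_vec_lambda continuous_on_component)

lemma continuous_on_join_slices:
  "(\<And>a. continuous_on S (f a)) \<Longrightarrow> continuous_on S (\<lambda>x. join_slices (\<lambda>a. f a x))"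
  unfolding join_slices_def by (intro continuous_on_vec_lambda continuous_on_component)

lemma admissible_rot:
  fixes Q :: "real ^ 'm \<Rightarrow> real ^ 'n ^ 'n"
  assumes adm: "admissible D Q G" and \<phi>: "test_function D \<phi>"
    and A: "A ** A ** A = - A" "transpose A = - A"
  obtains G' where "admissible D (\<lambda>x. Q x ** rot A (t * \<phi> x)) G'"
    "\<And>x \<Omega>. norm (gauge_transform (Q x ** rot A (t * \<phi> x)) (G' x) \<Omega>)
      = norm (gauge_transform (Q x) (G x) \<Omega> + t *\<^sub>R (\<chi> i j. A $ i $ j *\<^sub>R grad \<phi> x))"
proof -
  define R where "R x = rot A (t * \<phi> x)" for x
  \<comment> \<open>The two summands of each slice are those of the product rule for
    \<open>Q R\<close>.\<close>
  define G' where "G' x = join_slices (\<lambda>a. slice a (G x) ** R x + (t * grad \<phi> x $ a) *\<^sub>R (Q x ** A ** R x))" for x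
  have cQ: "continuous_on UNIV Q" and cG: "continuous_on UNIV G" using admissible_continuous[OF adm] .
  have cR: "continuous_on UNIV R"
    unfolding R_def rot_def using test_function_continuous[OF \<phi>] by (intro continuous_intros)
  have dR: "(R has_derivative (\<lambda>h. (t * (grad \<phi> x \<bullet> h)) *\<^sub>R (A ** R x))) (at x)" for x
  proof -
    have "((\<lambda>x. t * \<phi> x) has_derivative (\<lambda>h. t * (grad \<phi> x \<bullet> h))) (at x)"
      by (intro derivative_intros test_function_has_derivative[OF \<phi>])
    from has_derivative_compose[OF this has_derivative_rot[OF A]] show ?thesis by (simp add: R_def[abs_def])
  qed
  have dQR: "((\<lambda>x. Q x ** R x) has_derivative (\<lambda>h. \<Sum>a\<in>UNIV. h $ a *\<^sub>R slice a (G' x))) (at x)" for x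
  proof -
    have dQ: "(Q has_derivative (\<lambda>h. \<Sum>a\<in>UNIV. h $ a *\<^sub>R slice a (G x))) (at x)"
      using adm by (simp add: admissible_def)
    have "Q x ** ((t * (grad \<phi> x \<bullet> h)) *\<^sub>R (A ** R x)) + (\<Sum>a\<in>UNIV. h $ a *\<^sub>R slice a (G x)) ** R x
        = (\<Sum>a\<in>UNIV. h $ a *\<^sub>R slice a (G' x))" for h
    proof -
      have "(\<Sum>a\<in>UNIV. h $ a *\<^sub>R slice a (G x)) ** R x = (\<Sum>a\<in>UNIV. h $ a *\<^sub>R (slice a (G x) ** R x))"
        by (simp add: bounded_bilinear.sum_left[OF bounded_bilinear_matrix_mult] matrix_mult_bilinear_simps)
      moreover have "Q x ** ((t * (grad \<phi> x \<bullet> h)) *\<^sub>R (A ** R x))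
          = (\<Sum>a\<in>UNIV. h $ a *\<^sub>R ((t * grad \<phi> x $ a) *\<^sub>R (Q x ** A ** R x)))"
        by (simp add: matrix_mult_bilinear_simps matrix_mul_assoc inner_vec_def sum_distrib_left ac_simps
            flip: scaleR_sum_left)
      ultimately show ?thesis by (simp add: G'_def scaleR_add_right sum.distrib add.commute)
    qed
    then show ?thesis
      using bounded_bilinear.FDERIV[OF bounded_bilinear_matrix_mult dQ dR] by simp
  qed
  have cG': "continuous_on UNIV G'"
    unfolding G'_def
    by (intro continuous_on_join_slices continuous_on_add continuous_on_scaleR continuous_on_mult_left
        continuous_on_component test_function_continuous_grad[OF \<phi>] continuous_on_const
        bounded_bilinear.continuous_on[OF bounded_bilinear_matrix_mult] cQ cR cG continuous_on_slice)
  obtain K where K: "compact K" "K \<subseteq> D" "\<And>x. x \<notin> K \<Longrightarrow> Q x = mat 1 \<and> G x = 0"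
    using adm unfolding admissible_def by blast
  let ?S = "closure {x. \<phi> x \<noteq> 0}"
  have "admissible D (\<lambda>x. Q x ** R x) G'"
    unfolding admissible_def
  proof (intro conjI allI dQR cG' exI[of _ "K \<union> ?S"] impI)
    show "compact (K \<union> ?S)" "K \<union> ?S \<subseteq> D" using K \<phi> by (auto simp: test_function_def)
    fix x
    show "orthogonal_matrix (Q x ** R x)"
      using adm orthogonal_rot[OF A] by (auto simp: R_def admissible_def intro: orthogonal_matrix_mul)
    show "det (Q x ** R x) > 0"
      using adm det_rot_pos[OF A] by (simp add: det_mul R_def admissible_def)
    assume "x \<notin> K \<union> ?S"
    then have "x \<notin> K" and "x \<notin> ?S" by (simp_all only: Un_iff simp_thms de_Morgan_disj)
    then have x: "Q x = mat 1" "G x = 0" "\<phi> x = 0" "grad \<phi> x = 0"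
      using K(3)[OF \<open>x \<notin> K\<close>] test_function_support[OF \<phi> \<open>x \<notin> ?S\<close>] by (simp_all only:)
    show "Q x ** R x = mat 1" by (simp add: x R_def)
    show "G' x = 0" by (rule slice_eqI) (simp add: G'_def x matrix_mult_bilinear_simps)
  qed
  moreover have "norm (gauge_transform (Q x ** R x) (G' x) \<Omega>)
      = norm (gauge_transform (Q x) (G x) \<Omega> + t *\<^sub>R (\<chi> i j. A $ i $ j *\<^sub>R grad \<phi> x))" for x \<Omega>
  proof -
    have "(\<chi> i j. A $ i $ j *\<^sub>R (t *\<^sub>R grad \<phi> x)) = t *\<^sub>R (\<chi> i j. A $ i $ j *\<^sub>R grad \<phi> x)"
      by (simp add: vec_eq_iff)
    moreover have "norm (gauge_transform (Q x ** R x) (G' x) \<Omega>)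
      = norm (gauge_transform (Q x) (G x) \<Omega> + (\<chi> i j. A $ i $ j *\<^sub>R (t *\<^sub>R grad \<phi> x)))"
      unfolding R_def by (rule gauge_transform_rot[OF A]) (use adm in \<open>auto simp: G'_def R_def admissible_def\<close>)
    ultimately show ?thesis by simp
  qed
  ultimately show ?thesis unfolding R_def by (rule that)
qed

text \<open>Differentiating the constant \<open>Q^T Q\<close> along a coordinate direction shows
  that \<open>Q^T dQ\<close> plus its transpose vanishes.\<close>

lemma admissible_antisym:
  assumes adm: "admissible D Q G"
  shows "transpose (transpose (Q x) ** slice a (G x)) = - (transpose (Q x) ** slice a (G x))"
proof -
  let ?d = "\<lambda>h. \<Sum>a\<in>UNIV. h $ a *\<^sub>R slice a (G x)"
  have dQ: "(Q has_derivative ?d) (at x)" using adm by (simp add: admissible_def)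
  have "bounded_linear (transpose :: real ^ 'b ^ 'b \<Rightarrow> _)"
    by (simp add: linear_conv_bounded_linear[symmetric] linear_iff transpose_linear)
  from bounded_linear.has_derivative[OF this dQ]
  have "((\<lambda>x. transpose (Q x) ** Q x) has_derivative (\<lambda>h. transpose (Q x) ** ?d h + transpose (?d h) ** Q x)) (at x)"
    by (rule bounded_bilinear.FDERIV[OF bounded_bilinear_matrix_mult _ dQ])
  moreover have "(\<lambda>x. transpose (Q x) ** Q x) = (\<lambda>x. mat 1)"
    using adm by (auto simp: admissible_def orthogonal_matrix)
  ultimately have "((\<lambda>x. mat 1) has_derivative (\<lambda>h. transpose (Q x) ** ?d h + transpose (?d h) ** Q x)) (at x)"
    by (simp only:)
  from has_derivative_unique[OF this has_derivative_const]
  have "transpose (Q x) ** ?d (axis a 1) + transpose (?d (axis a 1)) ** Q x = 0" by (rule fun_cong)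
  moreover have "?d (axis a 1) = slice a (G x)"
    by (simp add: axis_def if_distrib[of "\<lambda>x. x *\<^sub>R _"] cong: if_cong)
  ultimately show ?thesis by (simp add: matrix_transpose_mul eq_neg_iff_add_eq_0 add.commute)
qed

section \<open>Measurability and integrability of tensor fields\<close>

lemma borel_measurable_vecI:
  fixes f :: "'a \<Rightarrow> 'b::euclidean_space ^ 'n"
  assumes "\<And>i. (\<lambda>x. f x $ i) \<in> borel_measurable M"
  shows "f \<in> borel_measurable M"
  unfolding borel_measurable_euclidean_space[of f]
proof
  fix b :: "'b ^ 'n" assume "b \<in> Basis"
  then obtain i u where b: "b = axis i u" by (auto simp: Basis_vec_def)
  show "(\<lambda>x. f x \<bullet> b) \<in> borel_measurable M"
    unfolding b inner_axis using assms[of i] by (intro borel_measurable_inner) auto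
qed

lemma borel_measurable_vec_nth:
  fixes f :: "'a \<Rightarrow> 'b::euclidean_space ^ 'n"
  assumes "f \<in> borel_measurable M"
  shows "(\<lambda>x. f x $ i) \<in> borel_measurable M"
proof -
  have "continuous_on UNIV (\<lambda>v :: 'b ^ 'n. v $ i)" by (intro continuous_intros)
  then have "(\<lambda>v :: 'b ^ 'n. v $ i) \<in> borel_measurable borel" by (rule borel_measurable_continuous_onI)
  from measurable_compose[OF assms this] show ?thesis .
qed

lemma norm_sq_vec: "(norm (v :: 'b::euclidean_space ^ 'n))\<^sup>2 = (\<Sum>i\<in>UNIV. (norm (v $ i))\<^sup>2)"
  by (simp add: power2_norm_eq_inner inner_vec_def)

lemma sq_integrable_vecI:
  fixes f :: "'a \<Rightarrow> 'b::euclidean_space ^ 'n"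
  assumes "\<And>i. sq_integrable M (\<lambda>x. f x $ i)"
  shows "sq_integrable M f"
  using assms unfolding sq_integrable_def norm_sq_vec
  by (auto intro!: borel_measurable_vecI Bochner_Integration.integrable_sum)

lemma sq_integrable_vec_nth:
  fixes f :: "'a \<Rightarrow> 'b::euclidean_space ^ 'n"
  assumes "sq_integrable M f"
  shows "sq_integrable M (\<lambda>x. f x $ i)"
proof (rule sq_integrable_dominated)
  show "(\<lambda>x. f x $ i) \<in> borel_measurable M"
    using assms by (intro borel_measurable_vec_nth sq_integrable_measurable)
  show "integrable M (\<lambda>x. (norm (f x))\<^sup>2)" using assms by (simp add: sq_integrable_def)
  show "AE x in M. (norm (f x $ i))\<^sup>2 \<le> (norm (f x))\<^sup>2"
    by (intro AE_I2 power_mono Finite_Cartesian_Product.norm_nth_le) auto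
qed

definition left_mult :: "real ^ 'n ^ 'n \<Rightarrow> real ^ 'm ^ 'n ^ 'n \<Rightarrow> real ^ 'm ^ 'n ^ 'n" where
  "left_mult P X = join_slices (\<lambda>a. P ** slice a X)"

definition right_mult :: "real ^ 'm ^ 'n ^ 'n \<Rightarrow> real ^ 'n ^ 'n \<Rightarrow> real ^ 'm ^ 'n ^ 'n" where
  "right_mult X P = join_slices (\<lambda>a. slice a X ** P)"

lemma norm_left_mult: "orthogonal_matrix P \<Longrightarrow> norm (left_mult P X) = norm X"
  by (rule norm_eq_slices) (simp add: left_mult_def norm_orthogonal_mult_left)

lemma norm_right_mult: "orthogonal_matrix P \<Longrightarrow> norm (right_mult X P) = norm X"
  by (rule norm_eq_slices) (simp add: right_mult_def norm_orthogonal_mult_right)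

lemma inner_left_mult: "left_mult P X \<bullet> W = X \<bullet> left_mult (transpose P) W"
  by (simp add: inner_eq_sum_slice left_mult_def inner_matrix_mult_left)

lemma gauge_transform_eq:
  "gauge_transform P G \<Omega> = left_mult (transpose P) G - right_mult (left_mult (transpose P) \<Omega>) P"
  by (rule slice_eqI) (simp add: slice_gauge_transform left_mult_def right_mult_def)

text \<open>For orthogonal \<open>P\<close> the gauge transform is an affine bijection in
  \<open>G\<close>. The second identity recovers the gradient of an admissible map from its gauge
  transform; the first allows the gradient of the limit to be defined from the weak cluster
  point.\<close>

lemma gauge_transform_inverse:
  assumes "orthogonal_matrix P"
  shows "gauge_transform P (left_mult P X + right_mult \<Omega> P) \<Omega> = X"
    and "left_mult P (gauge_transform P G \<Omega>) + right_mult \<Omega> P = G"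
proof -
  have P: "transpose P ** P = mat 1" "P ** transpose P = mat 1"
    using assms by (auto simp: orthogonal_matrix_def)
  show "gauge_transform P (left_mult P X + right_mult \<Omega> P) \<Omega> = X"
    by (rule slice_eqI)
       (simp add: slice_gauge_transform left_mult_def right_mult_def matrix_mult_bilinear_simps matrix_mul_assoc P)
  show "left_mult P (gauge_transform P G \<Omega>) + right_mult \<Omega> P = G"
    by (rule slice_eqI)
       (simp add: slice_gauge_transform left_mult_def right_mult_def matrix_mult_bilinear_simps matrix_mul_assoc P)
qed

lemma left_mult_nth: "left_mult P X $ i $ j = (\<Sum>k\<in>UNIV. P $ i $ k *\<^sub>R X $ k $ j)"
  by (simp add: vec_eq_iff left_mult_def join_slices_def matrix_matrix_mult_def)

lemma right_mult_nth: "right_mult X P $ i $ j = (\<Sum>k\<in>UNIV. P $ k $ j *\<^sub>R X $ i $ k)"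
  by (simp add: vec_eq_iff right_mult_def join_slices_def matrix_matrix_mult_def mult.commute)

lemma borel_measurable_left_mult:
  assumes "P \<in> borel_measurable M" "X \<in> borel_measurable M"
  shows "(\<lambda>x. left_mult (P x) (X x)) \<in> borel_measurable M"
proof (intro borel_measurable_vecI)
  fix i j a
  have [measurable]: "(\<lambda>x. P x $ i $ j) \<in> borel_measurable M" "(\<lambda>x. X x $ i $ j) \<in> borel_measurable M" for i j
    using assms by (auto intro!: borel_measurable_vec_nth)
  have "(\<lambda>x. left_mult (P x) (X x) $ i $ j) \<in> borel_measurable M"
    unfolding left_mult_nth by measurable
  then show "(\<lambda>x. left_mult (P x) (X x) $ i $ j $ a) \<in> borel_measurable M" by (rule borel_measurable_vec_nth)
qed

lemma borel_measurable_right_mult: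
  assumes "P \<in> borel_measurable M" "X \<in> borel_measurable M"
  shows "(\<lambda>x. right_mult (X x) (P x)) \<in> borel_measurable M"
proof (intro borel_measurable_vecI)
  fix i j a
  have [measurable]: "(\<lambda>x. P x $ i $ j) \<in> borel_measurable M" "(\<lambda>x. X x $ i $ j) \<in> borel_measurable M" for i j
    using assms by (auto intro!: borel_measurable_vec_nth)
  have "(\<lambda>x. right_mult (X x) (P x) $ i $ j) \<in> borel_measurable M"
    unfolding right_mult_nth by measurable
  then show "(\<lambda>x. right_mult (X x) (P x) $ i $ j $ a) \<in> borel_measurable M" by (rule borel_measurable_vec_nth)
qed

lemma borel_measurable_transpose:
  fixes P :: "'a \<Rightarrow> real ^ 'n ^ 'm"
  assumes "P \<in> borel_measurable M"
  shows "(\<lambda>x. transpose (P x)) \<in> borel_measurable M"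
proof (intro borel_measurable_vecI)
  show "(\<lambda>x. transpose (P x) $ i $ j) \<in> borel_measurable M" for i j
    unfolding transpose_def vec_lambda_beta by (intro borel_measurable_vec_nth assms)
qed

lemma sq_integrable_left_mult:
  assumes "P \<in> borel_measurable M" "sq_integrable M X" "AE x in M. orthogonal_matrix (P x)"
  shows "sq_integrable M (\<lambda>x. left_mult (P x) (X x))"
proof (rule sq_integrable_dominated)
  show "(\<lambda>x. left_mult (P x) (X x)) \<in> borel_measurable M"
    by (rule borel_measurable_left_mult[OF assms(1) sq_integrable_measurable[OF assms(2)]])
  show "integrable M (\<lambda>x. (norm (X x))\<^sup>2)" using assms(2) by (simp add: sq_integrable_def)
  show "AE x in M. (norm (left_mult (P x) (X x)))\<^sup>2 \<le> (norm (X x))\<^sup>2"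
    using assms(3) by eventually_elim (simp add: norm_left_mult)
qed

lemma sq_integrable_right_mult:
  assumes "P \<in> borel_measurable M" "sq_integrable M X" "AE x in M. orthogonal_matrix (P x)"
  shows "sq_integrable M (\<lambda>x. right_mult (X x) (P x))"
proof (rule sq_integrable_dominated)
  show "(\<lambda>x. right_mult (X x) (P x)) \<in> borel_measurable M"
    by (rule borel_measurable_right_mult[OF assms(1) sq_integrable_measurable[OF assms(2)]])
  show "integrable M (\<lambda>x. (norm (X x))\<^sup>2)" using assms(2) by (simp add: sq_integrable_def)
  show "AE x in M. (norm (right_mult (X x) (P x)))\<^sup>2 \<le> (norm (X x))\<^sup>2"
    using assms(3) by eventually_elim (simp add: norm_right_mult)
qed

lemma sq_integrable_gauge_transform:
  assumes "P \<in> borel_measurable M" "sq_integrable M G" "sq_integrable M \<Omega>" "AE x in M. orthogonal_matrix (P x)"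
  shows "sq_integrable M (\<lambda>x. gauge_transform (P x) (G x) (\<Omega> x))"
proof -
  have "AE x in M. orthogonal_matrix (transpose (P x))" using assms(4) by simp
  then show ?thesis
    unfolding gauge_transform_eq using assms
    by (intro sq_integrable_diff sq_integrable_left_mult sq_integrable_right_mult borel_measurable_transpose)
qed

section \<open>A minimizing sequence\<close>

text \<open>An approximate form of the vanishing first variation. Taking \<open>t\<close> of size
  \<open>sqrt e\<close> with either sign makes the error and the quadratic term of the same
  order.\<close>

lemma near_minimizer_bound:
  assumes e: "e > 0" and c: "c \<ge> 0" and q: "\<And>t::real. 2 * t * b + t\<^sup>2 * c \<ge> - e"
  shows "\<bar>b\<bar> \<le> sqrt e * (1 + c) / 2"
proof -
  define s where "s = sqrt e"
  have s: "s > 0" "s\<^sup>2 = e" using e by (simp_all add: s_def)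
  have "- 2 * s * b \<le> s * (s * (1 + c))" "2 * s * b \<le> s * (s * (1 + c))"
    using q[of s] q[of "- s"] s by (simp_all add: power2_eq_square algebra_simps)
  then have "s * (- 2 * b) \<le> s * (s * (1 + c))" "s * (2 * b) \<le> s * (s * (1 + c))" by (simp_all add: ac_simps)
  then have "- 2 * b \<le> s * (1 + c)" "2 * b \<le> s * (1 + c)" using s(1) by (simp_all only: mult_le_cancel_left_pos)
  then show ?thesis unfolding s_def[symmetric] by (simp add: abs_le_iff)
qed

locale gauge_problem =
  fixes D :: "(real ^ 'm) set" and \<Omega> :: "real ^ 'm \<Rightarrow> real ^ 'm ^ 'n ^ 'n"
  assumes D: "open D" "bounded D" and \<Omega>: "sq_integrable (lebesgue_on D) \<Omega>"
    and anti: "AE x in lebesgue_on D. \<forall>i j. \<Omega> x $ i $ j = - \<Omega> x $ j $ i"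
begin

abbreviation "L \<equiv> lebesgue_on D"

lemma finite_L: "finite_measure L"
  by (rule finite_measure_lebesgue_on_bounded[OF D])

lemma continuous_borel_measurable_L: "continuous_on UNIV f \<Longrightarrow> f \<in> borel_measurable L"
  by (intro borel_imp_lebesgue_on_measurable borel_measurable_continuous_onI)

lemma admissible_sq_integrable:
  assumes adm: "admissible D Q G"
  shows "sq_integrable L G" "sq_integrable L (\<lambda>x. gauge_transform (Q x) (G x) (\<Omega> x))"
proof -
  note c = admissible_continuous[OF adm]
  obtain K where K: "compact K" "\<And>x. x \<notin> K \<Longrightarrow> G x = 0"
    using adm unfolding admissible_def by blast
  have "\<exists>B. \<forall>x. \<bar>norm (G x)\<bar> \<le> B"
    by (rule bounded_range_compact_support[OF continuous_on_norm[OF c(2)] K(1)]) (auto simp: K(2))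
  then obtain B where "\<And>x. norm (G x) \<le> B" by auto
  then show G: "sq_integrable L G"
    by (intro sq_integrable_bounded[OF finite_L continuous_borel_measurable_L[OF c(2)], where B=B]) simp
  have "AE x in L. orthogonal_matrix (Q x)" using adm by (simp add: admissible_def)
  then show "sq_integrable L (\<lambda>x. gauge_transform (Q x) (G x) (\<Omega> x))"
    by (rule sq_integrable_gauge_transform[OF continuous_borel_measurable_L[OF c(1)] G \<Omega>])
qed

lemma sq_integrable_test_tensor:
  assumes "test_function D \<phi>"
  shows "sq_integrable L (\<lambda>x. \<chi> k l. (A :: real ^ 'n ^ 'n) $ k $ l *\<^sub>R grad \<phi> x)"
proof -
  have "\<exists>B. \<forall>x. norm (grad \<phi> x) \<le> B" by (rule test_function_bounded[OF assms]) auto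
  then obtain B where B: "\<And>x. norm (grad \<phi> x) \<le> B" by auto
  have "sq_integrable L (grad \<phi>)"
    by (rule sq_integrable_bounded[OF finite_L continuous_borel_measurable_L[OF test_function_continuous_grad[OF assms]], where B=B])
       (simp add: B)
  then have *: "sq_integrable L (\<lambda>x. c *\<^sub>R grad \<phi> x)" for c by (rule sq_integrable_scaleR)
  show ?thesis by (rule sq_integrable_vecI, rule sq_integrable_vecI) (simp add: *)
qed

text \<open>Since \<open>Q k\<close> is within \<open>1 / Suc k\<close> of the infimum,
  \<open>near_minimizer_bound\<close> makes the first variation in each coordinate plane of order
  \<open>1 / sqrt (Suc k)\<close>, with a constant depending only on the test function and the
  plane.\<close>

lemma minimizing_sequence:
  obtains Q :: "nat \<Rightarrow> real ^ 'm \<Rightarrow> real ^ 'n ^ 'n" and G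
  where "\<And>k. admissible D (Q k) (G k)"
    "\<And>k. (\<integral>x. (norm (gauge_transform (Q k x) (G k x) (\<Omega> x)))\<^sup>2 \<partial>L) \<le> (\<integral>x. (norm (\<Omega> x))\<^sup>2 \<partial>L)"
    "\<And>\<phi> i j. test_function D \<phi> \<Longrightarrow> (\<lambda>k. \<integral>x. gauge_transform (Q k x) (G k x) (\<Omega> x) $ i $ j \<bullet> grad \<phi> x \<partial>L) \<longlonglongrightarrow> 0"
proof -
  define E where "E p = (\<integral>x. (norm (gauge_transform (fst p x) (snd p x) (\<Omega> x)))\<^sup>2 \<partial>L)"
    for p :: "(real ^ 'm \<Rightarrow> real ^ 'n ^ 'n) \<times> (real ^ 'm \<Rightarrow> real ^ 'm ^ 'n ^ 'n)"
  define S :: "((real ^ 'm \<Rightarrow> real ^ 'n ^ 'n) \<times> (real ^ 'm \<Rightarrow> real ^ 'm ^ 'n ^ 'n)) set"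
    where "S = {p. admissible D (fst p) (snd p)}"
  define I where "I = Inf (E ` S)"
  define p0 :: "(real ^ 'm \<Rightarrow> real ^ 'n ^ 'n) \<times> (real ^ 'm \<Rightarrow> real ^ 'm ^ 'n ^ 'n)" where "p0 = (\<lambda>_. mat 1, \<lambda>_. 0)"
  have p0: "p0 \<in> S" by (simp add: S_def p0_def admissible_id)
  have Ep0: "E p0 = (\<integral>x. (norm (\<Omega> x))\<^sup>2 \<partial>L)"
  proof -
    have "norm (gauge_transform (mat 1) 0 W) = norm W" for W :: "real ^ 'm ^ 'n ^ 'n"
      by (rule norm_eq_slices) (simp add: slice_gauge_transform matrix_mult_bilinear_simps)
    then show ?thesis by (simp add: E_def p0_def)
  qed
  have bdd: "bdd_below (E ` S)" by (rule bdd_belowI[of _ 0]) (auto simp: E_def)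
  have Ile: "I \<le> E p" if "p \<in> S" for p unfolding I_def using bdd that by (intro cInf_lower) auto
  \<comment> \<open>Both bounds are achieved at once: either the constant map is itself close enough
    to the infimum, or any map that is close enough has smaller energy.\<close>
  have "\<exists>p\<in>S. E p \<le> E p0 \<and> E p < I + 1 / real (Suc k)" for k
  proof (cases "E p0 < I + 1 / real (Suc k)")
    case True
    then show ?thesis using p0 by blast
  next
    case False
    have "\<exists>y\<in>E ` S. y < I + 1 / real (Suc k)"
      by (rule cInf_lessD) (use p0 in \<open>auto simp: I_def\<close>)
    then obtain q where "q \<in> S" "E q < I + 1 / real (Suc k)" by blast
    moreover from this have "E q \<le> E p0" using False by linarith
    ultimately show ?thesis by blast
  qed
  then obtain p where p: "\<And>k. p k \<in> S" "\<And>k. E (p k) \<le> E p0" "\<And>k. E (p k) < I + 1 / real (Suc k)" by metis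
  define Q G where "Q k = fst (p k)" and "G k = snd (p k)" for k
  have adm: "admissible D (Q k) (G k)" for k using p(1)[of k] by (simp add: S_def Q_def G_def)
  define X where "X k x = gauge_transform (Q k x) (G k x) (\<Omega> x)" for k x
  have Xsq: "sq_integrable L (X k)" for k unfolding X_def by (rule admissible_sq_integrable(2)[OF adm])
  have EX: "E (p k) = (\<integral>x. (norm (X k x))\<^sup>2 \<partial>L)" for k by (simp add: E_def X_def Q_def G_def)
  have Xanti: "AE x in L. X k x $ i $ j = - X k x $ j $ i" for k i j
    using anti
  proof eventually_elim
    case (elim x)
    show ?case
      unfolding X_def by (rule gauge_transform_antisym[OF admissible_antisym[OF adm]]) (use elim in blast)
  qed
  have lim: "(\<lambda>k. \<integral>x. X k x $ i $ j \<bullet> grad \<phi> x \<partial>L) \<longlonglongrightarrow> 0" if \<phi>: "test_function D \<phi>" for \<phi> i j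
  proof (cases "i = j")
    case True
    have "(\<integral>x. X k x $ i $ j \<bullet> grad \<phi> x \<partial>L) = 0" for k
    proof -
      have "AE x in L. X k x $ i $ j \<bullet> grad \<phi> x = 0"
        using Xanti[of k i j]
      proof eventually_elim
        case (elim x)
        then have "X k x $ i $ j = 0" using True by (simp add: vec_eq_iff) 
        then show ?case by simp
      qed
      then show ?thesis by (rule integral_eq_zero_AE)
    qed
    then show ?thesis by simp
  next
    case False
    define A where "A = plane_generator i j"
    have A: "A ** A ** A = - A" "transpose A = - A"
      unfolding A_def by (rule plane_generator_cube[OF False] plane_generator_skew)+
    define H where "H x = (\<chi> k l. A $ k $ l *\<^sub>R grad \<phi> x)" for x
    have Hsq: "sq_integrable L H" unfolding H_def by (rule sq_integrable_test_tensor[OF \<phi>])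
    define c where "c = (\<integral>x. (norm (H x))\<^sup>2 \<partial>L)"
    define b where "b k = (\<integral>x. X k x \<bullet> H x \<partial>L)" for k
    have q: "2 * t * b k + t\<^sup>2 * c \<ge> - (1 / real (Suc k))" for t k
    proof -
      have "\<exists>G'. admissible D (\<lambda>x. Q k x ** rot A (t * \<phi> x)) G' \<and>
        (\<forall>x W. norm (gauge_transform (Q k x ** rot A (t * \<phi> x)) (G' x) W)
          = norm (gauge_transform (Q k x) (G k x) W + t *\<^sub>R (\<chi> i j. A $ i $ j *\<^sub>R grad \<phi> x)))"
        by (rule admissible_rot[OF adm[of k] \<phi> A, of t]) blast
      then obtain G' where G': "admissible D (\<lambda>x. Q k x ** rot A (t * \<phi> x)) G'"
        "\<And>x W. norm (gauge_transform (Q k x ** rot A (t * \<phi> x)) (G' x) W)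
          = norm (gauge_transform (Q k x) (G k x) W + t *\<^sub>R (\<chi> i j. A $ i $ j *\<^sub>R grad \<phi> x))"
        by blast
      have "I \<le> E (\<lambda>x. Q k x ** rot A (t * \<phi> x), G')" by (rule Ile) (simp add: S_def G'(1))
      also have "\<dots> = (\<integral>x. (norm (X k x + t *\<^sub>R H x))\<^sup>2 \<partial>L)"
        by (simp add: E_def G'(2) X_def H_def)
      also have "\<dots> = E (p k) + 2 * t * b k + t\<^sup>2 * c"
        unfolding EX b_def c_def by (rule integral_norm_sq_add_scaleR[OF Xsq Hsq])
      finally show ?thesis using p(3)[of k] by linarith
    qed
    have c: "c \<ge> 0" by (simp add: c_def)
    have bk: "\<bar>b k\<bar> \<le> sqrt (1 / real (Suc k)) * (1 + c) / 2" for k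
      by (rule near_minimizer_bound[OF _ c q]) simp
    have "(\<lambda>k. sqrt (1 / real (Suc k)) * (1 + c) / 2) \<longlonglongrightarrow> sqrt 0 * (1 + c) / 2"
      by (intro tendsto_intros LIMSEQ_inverse_real_of_nat[unfolded inverse_eq_divide]) auto
    then have "(\<lambda>k. sqrt (1 / real (Suc k)) * (1 + c) / 2) \<longlonglongrightarrow> 0" by simp
    then have "b \<longlonglongrightarrow> 0"
      by (rule Lim_null_comparison[rotated]) (intro always_eventually allI, simp only: real_norm_def, rule bk)
    \<comment> \<open>The generator pairs with \<open>X_ij - X_ji\<close>, which antisymmetry turns
      into twice \<open>X_ij\<close>.\<close>
    moreover have "b k = 2 * (\<integral>x. X k x $ i $ j \<bullet> grad \<phi> x \<partial>L)" for k
    proof -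
      have "b k = (\<integral>x. 2 * (X k x $ i $ j \<bullet> grad \<phi> x) \<partial>L)"
        unfolding b_def
      proof (rule integral_cong_AE)
        show "(\<lambda>x. X k x \<bullet> H x) \<in> borel_measurable L"
          using sq_integrable_inner[OF Xsq Hsq] by (rule borel_measurable_integrable)
        have "sq_integrable L (\<lambda>x. X k x $ i $ j)" by (intro sq_integrable_vec_nth Xsq)
        then show "(\<lambda>x. 2 * (X k x $ i $ j \<bullet> grad \<phi> x)) \<in> borel_measurable L"
          using continuous_borel_measurable_L[OF test_function_continuous_grad[OF \<phi>]] sq_integrable_measurable
          by (intro borel_measurable_times borel_measurable_inner) auto
        show "AE x in L. X k x \<bullet> H x = 2 * (X k x $ i $ j \<bullet> grad \<phi> x)"
          using Xanti[of k j i]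
        proof eventually_elim
          case (elim x)
          then show ?case
            unfolding H_def A_def inner_plane_generator inner_diff_left by (simp only: inner_minus_left)
        qed
      qed
      then show ?thesis by simp
    qed
    then have "b = (\<lambda>k. 2 * (\<integral>x. X k x $ i $ j \<bullet> grad \<phi> x \<partial>L))" by (rule ext)
    ultimately have "(\<lambda>k. 2 * (\<integral>x. X k x $ i $ j \<bullet> grad \<phi> x \<partial>L)) \<longlonglongrightarrow> 0" by (simp only:)
    from tendsto_mult_left[OF this, of "1/2"] show ?thesis by simp
  qed
  show ?thesis
  proof (rule that[of Q G])
    show "admissible D (Q k) (G k)" for k by (rule adm)
    show "(\<integral>x. (norm (gauge_transform (Q k x) (G k x) (\<Omega> x)))\<^sup>2 \<partial>L) \<le> (\<integral>x. (norm (\<Omega> x))\<^sup>2 \<partial>L)" for k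
      using p(2)[of k] unfolding EX Ep0 X_def .
    show "(\<lambda>k. \<integral>x. gauge_transform (Q k x) (G k x) (\<Omega> x) $ i $ j \<bullet> grad \<phi> x \<partial>L) \<longlonglongrightarrow> 0"
      if "test_function D \<phi>" for \<phi> i j using lim[OF that] unfolding X_def .
  qed
qed

end

section \<open>Passage to the limit\<close>

lemma tendsto_left_mult:
  assumes "(P \<longlongrightarrow> p) F"
  shows "((\<lambda>k. left_mult (P k) X) \<longlongrightarrow> left_mult p X) F"
proof (rule vec_tendstoI, rule vec_tendstoI)
  show "((\<lambda>k. left_mult (P k) X $ i $ j) \<longlongrightarrow> left_mult p X $ i $ j) F" for i j
    unfolding left_mult_nth by (intro tendsto_intros assms)
qed

lemma tendsto_right_mult:
  assumes "(P \<longlongrightarrow> p) F"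
  shows "((\<lambda>k. right_mult X (P k)) \<longlongrightarrow> right_mult X p) F"
proof (rule vec_tendstoI, rule vec_tendstoI)
  show "((\<lambda>k. right_mult X (P k) $ i $ j) \<longlongrightarrow> right_mult X p $ i $ j) F" for i j
    unfolding right_mult_nth by (intro tendsto_intros assms)
qed

lemma tendsto_transpose:
  fixes P :: "'a \<Rightarrow> real ^ 'n ^ 'm"
  assumes "(P \<longlongrightarrow> p) F"
  shows "((\<lambda>k. transpose (P k)) \<longlongrightarrow> transpose p) F"
  unfolding transpose_def by (rule vec_tendstoI, rule vec_tendstoI) (simp, intro tendsto_intros assms)

text \<open>Positivity is not a closed condition, but for orthogonal matrices it means determinant
  1, which passes to the limit.\<close>

lemma limit_special_orthogonal:
  fixes Q :: "nat \<Rightarrow> real ^ 'n ^ 'n"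
  assumes "Q \<longlonglongrightarrow> P" "\<And>k. orthogonal_matrix (Q k) \<and> det (Q k) > 0"
  shows "orthogonal_matrix P \<and> det P > 0"
proof
  have "(\<lambda>k. transpose (Q k) ** Q k) \<longlonglongrightarrow> transpose P ** P"
    by (intro bounded_bilinear.tendsto[OF bounded_bilinear_matrix_mult] tendsto_transpose assms(1))
  moreover have "(\<lambda>k. transpose (Q k) ** Q k) = (\<lambda>k. mat 1)"
    using assms(2) by (simp add: orthogonal_matrix)
  ultimately show "orthogonal_matrix P" by (simp add: orthogonal_matrix LIMSEQ_const_iff)
  have "(\<lambda>k. det (Q k)) \<longlonglongrightarrow> det P"
    unfolding det_def by (intro tendsto_intros assms(1))
  moreover have "det (Q k) = 1" for k
    using assms(2)[of k] det_orthogonal_matrix[of "Q k"] by auto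
  ultimately show "det P > 0" by (simp add: LIMSEQ_const_iff)
qed

text \<open>A crude bound for the directional derivative by the Hilbert-Schmidt norm; any constant
  independent of the map serves, since only boundedness of the energies matters for
  compactness.\<close>

lemma norm_sum_slices_le:
  fixes G :: "real ^ 'm ^ 'n ^ 'n" and h :: "real ^ 'm"
  shows "norm (\<Sum>a\<in>UNIV. h $ a *\<^sub>R slice a G) \<le> real CARD('m) * norm G * norm h"
proof -
  have "norm (\<Sum>a\<in>UNIV. h $ a *\<^sub>R slice a G) \<le> (\<Sum>a\<in>(UNIV :: 'm set). norm h * norm G)"
  proof (rule sum_norm_le)
    fix a :: 'm
    have "(norm (slice a G))\<^sup>2 \<le> (norm G)\<^sup>2"
      unfolding norm_sq_eq_sum_slice[of G] by (rule member_le_sum) auto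
    then have "norm (slice a G) \<le> norm G" by (simp add: power2_le_iff_abs_le)
    moreover have "\<bar>h $ a\<bar> \<le> norm h" by (rule component_le_norm_cart)
    ultimately show "norm (h $ a *\<^sub>R slice a G) \<le> norm h * norm G" by (simp add: mult_mono)
  qed
  then show ?thesis by (simp add: ac_simps)
qed

lemma integral_lebesgue_on_compact_support:
  fixes f :: "real ^ 'm \<Rightarrow> real"
  assumes "open D" "continuous_on UNIV f" "\<And>x. x \<notin> D \<Longrightarrow> f x = 0"
  shows "(\<integral>x. f x \<partial>(lebesgue_on D)) = (\<integral>x. f x \<partial>lborel)"
proof -
  have "(\<integral>x. f x \<partial>(lebesgue_on D)) = (\<integral>x. indicator D x *\<^sub>R f x \<partial>lebesgue)"
    using assms(1) by (intro integral_restrict_space) auto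
  also have "(\<lambda>x. indicator D x *\<^sub>R f x) = f" by (rule ext) (use assms(3) in \<open>auto simp: indicator_def\<close>)
  finally show ?thesis
    using assms(2) by (simp add: integral_completion borel_measurable_continuous_onI)
qed

text \<open>An entry of \<open>Q\<close> need not have compact support, but its product with the
  test function does, and that product is differentiated.\<close>

lemma admissible_integration_by_parts:
  fixes Q :: "real ^ 'm \<Rightarrow> real ^ 'n ^ 'n"
  assumes D: "open D" "bounded D" and adm: "admissible D Q G" and \<phi>: "test_function D \<phi>"
  shows "(\<integral>x. Q x $ i $ j * grad \<phi> x $ a \<partial>(lebesgue_on D)) = - (\<integral>x. \<phi> x * G x $ i $ j $ a \<partial>(lebesgue_on D))"
proof -
  define S where "S = closure {x. \<phi> x \<noteq> 0}"
  have S: "compact S" "S \<subseteq> D" using \<phi> by (auto simp: S_def test_function_def)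
  have off: "\<phi> x = 0" "grad \<phi> x = 0" if "x \<notin> S" for x
    using test_function_support[OF \<phi>] that unfolding S_def by blast+
  have offD: "\<phi> x = 0" "grad \<phi> x = 0" if "x \<notin> D" for x
    using off[of x] that S(2) by blast+
  note c = admissible_continuous[OF adm] test_function_continuous[OF \<phi>] test_function_continuous_grad[OF \<phi>]
  let ?f = "\<lambda>x. Q x $ i $ j * grad \<phi> x $ a" and ?g = "\<lambda>x. \<phi> x * G x $ i $ j $ a"
  have cf: "continuous_on UNIV ?f" and cg: "continuous_on UNIV ?g"
    by (intro continuous_intros c)+
  define u' where "u' x h = Q x $ i $ j * (grad \<phi> x \<bullet> h) + (\<Sum>b\<in>UNIV. h $ b *\<^sub>R slice b (G x)) $ i $ j * \<phi> x" for x h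
  have u'a: "u' x (axis a 1) = ?f x + ?g x" for x
    by (simp add: u'_def axis_def inner_vec_def if_distrib[of "\<lambda>x. x * _"] if_distrib[of "\<lambda>x. _ * x"] cong: if_cong)
  have "(\<integral>x. u' x (axis a 1) \<partial>lborel) = 0"
  proof (rule integral_derivative_compact_support[where u="\<lambda>x. Q x $ i $ j * \<phi> x"])
    fix x
    have "(Q has_derivative (\<lambda>h. \<Sum>a\<in>UNIV. h $ a *\<^sub>R slice a (G x))) (at x)"
      using adm by (simp add: admissible_def)
    then have "((\<lambda>x. Q x $ i $ j) has_derivative (\<lambda>h. (\<Sum>a\<in>UNIV. h $ a *\<^sub>R slice a (G x)) $ i $ j)) (at x)"
      by (intro bounded_linear.has_derivative[OF bounded_linear_vec_nth])
    from has_derivative_mult[OF this test_function_has_derivative[OF \<phi>]]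
    show "((\<lambda>x. Q x $ i $ j * \<phi> x) has_derivative u' x) (at x)" unfolding u'_def .
    show "compact S" by fact
    show "Q x $ i $ j * \<phi> x = 0" "u' x (axis a 1) = 0" if "x \<notin> S" using off[OF that] by (simp_all add: u'a)
    show "continuous_on UNIV (\<lambda>x. u' x (axis a 1))" unfolding u'a by (intro continuous_on_add cf cg)
  qed
  then have "(\<integral>x. ?f x + ?g x \<partial>lborel) = 0" by (simp only: u'a)
  moreover have "integrable lborel ?f" "integrable lborel ?g"
    by (rule integrable_compact_support[OF _ S(1)], rule cf cg, simp add: off)+
  ultimately have "(\<integral>x. ?f x \<partial>lborel) = - (\<integral>x. ?g x \<partial>lborel)" by simp
  moreover have "(\<integral>x. ?f x \<partial>(lebesgue_on D)) = (\<integral>x. ?f x \<partial>lborel)"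
    "(\<integral>x. ?g x \<partial>(lebesgue_on D)) = (\<integral>x. ?g x \<partial>lborel)"
    by (rule integral_lebesgue_on_compact_support[OF D(1)], rule cf cg, simp add: offD)+
  ultimately show ?thesis by simp
qed

context gauge_problem
begin

text \<open>The energy of \<open>Q\<close> is controlled by that of its gauge transform, because
  \<open>\<nabla>Q = Q X + \<Omega> Q\<close> for \<open>X = Q\<^sup>T \<nabla>Q - Q\<^sup>T \<Omega> Q\<close> and \<open>Q\<close> is orthogonal.\<close>

lemma admissible_energy_le:
  fixes Q :: "real ^ 'm \<Rightarrow> real ^ 'n ^ 'n"
  assumes adm: "admissible D Q G"
    and le: "(\<integral>x. (norm (gauge_transform (Q x) (G x) (\<Omega> x)))\<^sup>2 \<partial>L) \<le> C" and C: "(\<integral>x. (norm (\<Omega> x))\<^sup>2 \<partial>L) = C"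
  shows "(\<integral>\<^sup>+x. ennreal ((norm (G x))\<^sup>2) \<partial>lborel) \<le> ennreal (4 * C)"
proof -
  note sq = admissible_sq_integrable[OF adm]
  let ?X = "\<lambda>x. gauge_transform (Q x) (G x) (\<Omega> x)"
  obtain K where K: "K \<subseteq> D" "\<And>x. x \<notin> K \<Longrightarrow> G x = 0" using adm unfolding admissible_def by blast
  have "(norm (G x))\<^sup>2 \<le> 2 * (norm (?X x))\<^sup>2 + 2 * (norm (\<Omega> x))\<^sup>2" for x
  proof -
    have o: "orthogonal_matrix (Q x)" using adm by (simp add: admissible_def)
    show ?thesis
      using norm_add_sq_le[of "left_mult (Q x) (?X x)" "right_mult (\<Omega> x) (Q x)"]
      unfolding gauge_transform_inverse(2)[OF o] norm_left_mult[OF o] norm_right_mult[OF o] .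
  qed
  then have "(\<integral>x. (norm (G x))\<^sup>2 \<partial>L) \<le> (\<integral>x. 2 * (norm (?X x))\<^sup>2 + 2 * (norm (\<Omega> x))\<^sup>2 \<partial>L)"
    using sq \<Omega> by (intro integral_mono) (auto simp: sq_integrable_def)
  also have "\<dots> = 2 * (\<integral>x. (norm (?X x))\<^sup>2 \<partial>L) + 2 * C"
    using sq \<Omega> C by (simp add: sq_integrable_def)
  also have "\<dots> \<le> 4 * C" using le by simp
  finally have 1: "(\<integral>x. (norm (G x))\<^sup>2 \<partial>L) \<le> 4 * C" .
  \<comment> \<open>The gradient vanishes off \<open>D\<close>, so a bound over \<open>D\<close> is
    one over the whole space, where the translation estimates take place.\<close>
  have "(\<integral>\<^sup>+x. ennreal ((norm (G x))\<^sup>2) \<partial>lborel) = (\<integral>\<^sup>+x. ennreal ((norm (G x))\<^sup>2) * indicator D x \<partial>lebesgue)"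
    unfolding nn_integral_completion by (intro nn_integral_cong) (use K in \<open>auto simp: indicator_def\<close>)
  also have "\<dots> = (\<integral>\<^sup>+x. ennreal ((norm (G x))\<^sup>2) \<partial>L)"
    using D(1) by (subst nn_integral_restrict_space) auto
  also have "\<dots> = ennreal (\<integral>x. (norm (G x))\<^sup>2 \<partial>L)"
    using sq(1) by (intro nn_integral_eq_integral) (auto simp: sq_integrable_def)
  also have "\<dots> \<le> ennreal (4 * C)" using 1 by (rule ennreal_leI)
  finally show ?thesis .
qed

text \<open>The assumption on \<open>X\<close> identifies a limit of pairings only once that limit
  is known to exist. Existence comes from the equation itself: integrating
  \<open>grad q = q Y + \<Omega> q\<close> by parts against the test function leaves
  \<open>Y\<close> paired with a strongly convergent tensor, and every other term converges by
  domination.\<close>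

lemma weak_gradient_limit:
  fixes q :: "nat \<Rightarrow> real ^ 'm \<Rightarrow> real ^ 'n ^ 'n"
  assumes adm: "\<And>k. admissible D (q k) (g k)"
    and le: "\<And>k. (\<integral>x. (norm (gauge_transform (q k x) (g k x) (\<Omega> x)))\<^sup>2 \<partial>L) \<le> C"
    and P: "P \<in> borel_measurable L" "AE x in L. (\<lambda>k. q k x) \<longlonglongrightarrow> P x"
    and X: "sq_integrable L X" "\<And>z c. sq_integrable L z \<Longrightarrow>
      (\<lambda>k. \<integral>x. gauge_transform (q k x) (g k x) (\<Omega> x) \<bullet> z x \<partial>L) \<longlonglongrightarrow> c \<Longrightarrow> (\<integral>x. X x \<bullet> z x \<partial>L) = c"
    and \<phi>: "test_function D \<phi>"
  shows "(\<integral>x. P x $ i $ j * grad \<phi> x $ a \<partial>L)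
    = - (\<integral>x. \<phi> x * (left_mult (P x) (X x) + right_mult (\<Omega> x) (P x)) $ i $ j $ a \<partial>L)"
proof -
  interpret finite_measure L by (rule finite_L)
  define Y where "Y k x = gauge_transform (q k x) (g k x) (\<Omega> x)" for k x
  have Y: "sq_integrable L (Y k)" for k unfolding Y_def by (rule admissible_sq_integrable[OF adm])
  have oq: "orthogonal_matrix (q k x)" for k x using adm by (simp add: admissible_def)
  have oP: "AE x in L. orthogonal_matrix (P x)"
    using P(2)
  proof eventually_elim
    case (elim x)
    then show ?case using limit_special_orthogonal[OF elim] adm by (simp add: admissible_def)
  qed
  have qm: "q k \<in> borel_measurable L" for k
    by (rule continuous_borel_measurable_L[OF admissible_continuous(1)[OF adm]])
  define b where "b = sqrt (real CARD('n))"
  have bq: "\<bar>q k x $ i $ j\<bar> \<le> b" for k x i j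
    using norm_orthogonal_matrix[OF oq, of k x] component_le_norm_cart[of "q k x $ i" j]
      Finite_Cartesian_Product.norm_nth_le[of "q k x" i] unfolding b_def by linarith
  have \<phi>m: "\<phi> \<in> borel_measurable L" "grad \<phi> \<in> borel_measurable L"
    by (rule continuous_borel_measurable_L test_function_continuous[OF \<phi>] test_function_continuous_grad[OF \<phi>])+
  have "\<exists>B. (\<forall>x. \<bar>\<phi> x\<bar> \<le> B) \<and> (\<forall>x. norm (grad \<phi> x) \<le> B)"
    by (rule test_function_bounded[OF \<phi>]) auto
  then obtain B where B: "\<And>x. \<bar>\<phi> x\<bar> \<le> B" "\<And>x. norm (grad \<phi> x) \<le> B" by blast
  have Bnn: "B \<ge> 0" using B(1)[of undefined] by linarith
  have bnn: "b \<ge> 0" by (simp add: b_def)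
  define \<alpha> where "\<alpha> = (\<integral>x. P x $ i $ j * grad \<phi> x $ a \<partial>L)"
  have lim\<alpha>: "(\<lambda>k. \<integral>x. q k x $ i $ j * grad \<phi> x $ a \<partial>L) \<longlonglongrightarrow> \<alpha>"
    unfolding \<alpha>_def
  proof (rule integral_dominated_convergence[where w="\<lambda>_. b * B"])
    show "(\<lambda>x. P x $ i $ j * grad \<phi> x $ a) \<in> borel_measurable L"
      by (intro borel_measurable_times borel_measurable_vec_nth P \<phi>m)
    show "(\<lambda>x. q k x $ i $ j * grad \<phi> x $ a) \<in> borel_measurable L" for k
      by (intro borel_measurable_times borel_measurable_vec_nth qm \<phi>m)
    show "integrable L (\<lambda>_. b * B)" by simp
    show "AE x in L. (\<lambda>k. q k x $ i $ j * grad \<phi> x $ a) \<longlonglongrightarrow> P x $ i $ j * grad \<phi> x $ a"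
      using P(2) by eventually_elim (intro tendsto_intros)
    show "AE x in L. norm (q k x $ i $ j * grad \<phi> x $ a) \<le> b * B" for k
    proof (rule AE_I2)
      fix x
      have "\<bar>grad \<phi> x $ a\<bar> \<le> B" using component_le_norm_cart[of "grad \<phi> x" a] B(2)[of x] by linarith
      then show "norm (q k x $ i $ j * grad \<phi> x $ a) \<le> b * B"
        unfolding real_norm_def abs_mult by (intro mult_mono bq bnn) auto
    qed
  qed
  \<comment> \<open>Pairing with \<open>W\<close> extracts the entry \<open>i j a\<close>, so that
    the matrix factor can be moved to the other side as a transpose.\<close>
  define W :: "real ^ 'm ^ 'n ^ 'n" where "W = (\<chi> k l. matrix_unit i j $ k $ l *\<^sub>R axis a 1)"
  have W: "T \<bullet> W = T $ i $ j $ a" for T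
    unfolding W_def inner_matrix_unit by (simp add: inner_axis)
  define \<beta> where "\<beta> = (\<integral>x. \<phi> x * (right_mult (\<Omega> x) (P x) \<bullet> W) \<partial>L)"
  have abs_inner_bound: "norm (\<phi> x * (T \<bullet> W)) \<le> B * (norm T * norm W)" for x T
    unfolding real_norm_def abs_mult
    by (intro mult_mono B(1) Cauchy_Schwarz_ineq2 Bnn) auto
  have \<Omega>i: "integrable L (\<lambda>x. B * (norm (\<Omega> x) * norm W))"
    by (intro integrable_mult_right integrable_mult_left integrable_norm sq_integrable_integrable[OF finite_measure_axioms \<Omega>])
  have rm: "(\<lambda>x. \<phi> x * (right_mult (\<Omega> x) (p x) \<bullet> W)) \<in> borel_measurable L" if "p \<in> borel_measurable L" for p
    by (intro borel_measurable_times \<phi>m borel_measurable_inner borel_measurable_const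
        borel_measurable_right_mult that sq_integrable_measurable[OF \<Omega>])
  have lim\<beta>: "(\<lambda>k. \<integral>x. \<phi> x * (right_mult (\<Omega> x) (q k x) \<bullet> W) \<partial>L) \<longlonglongrightarrow> \<beta>"
    unfolding \<beta>_def
  proof (rule integral_dominated_convergence[OF rm[OF P(1)] rm[OF qm] \<Omega>i])
    show "AE x in L. (\<lambda>k. \<phi> x * (right_mult (\<Omega> x) (q k x) \<bullet> W)) \<longlonglongrightarrow> \<phi> x * (right_mult (\<Omega> x) (P x) \<bullet> W)"
      using P(2) by eventually_elim (intro tendsto_intros tendsto_right_mult)
    show "AE x in L. norm (\<phi> x * (right_mult (\<Omega> x) (q k x) \<bullet> W)) \<le> B * (norm (\<Omega> x) * norm W)" for k
      using abs_inner_bound[of x "right_mult (\<Omega> x) (q k x)" for x] by (simp add: norm_right_mult[OF oq])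
  qed
  \<comment> \<open>The test tensor that absorbs left multiplication by \<open>p\<close>: pairing
    \<open>T\<close> with it gives the test function times the entry \<open>i j a\<close> of
    \<open>p T\<close>.\<close>
  define Z where "Z p x = \<phi> x *\<^sub>R left_mult (transpose (p x)) W" for p x
  have Zm: "Z p \<in> borel_measurable L" if "p \<in> borel_measurable L" for p
    unfolding Z_def by (intro borel_measurable_scaleR \<phi>m borel_measurable_left_mult borel_measurable_transpose that borel_measurable_const)
  have Zb: "norm (Z p x) \<le> B * norm W" if "orthogonal_matrix (p x)" for p x
    unfolding Z_def using that B(1)[of x] by (simp add: norm_left_mult mult_right_mono)
  have Zsq: "sq_integrable L (Z p)" if "p \<in> borel_measurable L" "AE x in L. orthogonal_matrix (p x)" for p
  proof (rule sq_integrable_bounded[OF finite_measure_axioms Zm[OF that(1)]])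
    show "AE x in L. norm (Z p x) \<le> B * norm W" using that(2) by eventually_elim (rule Zb)
  qed
  have Zq: "sq_integrable L (Z (q k))" for k by (intro Zsq qm AE_I2 oq)
  have ZP: "sq_integrable L (Z P)" by (intro Zsq P oP)
  have Zinner: "T \<bullet> Z p x = \<phi> x * (left_mult (p x) T \<bullet> W)" for T p x
    by (simp add: Z_def inner_left_mult)
  have limZ: "(\<lambda>k. \<integral>x. (norm (Z (q k) x - Z P x))\<^sup>2 \<partial>L) \<longlonglongrightarrow> 0"
  proof -
    have "(\<lambda>k. \<integral>x. (norm (Z (q k) x - Z P x))\<^sup>2 \<partial>L) \<longlonglongrightarrow> (\<integral>x. 0 \<partial>L)"
    proof (rule integral_dominated_convergence[where w="\<lambda>_. (2 * (B * norm W))\<^sup>2"])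
      show "(\<lambda>x. (norm (Z (q k) x - Z P x))\<^sup>2) \<in> borel_measurable L" for k
        using sq_integrable_diff[OF Zq ZP, of k] by (auto simp: sq_integrable_def)
      show "AE x in L. (\<lambda>k. (norm (Z (q k) x - Z P x))\<^sup>2) \<longlonglongrightarrow> 0"
        using P(2)
      proof eventually_elim
        case (elim x)
        have "(\<lambda>k. (norm (Z (q k) x - Z P x))\<^sup>2) \<longlonglongrightarrow> (norm (Z P x - Z P x))\<^sup>2"
          unfolding Z_def by (intro tendsto_intros tendsto_left_mult tendsto_transpose elim)
        then show ?case by simp
      qed
      show "AE x in L. norm ((norm (Z (q k) x - Z P x))\<^sup>2) \<le> (2 * (B * norm W))\<^sup>2" for k
        using oP
      proof eventually_elim
        case (elim x)
        have "norm (Z (q k) x - Z P x) \<le> 2 * (B * norm W)"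
          using norm_triangle_ineq4[of "Z (q k) x" "Z P x"] Zb[of "q k" x, OF oq] Zb[of P x, OF elim] by linarith
        then have "(norm (Z (q k) x - Z P x))\<^sup>2 \<le> (2 * (B * norm W))\<^sup>2" by (intro power_mono) auto
        then show ?case by simp
      qed
    qed simp_all
    then show ?thesis by simp
  qed
  \<comment> \<open>Weak against strong: the first factor is bounded by \<open>sqrt C\<close> in the
    square mean, and the second tends to zero there.\<close>
  have lim0: "(\<lambda>k. \<integral>x. Y k x \<bullet> (Z (q k) x - Z P x) \<partial>L) \<longlonglongrightarrow> 0"
  proof (rule Lim_null_comparison)
    have "(\<lambda>k. sqrt C * sqrt (\<integral>x. (norm (Z (q k) x - Z P x))\<^sup>2 \<partial>L)) \<longlonglongrightarrow> sqrt C * sqrt 0"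
      by (intro tendsto_intros limZ)
    then show "(\<lambda>k. sqrt C * sqrt (\<integral>x. (norm (Z (q k) x - Z P x))\<^sup>2 \<partial>L)) \<longlonglongrightarrow> 0" by simp
    have "norm (\<integral>x. Y k x \<bullet> (Z (q k) x - Z P x) \<partial>L) \<le> sqrt C * sqrt (\<integral>x. (norm (Z (q k) x - Z P x))\<^sup>2 \<partial>L)" for k
    proof -
      have "sqrt (\<integral>x. (norm (Y k x))\<^sup>2 \<partial>L) \<le> sqrt C" using le[of k] unfolding Y_def by (rule real_sqrt_le_mono)
      then have "sqrt (\<integral>x. (norm (Y k x))\<^sup>2 \<partial>L) * sqrt (\<integral>x. (norm (Z (q k) x - Z P x))\<^sup>2 \<partial>L)
          \<le> sqrt C * sqrt (\<integral>x. (norm (Z (q k) x - Z P x))\<^sup>2 \<partial>L)"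
        by (rule mult_right_mono) simp
      with abs_integral_inner_le[OF Y sq_integrable_diff[OF Zq ZP], of k k]
      show ?thesis unfolding real_norm_def by (rule order_trans)
    qed
    then show "\<forall>\<^sub>F k in sequentially. norm (\<integral>x. Y k x \<bullet> (Z (q k) x - Z P x) \<partial>L) \<le> sqrt C * sqrt (\<integral>x. (norm (Z (q k) x - Z P x))\<^sup>2 \<partial>L)"
      by (intro always_eventually allI)
  qed
  have right_int: "integrable L (\<lambda>x. \<phi> x * (right_mult (\<Omega> x) (p x) \<bullet> W))"
    if "p \<in> borel_measurable L" "AE x in L. orthogonal_matrix (p x)" for p
  proof (rule Bochner_Integration.integrable_bound[OF \<Omega>i rm[OF that(1)]])
    show "AE x in L. norm (\<phi> x * (right_mult (\<Omega> x) (p x) \<bullet> W)) \<le> norm (B * (norm (\<Omega> x) * norm W))"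
      using that(2)
    proof eventually_elim
      case (elim x)
      have "B * (norm (\<Omega> x) * norm W) \<ge> 0" using Bnn by simp
      then show ?case using abs_inner_bound[of x "right_mult (\<Omega> x) (p x)"] by (simp only: norm_right_mult[OF elim] real_norm_def abs_of_nonneg)
    qed
  qed
  have YZ: "(\<integral>x. Y k x \<bullet> Z (q k) x \<partial>L)
      = - (\<integral>x. q k x $ i $ j * grad \<phi> x $ a \<partial>L) - (\<integral>x. \<phi> x * (right_mult (\<Omega> x) (q k x) \<bullet> W) \<partial>L)" for k
  proof -
    have "\<phi> x * g k x $ i $ j $ a = Y k x \<bullet> Z (q k) x + \<phi> x * (right_mult (\<Omega> x) (q k x) \<bullet> W)" for x
    proof -
      have "g k x = left_mult (q k x) (Y k x) + right_mult (\<Omega> x) (q k x)"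
        unfolding Y_def by (rule gauge_transform_inverse(2)[OF oq, symmetric])
      then have "g k x \<bullet> W = (left_mult (q k x) (Y k x) + right_mult (\<Omega> x) (q k x)) \<bullet> W" by (rule arg_cong)
      then show ?thesis unfolding W Zinner inner_add_left by (simp add: distrib_left)
    qed
    then have "(\<integral>x. \<phi> x * g k x $ i $ j $ a \<partial>L)
        = (\<integral>x. Y k x \<bullet> Z (q k) x \<partial>L) + (\<integral>x. \<phi> x * (right_mult (\<Omega> x) (q k x) \<bullet> W) \<partial>L)"
      using sq_integrable_inner[OF Y Zq] right_int[OF qm] oq by simp
    then show ?thesis using admissible_integration_by_parts[OF D adm \<phi>, of k i j a] by linarith
  qed
  \<comment> \<open>The varying tensor \<open>Z (q k)\<close> is replaced by the fixed
    \<open>Z P\<close>, which makes the pairing one to which the assumption on \<open>X\<close>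
    applies.\<close>
  have "(\<lambda>k. \<integral>x. Y k x \<bullet> Z P x \<partial>L) \<longlonglongrightarrow> - \<alpha> - \<beta> - 0"
  proof -
    have "(\<integral>x. Y k x \<bullet> Z P x \<partial>L)
      = (- (\<integral>x. q k x $ i $ j * grad \<phi> x $ a \<partial>L) - (\<integral>x. \<phi> x * (right_mult (\<Omega> x) (q k x) \<bullet> W) \<partial>L))
        - (\<integral>x. Y k x \<bullet> (Z (q k) x - Z P x) \<partial>L)" for k
      unfolding YZ[symmetric] using sq_integrable_inner[OF Y Zq, of k k] sq_integrable_inner[OF Y ZP, of k]
      by (simp add: inner_diff_right)
    then show ?thesis by (simp only:) (intro tendsto_intros lim\<alpha> lim\<beta> lim0)
  qed
  then have XZ: "(\<integral>x. X x \<bullet> Z P x \<partial>L) = - \<alpha> - \<beta> - 0" unfolding Y_def by (rule X(2)[OF ZP])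
  have "\<phi> x * (left_mult (P x) (X x) + right_mult (\<Omega> x) (P x)) $ i $ j $ a
      = X x \<bullet> Z P x + \<phi> x * (right_mult (\<Omega> x) (P x) \<bullet> W)" for x
    unfolding W[symmetric] Zinner by (simp add: inner_add_left distrib_left)
  then have "(\<integral>x. \<phi> x * (left_mult (P x) (X x) + right_mult (\<Omega> x) (P x)) $ i $ j $ a \<partial>L)
      = (\<integral>x. X x \<bullet> Z P x \<partial>L) + \<beta>"
    using sq_integrable_inner[OF X(1) ZP] right_int[OF P(1) oP] unfolding \<beta>_def by simp
  then show ?thesis using XZ unfolding \<alpha>_def by simp
qed

lemma coulomb_gauge_exists:
  obtains P :: "real ^ 'm \<Rightarrow> real ^ 'n ^ 'n" and G
  where "P \<in> borel_measurable L" "AE x in L. orthogonal_matrix (P x) \<and> det (P x) > 0" "sq_integrable L G"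
    "sq_integrable L (\<lambda>x. gauge_transform (P x) (G x) (\<Omega> x))"
    "\<And>\<phi> i j a. test_function D \<phi> \<Longrightarrow> (\<integral>x. P x $ i $ j * grad \<phi> x $ a \<partial>L) = - (\<integral>x. \<phi> x * G x $ i $ j $ a \<partial>L)"
    "\<And>\<phi> i j. test_function D \<phi> \<Longrightarrow> (\<integral>x. gauge_transform (P x) (G x) (\<Omega> x) $ i $ j \<bullet> grad \<phi> x \<partial>L) = 0"
    "sqrt (\<integral>x. (norm (G x))\<^sup>2 \<partial>L) + sqrt (\<integral>x. (norm (gauge_transform (P x) (G x) (\<Omega> x)))\<^sup>2 \<partial>L)
      \<le> 3 * sqrt (\<integral>x. (norm (\<Omega> x))\<^sup>2 \<partial>L)"
proof -
  define C where "C = (\<integral>x. (norm (\<Omega> x))\<^sup>2 \<partial>L)"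
  have "\<exists>Q G. (\<forall>k. admissible D (Q k :: real ^ 'm \<Rightarrow> real ^ 'n ^ 'n) (G k)) \<and>
    (\<forall>k. (\<integral>x. (norm (gauge_transform (Q k x) (G k x) (\<Omega> x)))\<^sup>2 \<partial>L) \<le> C) \<and>
    (\<forall>\<phi> i j. test_function D \<phi> \<longrightarrow> (\<lambda>k. \<integral>x. gauge_transform (Q k x) (G k x) (\<Omega> x) $ i $ j \<bullet> grad \<phi> x \<partial>L) \<longlonglongrightarrow> 0)"
    by (rule minimizing_sequence) (unfold C_def, blast)
  then obtain Q G where adm: "\<And>k. admissible D (Q k :: real ^ 'm \<Rightarrow> real ^ 'n ^ 'n) (G k)"
    and le: "\<And>k. (\<integral>x. (norm (gauge_transform (Q k x) (G k x) (\<Omega> x)))\<^sup>2 \<partial>L) \<le> C"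
    and div: "\<And>\<phi> i j. test_function D \<phi> \<Longrightarrow> (\<lambda>k. \<integral>x. gauge_transform (Q k x) (G k x) (\<Omega> x) $ i $ j \<bullet> grad \<phi> x \<partial>L) \<longlonglongrightarrow> 0"
    by blast
  let ?c = "real CARD('m)"
  have Gm: "G k \<in> borel_measurable borel" for k
    by (rule borel_measurable_continuous_onI[OF admissible_continuous(2)[OF adm]])
  \<comment> \<open>The bound \<open>N\<close> is the Hilbert-Schmidt norm of the gradient times the
    factor of \<open>norm_sum_slices_le\<close>; squaring that factor and using the energy bound
    \<open>4 * C\<close> gives the constant \<open>E\<close>.\<close>
  have "\<exists>r P. strict_mono (r :: nat \<Rightarrow> nat) \<and> P \<in> borel_measurable L \<and> (AE x in L. (\<lambda>k. Q (r k) x) \<longlonglongrightarrow> P x)"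
  proof (rule AE_convergent_subsequence_bounded_energy[where f=Q and N="\<lambda>k x. ?c * norm (G k x)"
        and f'="\<lambda>k x h. \<Sum>a\<in>UNIV. h $ a *\<^sub>R slice a (G k x)" and B="sqrt (real CARD('n))" and E="?c\<^sup>2 * (4 * C)", OF _ _ _ _ _ _ D])
    fix k
    show "(Q k has_derivative (\<lambda>h. \<Sum>a\<in>UNIV. h $ a *\<^sub>R slice a (G k x))) (at x)" for x
      using adm by (simp add: admissible_def)
    show "continuous_on UNIV (\<lambda>x. \<Sum>a\<in>UNIV. h $ a *\<^sub>R slice a (G k x))" for h
      by (intro continuous_intros continuous_on_slice admissible_continuous(2)[OF adm])
    show "(\<lambda>x. ?c * norm (G k x)) \<in> borel_measurable borel"
      using Gm[of k] by measurable
    show "norm (\<Sum>a\<in>UNIV. h $ a *\<^sub>R slice a (G k x)) \<le> ?c * norm (G k x) * norm h" for x h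
      by (rule norm_sum_slices_le)
    show "norm (Q k x) \<le> sqrt (real CARD('n))" for x
      using adm by (simp add: admissible_def norm_orthogonal_matrix)
    have "(\<integral>\<^sup>+x. ennreal ((?c * norm (G k x))\<^sup>2) \<partial>lborel) = ennreal (?c\<^sup>2) * (\<integral>\<^sup>+x. ennreal ((norm (G k x))\<^sup>2) \<partial>lborel)"
      using Gm by (subst nn_integral_cmult[symmetric]) (auto simp: power_mult_distrib ennreal_mult)
    also have "\<dots> \<le> ennreal (?c\<^sup>2) * ennreal (4 * C)"
      by (intro mult_left_mono admissible_energy_le[OF adm le C_def[symmetric]]) simp
    finally show "(\<integral>\<^sup>+x. ennreal ((?c * norm (G k x))\<^sup>2) \<partial>lborel) \<le> ennreal (?c\<^sup>2 * (4 * C))"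
      by (simp add: ennreal_mult C_def)
  qed blast
  then obtain r P where r: "strict_mono (r :: nat \<Rightarrow> nat)" and P: "P \<in> borel_measurable L" "AE x in L. (\<lambda>k. Q (r k) x) \<longlonglongrightarrow> P x"
    by blast
  have so: "AE x in L. orthogonal_matrix (P x) \<and> det (P x) > 0"
    using P(2)
  proof eventually_elim
    case (elim x)
    then show ?case by (rule limit_special_orthogonal) (use adm in \<open>simp add: admissible_def\<close>)
  qed
  then have oP: "AE x in L. orthogonal_matrix (P x)" by eventually_elim blast
  define Y where "Y k x = gauge_transform (Q (r k) x) (G (r k) x) (\<Omega> x)" for k x
  have Ysq: "sq_integrable L (Y k)" for k unfolding Y_def by (rule admissible_sq_integrable[OF adm])
  have Yle: "(\<integral>x. (norm (Y k x))\<^sup>2 \<partial>L) \<le> C" for k unfolding Y_def by (rule le)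
  have "\<exists>X. sq_integrable L X \<and> (\<integral>x. (norm (X x))\<^sup>2 \<partial>L) \<le> C \<and>
    (\<forall>z c. sq_integrable L z \<longrightarrow> (\<lambda>k. \<integral>x. Y k x \<bullet> z x \<partial>L) \<longlonglongrightarrow> c \<longrightarrow> (\<integral>x. X x \<bullet> z x \<partial>L) = c)"
    by (rule sq_integrable_weak_cluster[where f=Y, OF finite_L Ysq Yle]) blast
  then obtain X where X: "sq_integrable L X" "(\<integral>x. (norm (X x))\<^sup>2 \<partial>L) \<le> C"
    "\<And>z c. sq_integrable L z \<Longrightarrow> (\<lambda>k. \<integral>x. Y k x \<bullet> z x \<partial>L) \<longlonglongrightarrow> c \<Longrightarrow> (\<integral>x. X x \<bullet> z x \<partial>L) = c"
    by blast
  \<comment> \<open>The candidate gradient is defined by inverting the gauge transform at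
    \<open>X\<close>; that it is the weak gradient of \<open>P\<close> is then the content of
    \<open>weak_gradient_limit\<close>.\<close>
  define H where "H x = left_mult (P x) (X x) + right_mult (\<Omega> x) (P x)" for x
  have sql: "sq_integrable L (\<lambda>x. left_mult (P x) (X x))" and sqr: "sq_integrable L (\<lambda>x. right_mult (\<Omega> x) (P x))"
    by (rule sq_integrable_left_mult[OF P(1) X(1) oP] sq_integrable_right_mult[OF P(1) \<Omega> oP])+
  have Hsq: "sq_integrable L H" unfolding H_def by (rule sq_integrable_add[OF sql sqr])
  have gsq: "sq_integrable L (\<lambda>x. gauge_transform (P x) (H x) (\<Omega> x))"
    by (rule sq_integrable_gauge_transform[OF P(1) Hsq \<Omega> oP])
  have gX: "AE x in L. gauge_transform (P x) (H x) (\<Omega> x) = X x"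
    using oP unfolding H_def by eventually_elim (rule gauge_transform_inverse(1))
  have gauge_norm: "(\<integral>x. (norm (gauge_transform (P x) (H x) (\<Omega> x)))\<^sup>2 \<partial>L) = (\<integral>x. (norm (X x))\<^sup>2 \<partial>L)"
    by (rule integral_cong_AE) (use gX gsq X(1) in \<open>auto simp: sq_integrable_def\<close>)
  have "(\<integral>x. (norm (left_mult (P x) (X x)))\<^sup>2 \<partial>L) = (\<integral>x. (norm (X x))\<^sup>2 \<partial>L)"
  proof (rule integral_cong_AE)
    show "AE x in L. (norm (left_mult (P x) (X x)))\<^sup>2 = (norm (X x))\<^sup>2"
      using oP by eventually_elim (simp add: norm_left_mult)
  qed (use sql X(1) in \<open>auto simp: sq_integrable_def\<close>)
  moreover have "(\<integral>x. (norm (right_mult (\<Omega> x) (P x)))\<^sup>2 \<partial>L) = C"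
    unfolding C_def
  proof (rule integral_cong_AE)
    show "AE x in L. (norm (right_mult (\<Omega> x) (P x)))\<^sup>2 = (norm (\<Omega> x))\<^sup>2"
      using oP by eventually_elim (simp add: norm_right_mult)
  qed (use sqr \<Omega> in \<open>auto simp: sq_integrable_def\<close>)
  ultimately have "sqrt (\<integral>x. (norm (H x))\<^sup>2 \<partial>L) \<le> sqrt (\<integral>x. (norm (X x))\<^sup>2 \<partial>L) + sqrt C"
    using sqrt_integral_norm_sq_add_le[OF sql sqr] unfolding H_def by simp
  moreover have sC: "sqrt (\<integral>x. (norm (X x))\<^sup>2 \<partial>L) \<le> sqrt C" using X(2) by simp
  ultimately have bound: "sqrt (\<integral>x. (norm (H x))\<^sup>2 \<partial>L) + sqrt (\<integral>x. (norm (gauge_transform (P x) (H x) (\<Omega> x)))\<^sup>2 \<partial>L) \<le> 3 * sqrt C"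
    unfolding gauge_norm by linarith
  show ?thesis
  proof (rule that[of P H])
    show "(\<integral>x. P x $ i $ j * grad \<phi> x $ a \<partial>L) = - (\<integral>x. \<phi> x * H x $ i $ j $ a \<partial>L)"
      if "test_function D \<phi>" for \<phi> i j a
      unfolding H_def
      by (rule weak_gradient_limit[where q="\<lambda>k. Q (r k)" and g="\<lambda>k. G (r k)", OF adm le P X(1) X(3)[unfolded Y_def] that])
    show "(\<integral>x. gauge_transform (P x) (H x) (\<Omega> x) $ i $ j \<bullet> grad \<phi> x \<partial>L) = 0"
      if \<phi>: "test_function D \<phi>" for \<phi> i j
    proof -
      \<comment> \<open>This tensor does not depend on \<open>k\<close>, so the vanishing of the
        divergences in the limit, which is inherited by the subsequence, is a statement about weak
        pairings and transfers to \<open>X\<close>.\<close>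
      let ?z = "\<lambda>x. \<chi> k l. matrix_unit i j $ k $ l *\<^sub>R grad \<phi> x"
      have zsq: "sq_integrable L ?z" by (rule sq_integrable_test_tensor[OF \<phi>])
      have "(\<lambda>k. \<integral>x. Y k x \<bullet> ?z x \<partial>L) \<longlonglongrightarrow> 0"
        using LIMSEQ_subseq_LIMSEQ[OF div[OF \<phi>] r] unfolding Y_def inner_matrix_unit o_def .
      then have 0: "(\<integral>x. X x \<bullet> ?z x \<partial>L) = 0" by (rule X(3)[OF zsq])
      have "(\<integral>x. gauge_transform (P x) (H x) (\<Omega> x) \<bullet> ?z x \<partial>L) = (\<integral>x. X x \<bullet> ?z x \<partial>L)"
      proof (rule integral_cong_AE)
        show "AE x in L. gauge_transform (P x) (H x) (\<Omega> x) \<bullet> ?z x = X x \<bullet> ?z x"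
          using gX by eventually_elim simp
      qed (use sq_integrable_inner[OF gsq zsq] sq_integrable_inner[OF X(1) zsq] in \<open>auto dest: borel_measurable_integrable\<close>)
      then show ?thesis using 0 unfolding inner_matrix_unit by simp
    qed
  qed (use P so Hsq gsq bound in \<open>simp_all add: C_def\<close>)
qed

end

section \<open>Conclusion in terms of weak gradients and divergences\<close>

lemma integrable_imp_locally_integrable_on:
  fixes f :: "'a::euclidean_space \<Rightarrow> 'b::euclidean_space"
  assumes "open D" "integrable (lebesgue_on D) f"
  shows "locally_integrable_on D f"
  unfolding locally_integrable_on_def
proof safe
  fix K assume K: "compact K" "K \<subseteq> D"
  have "f absolutely_integrable_on D"
    using assms by (simp add: set_integrable_def integrable_restrict_space)
  then show "f absolutely_integrable_on K"
    by (rule set_integrable_subset) (use K in \<open>auto simp: compact_imp_closed lmeasurable_compact fmeasurableD\<close>)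
qed

theorem theorem2p1:
  fixes D :: "(real ^ 'm::finite) set"
    and \<Omega> :: "real ^ 'm \<Rightarrow> real ^ 'm ^ 'n::finite ^ 'n"
  assumes "smoothly_bounded_domain D"
    and "\<And>i j. (\<lambda>x. \<Omega> x $ i $ j) \<in> L2_on D"
    and "\<And>i j. AE x in lebesgue_on D. \<Omega> x $ i $ j = - \<Omega> x $ j $ i"
  shows "\<exists>P G. P \<in> W12_SO D \<and> has_weak_gradient_matrix D P G \<and>
           (\<forall>i j. has_weak_divergence D (\<lambda>x. gauge_transform (P x) (G x) (\<Omega> x) $ i $ j) (\<lambda>x. 0)) \<and>
           L2_norm_on D G + L2_norm_on D (\<lambda>x. gauge_transform (P x) (G x) (\<Omega> x))
             \<le> 3 * L2_norm_on D \<Omega>"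
proof -
  let ?L = "lebesgue_on D"
  have D: "open D" "bounded D" using assms(1) by (auto simp: smoothly_bounded_domain_def)
  have "sq_integrable ?L \<Omega>"
    by (rule sq_integrable_vecI, rule sq_integrable_vecI) (rule assms(2)[unfolded L2_on_iff_sq_integrable])
  \<comment> \<open>The exceptional null set may depend on the pair of indices; there are finitely
    many pairs, so one null set serves for all.\<close>
  moreover have "AE x in ?L. \<forall>i j. \<Omega> x $ i $ j = - \<Omega> x $ j $ i"
    using assms(3) by (simp add: AE_all_countable)
  ultimately interpret gauge_problem D \<Omega> by unfold_locales (use D in auto)
  note int = sq_integrable_integrable[OF finite_L]
  have "\<exists>P G. P \<in> borel_measurable ?L \<and> (AE x in ?L. orthogonal_matrix (P x) \<and> det (P x) > 0) \<and> sq_integrable ?L G \<and>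
    sq_integrable ?L (\<lambda>x. gauge_transform (P x) (G x) (\<Omega> x)) \<and>
    (\<forall>\<phi> i j a. test_function D \<phi> \<longrightarrow> (\<integral>x. P x $ i $ j * grad \<phi> x $ a \<partial>?L) = - (\<integral>x. \<phi> x * G x $ i $ j $ a \<partial>?L)) \<and>
    (\<forall>\<phi> i j. test_function D \<phi> \<longrightarrow> (\<integral>x. gauge_transform (P x) (G x) (\<Omega> x) $ i $ j \<bullet> grad \<phi> x \<partial>?L) = 0) \<and>
    sqrt (\<integral>x. (norm (G x))\<^sup>2 \<partial>?L) + sqrt (\<integral>x. (norm (gauge_transform (P x) (G x) (\<Omega> x)))\<^sup>2 \<partial>?L)
      \<le> 3 * sqrt (\<integral>x. (norm (\<Omega> x))\<^sup>2 \<partial>?L)"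
    by (rule coulomb_gauge_exists) blast
  then obtain P G where P: "P \<in> borel_measurable ?L" "AE x in ?L. orthogonal_matrix (P x) \<and> det (P x) > 0"
    and G: "sq_integrable ?L G"
    and X: "sq_integrable ?L (\<lambda>x. gauge_transform (P x) (G x) (\<Omega> x))"
    and wg: "\<And>\<phi> i j a. test_function D \<phi> \<Longrightarrow> (\<integral>x. P x $ i $ j * grad \<phi> x $ a \<partial>?L) = - (\<integral>x. \<phi> x * G x $ i $ j $ a \<partial>?L)"
    and wd: "\<And>\<phi> i j. test_function D \<phi> \<Longrightarrow> (\<integral>x. gauge_transform (P x) (G x) (\<Omega> x) $ i $ j \<bullet> grad \<phi> x \<partial>?L) = 0"
    and bound: "sqrt (\<integral>x. (norm (G x))\<^sup>2 \<partial>?L) + sqrt (\<integral>x. (norm (gauge_transform (P x) (G x) (\<Omega> x)))\<^sup>2 \<partial>?L)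
      \<le> 3 * sqrt (\<integral>x. (norm (\<Omega> x))\<^sup>2 \<partial>?L)"
    by blast
  have Psq: "sq_integrable ?L P"
  proof (rule sq_integrable_bounded[OF finite_L P(1)])
    show "AE x in ?L. norm (P x) \<le> sqrt (real CARD('n))"
      using P(2) by eventually_elim (simp add: norm_orthogonal_matrix)
  qed
  have Pij: "sq_integrable ?L (\<lambda>x. P x $ i $ j)" and Gij: "sq_integrable ?L (\<lambda>x. G x $ i $ j)"
    and Xij: "sq_integrable ?L (\<lambda>x. gauge_transform (P x) (G x) (\<Omega> x) $ i $ j)" for i j
    by (intro sq_integrable_vec_nth Psq G X)+
  have weak: "has_weak_gradient D (\<lambda>x. P x $ i $ j) (\<lambda>x. G x $ i $ j)" for i j
    unfolding has_weak_gradient_def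
  proof (intro conjI allI impI)
    show "locally_integrable_on D (\<lambda>x. P x $ i $ j)" "locally_integrable_on D (\<lambda>x. G x $ i $ j)"
      by (rule integrable_imp_locally_integrable_on[OF D(1) int[OF Pij]] integrable_imp_locally_integrable_on[OF D(1) int[OF Gij]])+
    fix \<phi> assume \<phi>: "test_function D \<phi>"
    have "\<exists>B. (\<forall>x. \<bar>\<phi> x\<bar> \<le> B) \<and> (\<forall>x. norm (grad \<phi> x) \<le> B)"
      by (rule test_function_bounded[OF \<phi>]) auto
    then obtain B where B: "\<And>x. \<bar>\<phi> x\<bar> \<le> B" "\<And>x. norm (grad \<phi> x) \<le> B" by blast
    have "sq_integrable ?L (\<lambda>x. \<phi> x *\<^sub>R G x $ i $ j)"
      by (rule sq_integrable_bounded_mult[OF Gij continuous_borel_measurable_L[OF test_function_continuous[OF \<phi>]], where B=B]) (simp add: B)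
    then have i1: "integrable ?L (\<lambda>x. \<phi> x *\<^sub>R G x $ i $ j)" by (rule int)
    have "AE x in ?L. \<bar>P x $ i $ j\<bar> \<le> sqrt (real CARD('n))"
      using P(2)
    proof eventually_elim
      case (elim x)
      then have "norm (P x) = sqrt (real CARD('n))" by (simp add: norm_orthogonal_matrix)
      then show ?case
        using component_le_norm_cart[of "P x $ i" j] Finite_Cartesian_Product.norm_nth_le[of "P x" i] by linarith
    qed
    moreover have "sq_integrable ?L (grad \<phi>)"
      by (rule sq_integrable_bounded[OF finite_L continuous_borel_measurable_L[OF test_function_continuous_grad[OF \<phi>]], where B=B]) (simp add: B)
    ultimately have "sq_integrable ?L (\<lambda>x. P x $ i $ j *\<^sub>R grad \<phi> x)"
      using sq_integrable_bounded_mult sq_integrable_measurable[OF Pij] by blast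
    then have i2: "integrable ?L (\<lambda>x. P x $ i $ j *\<^sub>R grad \<phi> x)" by (rule int)
    \<comment> \<open>The scalar identities are assembled into one between vector-valued integrals.
      Components commute with the integral for integrable maps, which is why \<open>i1\<close> and
      \<open>i2\<close> were established.\<close>
    have nth: "(\<integral>x. f x \<partial>?L) $ a = (\<integral>x. f x $ a \<partial>?L)" if "integrable ?L f" for f :: "real ^ 'm \<Rightarrow> real ^ 'm" and a
      using integral_bounded_linear[OF bounded_linear_vec_nth that] by simp
    show "(\<integral>x. P x $ i $ j *\<^sub>R grad \<phi> x \<partial>?L) = - (\<integral>x. \<phi> x *\<^sub>R G x $ i $ j \<partial>?L)"
      unfolding vec_eq_iff
    proof
      fix a
      show "(\<integral>x. P x $ i $ j *\<^sub>R grad \<phi> x \<partial>?L) $ a = (- (\<integral>x. \<phi> x *\<^sub>R G x $ i $ j \<partial>?L)) $ a"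
        unfolding vector_uminus_component nth[OF i1] nth[OF i2] using wg[OF \<phi>, of i j a] by simp
    qed
  qed
  have "P \<in> W12_SO D"
    unfolding W12_SO_def W12_def L2_on_iff_sq_integrable using P(2) Pij Gij weak by blast
  moreover have "has_weak_gradient_matrix D P G" using weak by (simp add: has_weak_gradient_matrix_def)
  moreover have "has_weak_divergence D (\<lambda>x. gauge_transform (P x) (G x) (\<Omega> x) $ i $ j) (\<lambda>x. 0)" for i j
    unfolding has_weak_divergence_def
  proof (intro conjI allI impI)
    show "locally_integrable_on D (\<lambda>x. gauge_transform (P x) (G x) (\<Omega> x) $ i $ j)"
      by (rule integrable_imp_locally_integrable_on[OF D(1) int[OF Xij]])
    show "locally_integrable_on D (\<lambda>x. 0 :: real)"
      by (rule integrable_imp_locally_integrable_on[OF D(1)]) simp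
  qed (simp add: wd)
  ultimately show ?thesis using bound unfolding L2_norm_on_def by blast
qed

end
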